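(* Let $\mathfrak g$ be a finite-dimensional Lie algebra, simple or abelian, equipped with a nondegenerate symmetric invariant bilinear form $(\cdot|\cdot)$ (normalized so that long roots have square length $2$ when $\mathfrak g$ is simple), let $h^\vee$ be the dual Coxeter number of $\mathfrak g$ if $\mathfrak g$ is simple and $h^\vee=0$ if $\mathfrak g$ is abelian, and let $\kappa\in\mathbb C$, $\kappa\ne-h^\vee$. Let $\varphi$ be an automorphism of $\mathfrak g$ preserving $(\cdot|\cdot)$, with induced automorphism $\varphi$ of $V^\kappa(\mathfrak g)$. Let $\{v_i\}$ and $\{v^i\}$ be dual bases of $\mathfrak g$ with respect to $(\cdot|\cdot)$ and $\omega=\frac1{2(\kappa+h^\vee)}\sum_{i=1}^{\dim\mathfrak g}v^i_{(-1)}v_i\in V^\kappa(\mathfrak g)$. Then in every $\varphi$-twisted $V^\kappa(\mathfrak g)$-module $W$ we have $$2(\kappa+h^\vee)\,Y(\omega,z)=\sum_{i=1}^{\dim\mathfrak g}{:}X(v^i,z)X(v_i,z){:}\;-\;z^{-1}X(\bar\omega,z)\;-\;z^{-2}\,\kappa\,\mathrm{tr}\binom{\mathcal S}{2}\,I ,$$ where $$\bar\omega=\sum_{i=1}^{\dim\mathfrak g}\bigl[(\mathcal S+\mathcal N)v^i,v_i\bigr].$$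
   Context: All vector spaces are over $\mathbb C$, $\mathrm i=\sqrt{-1}$; $D^{(k)}=D^k/k!$ for an operator $D$. $z,z_1,z_2,\dots$ are commuting formal variables, $\zeta,\zeta_1,\zeta_2,\dots$ are further formal variables (thought of as $\zeta=\log z$, $\zeta_i=\log z_i$), and $z_{ij}=z_i-z_j$. Put $D_z=\partial_z+z^{-1}\partial_\zeta$, $D_\zeta=z\partial_z+\partial_\zeta$, and similarly $D_{z_i},D_{\zeta_i}$. Logarithmic fields. For a vector space $W$ and $\alpha\in\mathbb C/\mathbb Z$, $W[\zeta][[z]]z^{-\alpha}$ is the space of formal series $\sum_{i\ge0}w_i(\zeta)z^{i-m}$ with $w_i(\zeta)\in W[\zeta]$, $m\in\alpha$. Let $\mathrm{LFie}_\alpha(W)=\mathrm{Hom}_{\mathbb C}(W,W[\zeta][[z]]z^{-\alpha})$ and $\mathrm{LFie}(W)=\bigoplus_{\alpha\in\mathbb C/\mathbb Z}\mathrm{LFie}_\alpha(W)$; its elements are called logarithmic fields. Two logarithmic fields $a,b$ are local if $z_{12}^N a(z_1)b(z_2)=z_{12}^N b(z_2)a(z_1)$ for some integer $N\ge0$. For local $a,b$ and $n\in\mathbb Z$, the $n$-th product is $(a_{(n)}b)(z)v=D_{z_1}^{(N-1-n)}\bigl(z_{12}^N a(z_1)b(z_2)v\bigr)\big|_{z_1=z_2=z,\ \zeta_1=\zeta_2=\zeta}$ ($v\in W$) for $n\le N-1$, and $a_{(n)}b=0$ for $n\ge N$ (independent of $N$). A local collection is a set of logarithmic fields in which every pair is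 local. For a logarithmic field $a(z)$, $a(z)_-$ (resp. $a(z)_+$) is the part containing only powers $z^\gamma$ with $\mathrm{Re}\,\gamma<0$ (resp. $\mathrm{Re}\,\gamma\ge0$), and ${:}a(z_1)b(z_2){:}=a(z_1)_+b(z_2)+b(z_2)a(z_1)_-$, which is well defined at $z_1=z_2=z$. Twisted modules. For a vertex algebra $V$ with vacuum $\mathbf 1$ and $\varphi\in\mathrm{Aut}(V)$, a $\varphi$-twisted $V$-module is a vector space $W$ with a linear map $Y\colon V\to\mathrm{LFie}(W)$ such that $Y(\mathbf 1)=I$, $Y(V)$ is a local collection, $Y(\varphi a,z)=e^{2\pi\mathrm iD_\zeta}Y(a,z)$, and $Y(a_{(n)}b,z)=Y(a,z)_{(n)}Y(b,z)$ for all $a,b\in V$, $n\in\mathbb Z$. Here $e^{2\pi\mathrm iD_\zeta}$ sends $\zeta\mapsto\zeta+2\pi\mathrm i$, $z^\gamma\mapsto e^{2\pi\mathrm i\gamma}z^\gamma$. Affine vertex algebra. $\hat{\mathfrak g}=\mathfrak g[t,t^{-1}]\oplus\mathbb CK$ has brackets $[at^m,bt^n]=[a,b]t^{m+n}+m\delta_{m,-n}(a|b)K$, $K$ central. $V^\kappa(\mathfrak g)=\mathrm{Ind}^{\hat{\mathfrak g}}_{\mathfrak g[t]\oplus\mathbb CK}\mathbb C$ (with $\mathfrak g[t]$ acting by $0$ and $K$ by $\kappa$ on $\mathbb C$) is the universal affine vertex algebra of level $\kappa$, with vacuum $\mathbf 1$ the image of $1\in\mathbb C$, generated by the fields $Y((at^{-1})\mathbf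 1,z)=\sum_{m\in\mathbb Z}(at^m)z^{-m-1}$, $a\in\mathfrak g$. One identifies $a\in\mathfrak g$ with $(at^{-1})\mathbf 1$. The induced automorphism $\varphi$ of $V^\kappa(\mathfrak g)$ is locally finite (every vector lies in a finite-dimensional invariant subspace). Write $\varphi=\sigma e^{-2\pi\mathrm i\mathcal N}$ uniquely with $\sigma$ semisimple, $\mathcal N$ locally nilpotent, $\sigma\mathcal N=\mathcal N\sigma$ (both on $V^\kappa(\mathfrak g)$ and, compatibly, on $\mathfrak g$). Let $\mathfrak g_\alpha=\{a\in\mathfrak g\mid\sigma a=e^{-2\pi\mathrm i\alpha}a\}$, $\alpha\in\mathbb C/\mathbb Z$. For each $\alpha\in\mathbb C/\mathbb Z$ let $\alpha_0\in\alpha$ be the representative with $-1<\mathrm{Re}\,\alpha_0\le0$; the linear operator $\mathcal S$ on $\mathfrak g$ is defined by $\mathcal Sa=\alpha_0a$ for $a\in\mathfrak g_\alpha$, and $\binom{\mathcal S}2=\frac12\mathcal S(\mathcal S-1)$. For $a\in V^\kappa(\mathfrak g)$, $X(a,z)=Y(e^{\zeta\mathcal N}a,z)$ ($Y$ extended linearly over $\mathbb C[\zeta]$), which equals $Y(a,z)|_{\zeta=0}$. *)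

theory Defs
  imports
    Complex_Main
    "HOL-Library.Function_Algebras"
    "HOL-Library.Product_Plus"
    "HOL-Library.Poly_Mapping"
begin

section \<open>Complex vector spaces\<close>

class complex_vector = ab_group_add +
  fixes scaleC :: "complex \<Rightarrow> 'a \<Rightarrow> 'a" (infixr \<open>*\<^sub>C\<close> 75)
  assumes scaleC_add_right: "c *\<^sub>C (x + y) = c *\<^sub>C x + c *\<^sub>C y"
    and scaleC_add_left: "(c + d) *\<^sub>C x = c *\<^sub>C x + d *\<^sub>C x"
    and scaleC_scaleC: "c *\<^sub>C d *\<^sub>C x = (c * d) *\<^sub>C x"
    and scaleC_one: "1 *\<^sub>C x = x"

interpretation cvec: vector_space "scaleC :: complex \<Rightarrow> 'a \<Rightarrow> 'a::complex_vector"
  by unfold_locales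
    (rule scaleC_add_right scaleC_add_left scaleC_scaleC scaleC_one)+

instantiation complex :: complex_vector
begin
definition scaleC_complex :: "complex \<Rightarrow> complex \<Rightarrow> complex"
  where "scaleC_complex c x = c * x"
instance
  by standard (simp_all add: scaleC_complex_def algebra_simps)
end

instantiation "fun" :: (type, complex_vector) complex_vector
begin
definition scaleC_fun :: "complex \<Rightarrow> ('a \<Rightarrow> 'b) \<Rightarrow> 'a \<Rightarrow> 'b"
  where "scaleC_fun c f = (\<lambda>x. c *\<^sub>C f x)"
instance
  by standard
    (simp_all add: scaleC_fun_def fun_eq_iff scaleC_add_right scaleC_add_left scaleC_scaleC
      scaleC_one)
end

instantiation prod :: (complex_vector, complex_vector) complex_vector
begin
definition scaleC_prod :: "complex \<Rightarrow> 'a \<times> 'b \<Rightarrow> 'a \<times> 'b"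
  where "scaleC_prod c p = (c *\<^sub>C fst p, c *\<^sub>C snd p)"
instance
  by standard
    (simp_all add: scaleC_prod_def prod_eq_iff scaleC_add_right scaleC_add_left scaleC_scaleC
      scaleC_one)
end

instantiation poly_mapping :: (type, complex_vector) complex_vector
begin
definition scaleC_poly_mapping :: "complex \<Rightarrow> ('a \<Rightarrow>\<^sub>0 'b) \<Rightarrow> 'a \<Rightarrow>\<^sub>0 'b"
  where "scaleC_poly_mapping c p = Poly_Mapping.map (scaleC c) p"
lemma lookup_scaleC:
  "Poly_Mapping.lookup (c *\<^sub>C p) k = c *\<^sub>C Poly_Mapping.lookup p k"
  for p :: "'a \<Rightarrow>\<^sub>0 'b"
  unfolding scaleC_poly_mapping_def by (simp add: Poly_Mapping.map.rep_eq when_def)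
instance
  by standard
    (rule poly_mapping_eqI; simp add: lookup_scaleC lookup_add scaleC_add_right scaleC_add_left
      scaleC_scaleC scaleC_one)+
end

abbreviation clinear :: "('a::complex_vector \<Rightarrow> 'b::complex_vector) \<Rightarrow> bool"
  where "clinear \<equiv> Vector_Spaces.linear scaleC scaleC"

definition cbilinear ::
  "('a::complex_vector \<Rightarrow> 'b::complex_vector \<Rightarrow> 'c::complex_vector) \<Rightarrow> bool"
  where "cbilinear f \<longleftrightarrow> (\<forall>x. clinear (f x)) \<and> (\<forall>y. clinear (\<lambda>x. f x y))"

definition fin_dim :: "'a::complex_vector itself \<Rightarrow> bool"
  where "fin_dim T \<longleftrightarrow> (\<exists>S :: 'a set. finite S \<and> cvec.span S = UNIV)"

definition semisimple_op :: "('a::complex_vector \<Rightarrow> 'a) \<Rightarrow> bool"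
  where "semisimple_op f \<longleftrightarrow> clinear f \<and> cvec.span {x. \<exists>c. f x = c *\<^sub>C x} = UNIV"

definition locally_nilpotent :: "('a::complex_vector \<Rightarrow> 'a) \<Rightarrow> bool"
  where "locally_nilpotent f \<longleftrightarrow> clinear f \<and> (\<forall>x. \<exists>n. (f ^^ n) x = 0)"

text \<open>The exponential of a locally nilpotent operator, a finite sum on each vector
  (\<^const>\<open>Sum_any\<close> sums over the support of its argument).\<close>

definition exp_op :: "complex \<Rightarrow> ('a::complex_vector \<Rightarrow> 'a) \<Rightarrow> 'a \<Rightarrow> 'a"
  where "exp_op c f x = Sum_any (\<lambda>j::nat. (c ^ j / fact j) *\<^sub>C (f ^^ j) x)"

definition jordan_decomp ::
  "('a::complex_vector \<Rightarrow> 'a) \<Rightarrow> ('a \<Rightarrow> 'a) \<Rightarrow> ('a \<Rightarrow> 'a) \<Rightarrow> bool"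
  where "jordan_decomp \<phi> \<sigma> \<N> \<longleftrightarrow>
    semisimple_op \<sigma> \<and> locally_nilpotent \<N> \<and> (\<forall>x. \<sigma> (\<N> x) = \<N> (\<sigma> x)) \<and>
    (\<forall>x. \<phi> x = \<sigma> (exp_op (- 2 * of_real pi * \<i>) \<N> x))"

definition op_trace :: "('a::complex_vector \<Rightarrow> 'a) \<Rightarrow> complex"
  where "op_trace f =
    (let E = (SOME E. cvec.independent E \<and> cvec.span E = (UNIV :: 'a set))
     in \<Sum>e\<in>E. cvec.representation E (f e) e)"


section \<open>Lie algebras with an invariant form\<close>

definition lie_algebra :: "('g::complex_vector \<Rightarrow> 'g \<Rightarrow> 'g) \<Rightarrow> bool"
  where "lie_algebra br \<longleftrightarrow> cbilinear br \<and> (\<forall>x. br x x = 0) \<and>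
    (\<forall>x y z. br x (br y z) + br y (br z x) + br z (br x y) = 0)"

definition abelian_lie :: "('g::complex_vector \<Rightarrow> 'g \<Rightarrow> 'g) \<Rightarrow> bool"
  where "abelian_lie br \<longleftrightarrow> (\<forall>x y. br x y = 0)"

definition lie_ideal :: "('g::complex_vector \<Rightarrow> 'g \<Rightarrow> 'g) \<Rightarrow> 'g set \<Rightarrow> bool"
  where "lie_ideal br I \<longleftrightarrow> cvec.subspace I \<and> (\<forall>x. \<forall>y\<in>I. br x y \<in> I)"

definition simple_lie :: "('g::complex_vector \<Rightarrow> 'g \<Rightarrow> 'g) \<Rightarrow> bool"
  where "simple_lie br \<longleftrightarrow>
    \<not> abelian_lie br \<and> (\<forall>I. lie_ideal br I \<longrightarrow> I = {0} \<or> I = UNIV)"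

definition nondeg_inv_form ::
  "('g::complex_vector \<Rightarrow> 'g \<Rightarrow> 'g) \<Rightarrow> ('g \<Rightarrow> 'g \<Rightarrow> complex) \<Rightarrow> bool"
  where "nondeg_inv_form br B \<longleftrightarrow> cbilinear B \<and> (\<forall>x y. B x y = B y x) \<and>
    (\<forall>x y z. B (br x y) z = B x (br y z)) \<and> (\<forall>x. (\<forall>y. B x y = 0) \<longrightarrow> x = 0)"

definition lie_automorphism ::
  "('g::complex_vector \<Rightarrow> 'g \<Rightarrow> 'g) \<Rightarrow> ('g \<Rightarrow> 'g) \<Rightarrow> bool"
  where "lie_automorphism br \<phi> \<longleftrightarrow>
    clinear \<phi> \<and> bij \<phi> \<and> (\<forall>x y. \<phi> (br x y) = br (\<phi> x) (\<phi> y))"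

text \<open>The next definitions are used only for finite-dimensional simple Lie algebras, where Cartan
  subalgebras are the maximal toral subalgebras.\<close>

definition toral_subalgebra :: "('g::complex_vector \<Rightarrow> 'g \<Rightarrow> 'g) \<Rightarrow> 'g set \<Rightarrow> bool"
  where "toral_subalgebra br H \<longleftrightarrow> cvec.subspace H \<and> (\<forall>x\<in>H. \<forall>y\<in>H. br x y = 0) \<and>
    (\<forall>x\<in>H. semisimple_op (br x))"

definition cartan_subalgebra :: "('g::complex_vector \<Rightarrow> 'g \<Rightarrow> 'g) \<Rightarrow> 'g set \<Rightarrow> bool"
  where "cartan_subalgebra br H \<longleftrightarrow> toral_subalgebra br H \<and>
    (\<forall>H'. toral_subalgebra br H' \<and> H \<subseteq> H' \<longrightarrow> H' = H)"

text \<open>The dual space of a Cartan subalgebra \<open>H\<close> is identified with \<open>H\<close> by means of the form: the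
  root \<open>h \<mapsto> (\<alpha>|h)\<close> is represented by \<open>\<alpha> \<in> H\<close>, so that \<open>(\<alpha>|\<beta>)\<close> is the form on the dual space.\<close>

definition roots ::
  "('g::complex_vector \<Rightarrow> 'g \<Rightarrow> 'g) \<Rightarrow> ('g \<Rightarrow> 'g \<Rightarrow> complex) \<Rightarrow> 'g set \<Rightarrow> 'g set"
  where "roots br B H =
    {\<alpha> \<in> H. \<alpha> \<noteq> 0 \<and> (\<exists>x. x \<noteq> 0 \<and> (\<forall>h\<in>H. br h x = B \<alpha> h *\<^sub>C x))}"

definition coroot :: "('g::complex_vector \<Rightarrow> 'g \<Rightarrow> complex) \<Rightarrow> 'g \<Rightarrow> 'g"
  where "coroot B \<alpha> = (2 / B \<alpha> \<alpha>) *\<^sub>C \<alpha>"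

text \<open>For an invariant form on a simple Lie algebra that is not yet normalized, square lengths of
  roots are complex numbers, but their ratios are positive reals.\<close>

definition long_roots ::
  "('g::complex_vector \<Rightarrow> 'g \<Rightarrow> 'g) \<Rightarrow> ('g \<Rightarrow> 'g \<Rightarrow> complex) \<Rightarrow> 'g set \<Rightarrow> 'g set"
  where "long_roots br B H =
    {\<alpha> \<in> roots br B H. \<forall>\<beta>\<in>roots br B H. \<exists>r::real. r \<le> 1 \<and> B \<beta> \<beta> = of_real r * B \<alpha> \<alpha>}"

definition normalized_form ::
  "('g::complex_vector \<Rightarrow> 'g \<Rightarrow> 'g) \<Rightarrow> ('g \<Rightarrow> 'g \<Rightarrow> complex) \<Rightarrow> bool"
  where "normalized_form br B \<longleftrightarrow>
    (\<forall>H. cartan_subalgebra br H \<longrightarrow> (\<forall>\<alpha>\<in>long_roots br B H. B \<alpha> \<alpha> = 2))"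

definition root_base ::
  "('g::complex_vector \<Rightarrow> 'g \<Rightarrow> 'g) \<Rightarrow> ('g \<Rightarrow> 'g \<Rightarrow> complex) \<Rightarrow> 'g set \<Rightarrow> 'g set \<Rightarrow> bool"
  where "root_base br B H \<Delta> \<longleftrightarrow> \<Delta> \<subseteq> roots br B H \<and> cvec.independent \<Delta> \<and>
    (\<forall>\<beta>\<in>roots br B H. \<exists>c::'g \<Rightarrow> nat.
       \<beta> = (\<Sum>\<alpha>\<in>\<Delta>. of_nat (c \<alpha>) *\<^sub>C \<alpha>) \<or> \<beta> = - (\<Sum>\<alpha>\<in>\<Delta>. of_nat (c \<alpha>) *\<^sub>C \<alpha>))"

definition highest_root ::
  "('g::complex_vector \<Rightarrow> 'g \<Rightarrow> 'g) \<Rightarrow> ('g \<Rightarrow> 'g \<Rightarrow> complex) \<Rightarrow> 'g set \<Rightarrow> 'g set \<Rightarrow> 'g \<Rightarrow> bool"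
  where "highest_root br B H \<Delta> \<theta> \<longleftrightarrow> \<theta> \<in> roots br B H \<and>
    (\<forall>\<beta>\<in>roots br B H. \<exists>c::'g \<Rightarrow> nat. \<theta> - \<beta> = (\<Sum>\<alpha>\<in>\<Delta>. of_nat (c \<alpha>) *\<^sub>C \<alpha>))"

text \<open>For simple Lie algebras, \<open>h\<^sup>\<or> = 1 + \<Sum> a\<^sub>\<alpha>\<close>, where \<open>a\<^sub>\<alpha>\<close> are the coefficients of the coroot of
  the highest root in terms of the simple coroots.\<close>

definition dual_coxeter ::
  "('g::complex_vector \<Rightarrow> 'g \<Rightarrow> 'g) \<Rightarrow> ('g \<Rightarrow> 'g \<Rightarrow> complex) \<Rightarrow> nat"
  where "dual_coxeter br B =
    (if abelian_lie br then 0
     else (THE h. \<exists>H \<Delta> \<theta> a. cartan_subalgebra br H \<and> root_base br B H \<Delta> \<and>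
             highest_root br B H \<Delta> \<theta> \<and>
             coroot B \<theta> = (\<Sum>\<alpha>\<in>\<Delta>. of_nat (a \<alpha>) *\<^sub>C coroot B \<alpha>) \<and>
             h = 1 + (\<Sum>\<alpha>\<in>\<Delta>. a \<alpha>)))"

definition is_basis_family :: "(nat \<Rightarrow> 'a::complex_vector) \<Rightarrow> bool"
  where "is_basis_family v \<longleftrightarrow> (let I = {1..cvec.dim (UNIV :: 'a set)} in
    inj_on v I \<and> cvec.independent (v ` I) \<and> cvec.span (v ` I) = UNIV)"

definition dual_bases ::
  "('g::complex_vector \<Rightarrow> 'g \<Rightarrow> complex) \<Rightarrow> (nat \<Rightarrow> 'g) \<Rightarrow> (nat \<Rightarrow> 'g) \<Rightarrow> bool"
  where "dual_bases B v w \<longleftrightarrow> is_basis_family v \<and> is_basis_family w \<and>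
    (\<forall>i\<in>{1..cvec.dim (UNIV :: 'g set)}. \<forall>j\<in>{1..cvec.dim (UNIV :: 'g set)}.
       B (v i) (w j) = (if i = j then 1 else 0))"


section \<open>Logarithmic fields\<close>

text \<open>In a series \<open>f\<close>, \<open>f \<gamma> k\<close> is the coefficient of \<open>z\<^sup>\<gamma> \<zeta>\<^sup>k\<close>. In a series \<open>F\<close> in two pairs of
  variables, \<open>F \<gamma>\<^sub>1 \<gamma>\<^sub>2 k\<^sub>1 k\<^sub>2\<close> is the coefficient of
  \<open>z\<^sub>1\<close> to the \<open>\<gamma>\<^sub>1\<close> times \<open>z\<^sub>2\<close> to the \<open>\<gamma>\<^sub>2\<close> times \<open>\<zeta>\<^sub>1\<close> to the \<open>k\<^sub>1\<close> times \<open>\<zeta>\<^sub>2\<close> to the \<open>k\<^sub>2\<close>.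
  A class \<open>\<alpha>\<close> in \<open>\<complex>/\<int>\<close> is given by a representative.\<close>

type_synonym 'w series = "complex \<Rightarrow> nat \<Rightarrow> 'w"
type_synonym 'w series2 = "complex \<Rightarrow> complex \<Rightarrow> nat \<Rightarrow> nat \<Rightarrow> 'w"
type_synonym 'w lfield = "'w \<Rightarrow> 'w series"

definition log_series :: "complex \<Rightarrow> 'w::complex_vector series set"
  where "log_series \<alpha> = {f. (\<forall>\<gamma>. finite {k. f \<gamma> k \<noteq> 0}) \<and>
    (\<exists>n::int. \<forall>\<gamma> k. f \<gamma> k \<noteq> 0 \<longrightarrow> (\<exists>i::nat. \<gamma> = of_nat i - (\<alpha> + of_int n)))}"

definition LFie_at :: "complex \<Rightarrow> 'w::complex_vector lfield set"
  where "LFie_at \<alpha> = {a. clinear a \<and> (\<forall>v. a v \<in> log_series \<alpha>)}"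

text \<open>The sum of the subspaces \<^term>\<open>LFie_at \<alpha>\<close> over \<open>\<alpha> \<in> \<complex>/\<int>\<close> is direct, because the exponents
  occurring for different classes are disjoint.\<close>

definition LFie :: "'w::complex_vector lfield set"
  where "LFie = cvec.span (\<Union>\<alpha>. LFie_at \<alpha>)"

definition id_field :: "'w::complex_vector lfield"
  where "id_field v = (\<lambda>\<gamma> k. if \<gamma> = 0 \<and> k = 0 then v else 0)"

definition z_times :: "complex \<Rightarrow> 'w lfield \<Rightarrow> 'w lfield"
  where "z_times c a v = (\<lambda>\<gamma> k. a v (\<gamma> - c) k)"

text \<open>The series \<open>a(z\<^sub>1) b(z\<^sub>2) v\<close> and \<open>b(z\<^sub>2) a(z\<^sub>1) v\<close>.\<close>

definition comp12 :: "'w lfield \<Rightarrow> 'w lfield \<Rightarrow> 'w \<Rightarrow> 'w series2"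
  where "comp12 a b v = (\<lambda>\<gamma>1 \<gamma>2 k1 k2. a (b v \<gamma>2 k2) \<gamma>1 k1)"

definition comp21 :: "'w lfield \<Rightarrow> 'w lfield \<Rightarrow> 'w \<Rightarrow> 'w series2"
  where "comp21 b a v = (\<lambda>\<gamma>1 \<gamma>2 k1 k2. b (a v \<gamma>1 k1) \<gamma>2 k2)"

definition z12_times :: "'w::complex_vector series2 \<Rightarrow> 'w series2"
  where "z12_times F = (\<lambda>\<gamma>1 \<gamma>2 k1 k2. F (\<gamma>1 - 1) \<gamma>2 k1 k2 - F \<gamma>1 (\<gamma>2 - 1) k1 k2)"

text \<open>\<open>D = \<partial>\<^sub>z + z\<^sup>-\<^sup>1 \<partial>\<^sub>\<zeta>\<close> with respect to the first pair of variables.\<close>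

definition D_z1 :: "'w::complex_vector series2 \<Rightarrow> 'w series2"
  where "D_z1 F = (\<lambda>\<gamma>1 \<gamma>2 k1 k2.
    (\<gamma>1 + 1) *\<^sub>C F (\<gamma>1 + 1) \<gamma>2 k1 k2 + of_nat (k1 + 1) *\<^sub>C F (\<gamma>1 + 1) \<gamma>2 (k1 + 1) k2)"

text \<open>The substitution \<open>z\<^sub>1 = z\<^sub>2 = z\<close>, \<open>\<zeta>\<^sub>1 = \<zeta>\<^sub>2 = \<zeta>\<close>. In all its uses below on logarithmic fields,
  only finitely many \<open>\<gamma>\<^sub>1\<close> contribute to a given power of \<open>z\<close>.\<close>

definition diag_subst :: "'w::complex_vector series2 \<Rightarrow> 'w series"
  where "diag_subst F = (\<lambda>\<gamma> k. Sum_any (\<lambda>\<gamma>1. \<Sum>i\<le>k. F \<gamma>1 (\<gamma> - \<gamma>1) i (k - i)))"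

definition local_order :: "nat \<Rightarrow> 'w::complex_vector lfield \<Rightarrow> 'w lfield \<Rightarrow> bool"
  where "local_order N a b \<longleftrightarrow>
    (\<forall>v. (z12_times ^^ N) (comp12 a b v) = (z12_times ^^ N) (comp21 b a v))"

definition local_collection :: "'w::complex_vector lfield set \<Rightarrow> bool"
  where "local_collection A \<longleftrightarrow> A \<subseteq> LFie \<and> (\<forall>a\<in>A. \<forall>b\<in>A. \<exists>N. local_order N a b)"

text \<open>The \<open>n\<close>-th product of local fields does not depend on the choice of \<open>N\<close>; the least one
  is used.\<close>

definition field_prod :: "int \<Rightarrow> 'w::complex_vector lfield \<Rightarrow> 'w lfield \<Rightarrow> 'w lfield"
  where "field_prod n a b v =
    (let N = (LEAST N. local_order N a b); k = nat (int N - 1 - n)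
     in if n \<le> int N - 1
        then diag_subst ((1 / fact k) *\<^sub>C (D_z1 ^^ k) ((z12_times ^^ N) (comp12 a b v)))
        else 0)"

definition minus_part :: "'w::complex_vector lfield \<Rightarrow> 'w lfield"
  where "minus_part a v = (\<lambda>\<gamma> k. if Re \<gamma> < 0 then a v \<gamma> k else 0)"

definition plus_part :: "'w::complex_vector lfield \<Rightarrow> 'w lfield"
  where "plus_part a v = (\<lambda>\<gamma> k. if Re \<gamma> \<ge> 0 then a v \<gamma> k else 0)"

definition normal_ordered :: "'w::complex_vector lfield \<Rightarrow> 'w lfield \<Rightarrow> 'w lfield"
  where "normal_ordered a b v =
    diag_subst (comp12 (plus_part a) b v + comp21 b (minus_part a) v)"

text \<open>\<open>exp(2\<pi>\<i>D\<^sub>\<zeta>)\<close>: the substitution \<open>\<zeta> \<mapsto> \<zeta> + 2\<pi>\<i>\<close>, \<open>z\<^sup>\<gamma> \<mapsto> exp(2\<pi>\<i>\<gamma>) z\<^sup>\<gamma>\<close>.\<close>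

definition monodromy :: "'w::complex_vector lfield \<Rightarrow> 'w lfield"
  where "monodromy a v = (\<lambda>\<gamma> k. exp (2 * of_real pi * \<i> * \<gamma>) *\<^sub>C
    Sum_any (\<lambda>j. (of_nat (j choose k) * (2 * of_real pi * \<i>) ^ (j - k)) *\<^sub>C a v \<gamma> j))"


section \<open>Vertex algebras and twisted modules\<close>

text \<open>\<open>pr n a b\<close> is the \<open>n\<close>-th product. The last axiom is the Borcherds identity.\<close>

definition vertex_algebra ::
  "'v::complex_vector \<Rightarrow> (int \<Rightarrow> 'v \<Rightarrow> 'v \<Rightarrow> 'v) \<Rightarrow> bool"
  where "vertex_algebra vac pr \<longleftrightarrow>
    (\<forall>n. cbilinear (pr n)) \<and>
    (\<forall>a b. \<exists>N. \<forall>n\<ge>N. pr n a b = 0) \<and>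
    (\<forall>n a. pr n vac a = (if n = -1 then a else 0)) \<and>
    (\<forall>a. pr (-1) a vac = a \<and> (\<forall>n\<ge>0. pr n a vac = 0)) \<and>
    (\<forall>m n k a b c.
      Sum_any (\<lambda>j::nat. ((of_int m :: complex) gchoose j) *\<^sub>C
        pr (m + k - int j) (pr (n + int j) a b) c) =
      Sum_any (\<lambda>j::nat. ((-1) ^ j * ((of_int n :: complex) gchoose j)) *\<^sub>C
        (pr (m + n - int j) a (pr (k + int j) b c) -
         ((-1) powi n :: complex) *\<^sub>C pr (n + k - int j) b (pr (m + int j) a c))))"

definition va_automorphism ::
  "'v::complex_vector \<Rightarrow> (int \<Rightarrow> 'v \<Rightarrow> 'v \<Rightarrow> 'v) \<Rightarrow> ('v \<Rightarrow> 'v) \<Rightarrow> bool"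
  where "va_automorphism vac pr \<phi> \<longleftrightarrow> clinear \<phi> \<and> bij \<phi> \<and> \<phi> vac = vac \<and>
    (\<forall>n a b. \<phi> (pr n a b) = pr n (\<phi> a) (\<phi> b))"

definition twisted_module ::
  "'v::complex_vector \<Rightarrow> (int \<Rightarrow> 'v \<Rightarrow> 'v \<Rightarrow> 'v) \<Rightarrow> ('v \<Rightarrow> 'v) \<Rightarrow>
   ('v \<Rightarrow> 'w::complex_vector lfield) \<Rightarrow> bool"
  where "twisted_module vac pr \<phi> Y \<longleftrightarrow>
    clinear Y \<and> (\<forall>a. Y a \<in> LFie) \<and> Y vac = id_field \<and> local_collection (range Y) \<and>
    (\<forall>a. Y (\<phi> a) = monodromy (Y a)) \<and>
    (\<forall>n a b. Y (pr n a b) = field_prod n (Y a) (Y b))"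

text \<open>\<open>X(a,z) = Y(exp(\<zeta>\<N>) a, z)\<close>, with \<open>Y\<close> extended linearly over \<open>\<complex>[\<zeta>]\<close>: the coefficient of
  \<open>\<zeta>\<^sup>k\<close> collects the contributions of \<open>\<zeta>\<^sup>j/j!\<close> times the coefficient of \<open>\<zeta>\<close> to the \<open>k - j\<close>.\<close>

definition X_field ::
  "('v::complex_vector \<Rightarrow> 'v) \<Rightarrow> ('v \<Rightarrow> 'w::complex_vector lfield) \<Rightarrow> 'v \<Rightarrow> 'w lfield"
  where "X_field \<N> Y a w =
    (\<lambda>\<gamma> k. \<Sum>j\<le>k. (1 / fact j) *\<^sub>C Y ((\<N> ^^ j) a) w \<gamma> (k - j))"


section \<open>Universal affine vertex algebras\<close>

definition lie_module ::
  "('l::complex_vector \<Rightarrow> 'l \<Rightarrow> 'l) \<Rightarrow> ('l \<Rightarrow> 'v::complex_vector \<Rightarrow> 'v) \<Rightarrow> bool"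
  where "lie_module br \<rho> \<longleftrightarrow>
    cbilinear \<rho> \<and> (\<forall>x y v. \<rho> (br x y) v = \<rho> x (\<rho> y v) - \<rho> y (\<rho> x v))"

text \<open>Formal linear combinations of words \<open>x\<^sub>1 \<dots> x\<^sub>r\<close> in a Lie algebra \<open>L\<close>, with the relations
  defining the universal enveloping algebra \<open>U(L)\<close> and those defining the tensor product of \<open>U(L)\<close>
  over \<open>U(S)\<close> with the one-dimensional module on which a subalgebra \<open>S\<close> acts by \<open>\<chi>\<close>.\<close>

definition induced_relations ::
  "('l::complex_vector \<Rightarrow> 'l \<Rightarrow> 'l) \<Rightarrow> 'l set \<Rightarrow> ('l \<Rightarrow> complex) \<Rightarrow> ('l list \<Rightarrow>\<^sub>0 complex) set"
  where "induced_relations br S \<chi> =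
    {Poly_Mapping.single (u @ [c *\<^sub>C x + y] @ w) 1 - Poly_Mapping.single (u @ [x] @ w) c
       - Poly_Mapping.single (u @ [y] @ w) 1 | u w x y c. True} \<union>
    {Poly_Mapping.single (u @ [x, y] @ w) 1 - Poly_Mapping.single (u @ [y, x] @ w) 1
       - Poly_Mapping.single (u @ [br x y] @ w) 1 | u w x y. True} \<union>
    {Poly_Mapping.single (u @ [x]) 1 - Poly_Mapping.single u (\<chi> x) | u x. x \<in> S}"

definition words_apply ::
  "('l \<Rightarrow> 'v::complex_vector \<Rightarrow> 'v) \<Rightarrow> 'v \<Rightarrow> ('l list \<Rightarrow>\<^sub>0 complex) \<Rightarrow> 'v"
  where "words_apply \<rho> v p =
    (\<Sum>w\<in>Poly_Mapping.keys p. Poly_Mapping.lookup p w *\<^sub>C foldr \<rho> w v)"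

text \<open>\<open>\<rho>\<close> is the \<open>L\<close>-module induced from the \<open>S\<close>-module \<open>\<chi>\<close>, and \<open>v\<close> is the image of \<open>1\<close>.\<close>

definition induced_module ::
  "('l::complex_vector \<Rightarrow> 'l \<Rightarrow> 'l) \<Rightarrow> 'l set \<Rightarrow> ('l \<Rightarrow> complex) \<Rightarrow>
   ('l \<Rightarrow> 'v::complex_vector \<Rightarrow> 'v) \<Rightarrow> 'v \<Rightarrow> bool"
  where "induced_module br S \<chi> \<rho> v \<longleftrightarrow> lie_module br \<rho> \<and>
    range (words_apply \<rho> v) = UNIV \<and>
    {p. words_apply \<rho> v p = 0} = cvec.span (induced_relations br S \<chi>)"

text \<open>\<open>(f, c)\<close> stands for \<open>\<Sum>\<^sub>m f\<^sub>m t\<^sup>m + c K\<close>.\<close>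

type_synonym 'g affine = "(int \<Rightarrow>\<^sub>0 'g) \<times> complex"

definition affine_bracket ::
  "('g::complex_vector \<Rightarrow> 'g \<Rightarrow> 'g) \<Rightarrow> ('g \<Rightarrow> 'g \<Rightarrow> complex) \<Rightarrow>
   'g affine \<Rightarrow> 'g affine \<Rightarrow> 'g affine"
  where "affine_bracket br B x y =
    (\<Sum>m\<in>Poly_Mapping.keys (fst x). \<Sum>n\<in>Poly_Mapping.keys (fst y).
       Poly_Mapping.single (m + n)
         (br (Poly_Mapping.lookup (fst x) m) (Poly_Mapping.lookup (fst y) n)),
     \<Sum>m\<in>Poly_Mapping.keys (fst x).
       of_int m * B (Poly_Mapping.lookup (fst x) m) (Poly_Mapping.lookup (fst y) (- m)))"

definition loop :: "'g::complex_vector \<Rightarrow> int \<Rightarrow> 'g affine"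
  where "loop a m = (Poly_Mapping.single m a, 0)"

definition affine_plus :: "'g::complex_vector affine set"
  where "affine_plus = {x. Poly_Mapping.keys (fst x) \<subseteq> {0..}}"

text \<open>\<open>V\<^sup>\<kappa>(\<gg>)\<close> is determined by this up to isomorphism: \<open>\<rho>\<close> makes the underlying space the
  induced module, and the products with \<open>(at\<^sup>-\<^sup>1)\<one>\<close> on the left are the modes \<open>at\<^sup>m\<close>, which determine
  the remaining products.\<close>

definition universal_affine_va ::
  "('g::complex_vector \<Rightarrow> 'g \<Rightarrow> 'g) \<Rightarrow> ('g \<Rightarrow> 'g \<Rightarrow> complex) \<Rightarrow> complex \<Rightarrow>
   'v::complex_vector \<Rightarrow> (int \<Rightarrow> 'v \<Rightarrow> 'v \<Rightarrow> 'v) \<Rightarrow> ('g affine \<Rightarrow> 'v \<Rightarrow> 'v) \<Rightarrow> bool"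
  where "universal_affine_va br B \<kappa> vac pr \<rho> \<longleftrightarrow>
    induced_module (affine_bracket br B) affine_plus (\<lambda>x. \<kappa> * snd x) \<rho> vac \<and>
    vertex_algebra vac pr \<and>
    (\<forall>a m v. pr m (\<rho> (loop a (-1)) vac) v = \<rho> (loop a m) v)"

definition affine_embed ::
  "'v \<Rightarrow> ('g::complex_vector affine \<Rightarrow> 'v \<Rightarrow> 'v) \<Rightarrow> 'g \<Rightarrow> 'v"
  where "affine_embed vac \<rho> a = \<rho> (loop a (-1)) vac"


section \<open>The operator \<open>\<S>\<close>\<close>

text \<open>Since \<open>\<sigma>\<close> is semisimple and invertible, \<open>\<S>\<close> is determined by its values on the eigenvectors
  of \<open>\<sigma>\<close>; \<open>\<alpha>\<close> below is the representative \<open>\<alpha>\<^sub>0\<close> of its class in \<open>\<complex>/\<int>\<close>.\<close>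

definition is_S_op :: "('g::complex_vector \<Rightarrow> 'g) \<Rightarrow> ('g \<Rightarrow> 'g) \<Rightarrow> bool"
  where "is_S_op \<sigma> \<S> \<longleftrightarrow> clinear \<S> \<and>
    (\<forall>\<alpha> a. -1 < Re \<alpha> \<and> Re \<alpha> \<le> 0 \<and> \<sigma> a = exp (- 2 * of_real pi * \<i> * \<alpha>) *\<^sub>C a \<longrightarrow>
       \<S> a = \<alpha> *\<^sub>C a)"

definition op_choose_2 :: "('g::complex_vector \<Rightarrow> 'g) \<Rightarrow> 'g \<Rightarrow> 'g"
  where "op_choose_2 \<S> a = (1 / 2) *\<^sub>C \<S> (\<S> a - a)"

end

theory Submission
  imports Defs "HOL-Computational_Algebra.Polynomial"
begin

text \<open>Write \<open>T = \<S> + \<N>\<close> on the Lie algebra. The theorem is the sum over dual bases of an expansion of the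
normally ordered product of two fields into their products,
\<open>:Y(a,z)Y(b,z): = \<Sum>\<^sub>j z\<^sup>-\<^sup>j Y((binom(T,j) a)\<^sub>(\<^sub>j\<^sub>-\<^sub>1\<^sub>) b, z)\<close>, where \<open>binom(T,j) = T(T-1)\<dots>(T-j+1)/j!\<close>
(\<open>normal_ordered_expansion\<close>). In \<open>V\<^sup>\<kappa>(\<gg>)\<close> the nonnegative products of \<open>a,b \<in> \<gg>\<close> are \<open>[a,b]\<close>,
\<open>\<kappa>(a|b)\<one>\<close>, \<open>0\<close>, \<open>0\<close>, \<dots>, so that only \<open>j = 0, 1, 2\<close> contribute, and these are the terms of the theorem.

The expansion holds for the following reason. The series \<open>z\<^sub>1\<^sub>2\<^sup>N Y(a,z\<^sub>1)Y(b,z\<^sub>2)\<close>, whose derivatives on the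
diagonal \<open>z\<^sub>1 = z\<^sub>2\<close> are the products of the two fields, differs from \<open>z\<^sub>1\<^sub>2\<^sup>N :Y(a,z\<^sub>1)Y(b,z\<^sub>2):\<close> by
\<open>P\<^sub>a = z\<^sub>1\<^sub>2\<^sup>N [Y(a,z\<^sub>1)\<^sub>-, Y(b,z\<^sub>2)]\<close>. By locality this is also \<open>- z\<^sub>1\<^sub>2\<^sup>N [Y(a,z\<^sub>1)\<^sub>+, Y(b,z\<^sub>2)]\<close>. The
first expression bounds the real parts of the exponents of \<open>z\<^sub>1\<close> by \<open>N\<close> from above, the second one
bounds them by \<open>0\<close> from below. Moreover \<open>Y(a,z)\<close> is \<open>z\<^sup>-\<^sup>\<S> exp(- \<zeta>\<N>)\<close>, acting on
\<open>a\<close>, up to integral powers of \<open>z\<close>. So once this factor is removed, \<open>P\<close> becomes a polynomial in \<open>z\<^sub>1\<close> of degree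
less than \<open>N\<close>, and \<open>(D + z\<^sub>1\<^sup>-\<^sup>1 T)\<^sup>N\<close> annihilates the family \<open>a \<mapsto> P\<^sub>a\<close>, where \<open>D\<close> is the
derivation \<open>\<partial> + z\<^sub>1\<^sup>-\<^sup>1 \<partial>\<^sub>\<zeta>\<close>. A Leibniz formula (\<open>twisted_leibniz\<close>) turns this into a linear relation between
the derivatives of \<open>P\<close> of orders \<open>0, \<dots>, N\<close>. On the diagonal, a derivative of order \<open>N - j < N\<close> is a
multiple of the product number \<open>j - 1\<close>, and the one of order \<open>N\<close> is a multiple of the product number
\<open>-1\<close> minus the normally ordered product.

The shape of \<open>Y(a,z)\<close> and the properties of \<open>\<N>\<close> used below have one source: bilinear maps that are compatible
with automorphisms are compatible with their semisimple parts and satisfy the Leibniz rule for the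
nilpotent ones (\<open>jordan_bilinear_semisimple_eigenvectors\<close>, \<open>jordan_bilinear_nilpotent\<close>). Applied to
the coefficient of \<open>z\<^sup>\<gamma>\<close> in \<open>Y\<close>, on whose values the monodromy acts by the scalar \<open>exp(2\<pi>\<i>\<gamma>)\<close> times a
shift of \<open>\<zeta>\<close>, this gives \<open>\<partial>\<^sub>\<zeta> Y(v) = - Y(\<N> v)\<close> and the exponents of \<open>Y(a)\<close>. Applied to the inclusion of
\<open>\<gg>\<close> in \<open>V\<^sup>\<kappa>(\<gg>)\<close> it identifies the two operators \<open>\<N>\<close>. Applied to the form it shows that \<open>\<N>\<close> is skew.
Applied to the product number \<open>-1\<close> it shows, together with skewness, that \<open>\<N> \<omega> = 0\<close>.

Since \<open>\<N> \<omega> = 0\<close>, the field of \<open>\<omega>\<close> does not involve \<open>\<zeta>\<close>. Since \<open>X(a,z)\<close> is \<open>Y(a,z)\<close> at \<open>\<zeta> = 0\<close>, the other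
side does not involve \<open>\<zeta>\<close> either, and it suffices to compare the two at \<open>\<zeta> = 0\<close>, where \<open>X = Y\<close>. There the
expansion gives the claim with the coefficient \<open>\<kappa> tr binom(T,2)\<close>, and \<open>binom(T,2)\<close> has the same
trace as \<open>binom(\<S>,2)\<close> because the difference is nilpotent.\<close>

section \<open>Linear algebra\<close>

lemma clinear_iff:
  "clinear f \<longleftrightarrow> (\<forall>x y. f (x + y) = f x + f y) \<and> (\<forall>c x. f (c *\<^sub>C x) = c *\<^sub>C f x)"
  by (simp add: Vector_Spaces.linear_iff cvec.vector_space_axioms)

lemma
  assumes "clinear f"
  shows clinear_add: "f (x + y) = f x + f y"
    and clinear_scale: "f (c *\<^sub>C x) = c *\<^sub>C f x"
    and clinear_zero: "f 0 = 0"
    and clinear_neg: "f (- x) = - f x"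
    and clinear_diff: "f (x - y) = f x - f y"
    and clinear_sum: "f (sum g A) = (\<Sum>i\<in>A. f (g i))"
proof -
  show add: "f (x + y) = f x + f y" for x y using assms by (simp add: clinear_iff)
  show "f (c *\<^sub>C x) = c *\<^sub>C f x" using assms by (simp add: clinear_iff)
  show zero: "f 0 = 0" using add[of 0 0] by simp
  show neg: "f (- x) = - f x" for x using add[of x "- x"] zero by (simp add: eq_neg_iff_add_eq_0 add.commute)
  show "f (x - y) = f x - f y" using add[of x "- y"] neg by simp
  show "f (sum g A) = (\<Sum>i\<in>A. f (g i))"
    by (induction A rule: infinite_finite_induct) (simp_all add: zero add)
qed

lemma clinear_funpow: "clinear f \<Longrightarrow> clinear (f ^^ n)" for f :: "'a::complex_vector \<Rightarrow> 'a"
  by (induction n) (simp_all add: clinear_iff)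

lemma
  assumes "cbilinear f"
  shows cbilinear_right: "clinear (f a)" and cbilinear_left: "clinear (\<lambda>a. f a b)"
  using assms by (simp_all add: cbilinear_def)

text \<open>In coordinates this is the fact that a complex polynomial is determined by its values at the natural
numbers. Exponents may repeat on each side, so that a double sum can be compared with a single one
without collecting its terms first.\<close>

lemma vector_polynomial_coefficients_unique:
  fixes w :: "'k \<Rightarrow> 'a::complex_vector" and u :: "'l \<Rightarrow> 'a"
  assumes fin: "finite K" "finite L"
    and eq: "\<And>m::nat. (\<Sum>k\<in>K. of_nat m ^ e k *\<^sub>C w k) = (\<Sum>l\<in>L. of_nat m ^ e' l *\<^sub>C u l)"
  shows "(\<Sum>k\<in>{k\<in>K. e k = d}. w k) = (\<Sum>l\<in>{l\<in>L. e' l = d}. u l)"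
proof -
  obtain E :: "'a set" where E: "cvec.independent E" "cvec.span E = UNIV"
    by (rule cvec.maximal_independent_subset[of UNIV]) (auto simp: top.extremum_unique)
  define r where "r = cvec.representation E"
  have lin: "clinear (\<lambda>x. r x b)" for b
    using E by (auto simp: clinear_iff r_def cvec.representation_add cvec.representation_scale scaleC_complex_def)
  have rep: "(\<Sum>b | r x b \<noteq> 0. r x b *\<^sub>C b) = x" for x
    unfolding r_def using E by (intro cvec.sum_nonzero_representation_eq) auto
  have inj: "x = y" if "\<And>b. r x b = r y b" for x y
  proof -
    have "r x = r y" using that by (rule ext)
    then have "(\<Sum>b | r x b \<noteq> 0. r x b *\<^sub>C b) = (\<Sum>b | r y b \<noteq> 0. r y b *\<^sub>C b)" by (rule arg_cong)
    then show ?thesis by (simp only: rep)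
  qed
  show ?thesis
  proof (rule inj)
    fix b
    define p where "p = (\<Sum>k\<in>K. monom (r (w k) b) (e k))"
    define q where "q = (\<Sum>l\<in>L. monom (r (u l) b) (e' l))"
    have "poly p (of_nat m) = poly q (of_nat m)" for m
      using arg_cong[OF eq[of m], of "\<lambda>x. r x b"]
      by (simp add: p_def q_def poly_sum poly_monom clinear_sum[OF lin] clinear_scale[OF lin]
          scaleC_complex_def mult.commute)
    then have "range of_nat \<subseteq> {x. poly (p - q) x = 0}" by auto
    moreover have "infinite (range (of_nat :: nat \<Rightarrow> complex))"
      by (simp add: range_inj_infinite inj_of_nat)
    ultimately have "p - q = 0" using poly_roots_finite finite_subset by blast
    then have "coeff p d = coeff q d" by simp
    then show "r (\<Sum>k\<in>{k\<in>K. e k = d}. w k) b = r (\<Sum>l\<in>{l\<in>L. e' l = d}. u l) b"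
      by (simp add: p_def q_def coeff_sum coeff_monom clinear_sum[OF lin] fin sum.inter_filter
          if_distrib[of "\<lambda>x. r x b"] clinear_zero[OF lin] cong: if_cong)
  qed
qed

section \<open>Exponentials of locally nilpotent operators\<close>

lemma funpow_zero_mono:
  fixes f :: "'a::complex_vector \<Rightarrow> 'a"
  assumes "clinear f" "(f ^^ n) x = 0" "n \<le> m"
  shows "(f ^^ m) x = 0"
proof -
  have "(f ^^ m) x = (f ^^ (m - n)) ((f ^^ n) x)"
    using assms(3) by (metis comp_apply funpow_add le_add_diff_inverse2)
  then show ?thesis using assms by (simp add: clinear_zero clinear_funpow)
qed

lemma exp_op_eq_sum:
  assumes "clinear f" "(f ^^ n) x = 0"
  shows "exp_op c f x = (\<Sum>j<n. (c ^ j / fact j) *\<^sub>C (f ^^ j) x)"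
proof -
  have "{j. (c ^ j / fact j) *\<^sub>C (f ^^ j) x \<noteq> 0} \<subseteq> {..<n}"
    using funpow_zero_mono[OF assms] by (force simp: not_less[symmetric])
  then show ?thesis unfolding exp_op_def by (subst Sum_any.expand_superset[of "{..<n}"]) auto
qed

lemma exp_op_scale:
  assumes "locally_nilpotent N"
  shows "exp_op c N (d *\<^sub>C z) = d *\<^sub>C exp_op c N z"
proof -
  have l: "clinear N" and lp: "\<And>j. clinear (N ^^ j)" using assms by (simp_all add: locally_nilpotent_def clinear_funpow)
  obtain n where n: "(N ^^ n) z = 0" using assms by (auto simp: locally_nilpotent_def)
  have n': "(N ^^ n) (d *\<^sub>C z) = 0" using n by (simp add: clinear_scale[OF lp])
  show ?thesis unfolding exp_op_eq_sum[OF l n] exp_op_eq_sum[OF l n']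
    by (simp add: clinear_scale[OF lp] cvec.scale_sum_right scaleC_scaleC mult.commute)
qed

lemma exp_op_add:
  assumes N: "locally_nilpotent N"
  shows "exp_op s N (exp_op t N x) = exp_op (s + t) N x"
proof -
  have lin: "clinear N" and linp: "\<And>j. clinear (N ^^ j)"
    using N by (simp_all add: locally_nilpotent_def clinear_funpow)
  obtain n where n: "(N ^^ n) x = 0" using N by (auto simp: locally_nilpotent_def)
  define g where "g i j = ((s ^ i / fact i) * (t ^ j / fact j)) *\<^sub>C (N ^^ (i + j)) x" for i j
  have ex: "exp_op t N x = (\<Sum>j<n. (t ^ j / fact j) *\<^sub>C (N ^^ j) x)"
    using exp_op_eq_sum[OF lin n] .
  have pw: "(N ^^ i) (exp_op t N x) = (\<Sum>j<n. (t ^ j / fact j) *\<^sub>C (N ^^ (i + j)) x)" for i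
    unfolding ex by (simp add: clinear_sum[OF linp] clinear_scale[OF linp] funpow_add)
  have "(N ^^ n) (exp_op t N x) = 0"
    unfolding pw by (rule sum.neutral) (simp add: funpow_zero_mono[OF lin n])
  then have "exp_op s N (exp_op t N x) = (\<Sum>i<n. \<Sum>j<n. g i j)"
    by (simp add: exp_op_eq_sum[OF lin] pw cvec.scale_sum_right g_def scaleC_scaleC)
  also have "\<dots> = (\<Sum>(i, j)\<in>{..<n} \<times> {..<n}. g i j)" by (simp add: sum.cartesian_product)
  also have "\<dots> = (\<Sum>(i, j)\<in>{(i, j). i + j < n}. g i j)"
  proof (rule sum.mono_neutral_right)
    have "g i j = 0" if "\<not> i + j < n" for i j
      using funpow_zero_mono[OF lin n, of "i + j"] that by (simp add: g_def)
    then show "\<forall>ij\<in>{..<n} \<times> {..<n} - {(i, j). i + j < n}. (case ij of (i, j) \<Rightarrow> g i j) = 0" by auto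
  qed auto
  also have "\<dots> = (\<Sum>k<n. \<Sum>i\<le>k. g i (k - i))" by (rule sum.triangle_reindex)
  also have "\<dots> = (\<Sum>k<n. ((s + t) ^ k / fact k) *\<^sub>C (N ^^ k) x)"
  proof (rule sum.cong[OF refl])
    fix k
    have "(\<Sum>i\<le>k. g i (k - i)) = (\<Sum>i\<le>k. (s ^ i / fact i) * (t ^ (k - i) / fact (k - i))) *\<^sub>C (N ^^ k) x"
      by (simp add: g_def cvec.scale_sum_left)
    also have "(\<Sum>i\<le>k. (s ^ i / fact i) * (t ^ (k - i) / fact (k - i))) = (s + t) ^ k / fact k"
      by (auto simp: binomial_ring sum_divide_distrib binomial_fact intro!: sum.cong)
    finally show "(\<Sum>i\<le>k. g i (k - i)) = ((s + t) ^ k / fact k) *\<^sub>C (N ^^ k) x" .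
  qed
  also have "\<dots> = exp_op (s + t) N x" by (rule exp_op_eq_sum[OF lin n, symmetric])
  finally show ?thesis .
qed

section \<open>Jordan decompositions and maps that intertwine them\<close>

lemma eigenvector_induct:
  assumes "semisimple_op \<sigma>" and "P 0" and "\<And>x y. P x \<Longrightarrow> P y \<Longrightarrow> P (x + y)"
    and eig: "\<And>c x. \<sigma> x = c *\<^sub>C x \<Longrightarrow> P x"
  shows "P x"
proof -
  have lin: "clinear \<sigma>" using assms(1) by (simp add: semisimple_op_def)
  have "x \<in> cvec.span {x. \<exists>c. \<sigma> x = c *\<^sub>C x}" using assms(1) by (simp add: semisimple_op_def)
  then obtain t r where x: "x = (\<Sum>a\<in>t. r a *\<^sub>C a)" and t: "finite t" "t \<subseteq> {x. \<exists>c. \<sigma> x = c *\<^sub>C x}"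
    unfolding cvec.span_explicit by blast
  have "P (\<Sum>a\<in>t. r a *\<^sub>C a)" using t
  proof (induction t)
    case (insert a t)
    then obtain c where "\<sigma> a = c *\<^sub>C a" by auto
    then have "\<sigma> (r a *\<^sub>C a) = c *\<^sub>C (r a *\<^sub>C a)" by (simp add: clinear_scale[OF lin] scaleC_scaleC mult.commute)
    then have "P (r a *\<^sub>C a)" by (rule eig)
    then show ?case using insert assms(3) by auto
  qed (simp add: assms(2))
  then show ?thesis by (simp add: x)
qed

lemma clinear_eq_on_eigenvectors:
  assumes "semisimple_op \<sigma>" "clinear f" "clinear g" "\<And>c x. \<sigma> x = c *\<^sub>C x \<Longrightarrow> f x = g x"
  shows "f x = g x"
  by (rule eigenvector_induct[OF assms(1), where P = "\<lambda>x. f x = g x"])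
    (use assms in \<open>auto simp: clinear_zero clinear_add\<close>)

text \<open>A semisimple operator has no Jordan block of size two. The vector \<open>x\<close> is annihilated by a product of
\<open>\<sigma> - l\<close> over distinct \<open>l\<close>. The factor \<open>\<sigma> - \<nu>\<close> maps \<open>x\<close> to \<open>w\<close>, so the remaining factors annihilate \<open>w\<close>, on
which they act by nonzero scalars.\<close>

lemma semisimple_no_generalized:
  assumes ss: "semisimple_op \<sigma>" and w: "\<sigma> w = \<nu> *\<^sub>C w" and x: "\<sigma> x = \<nu> *\<^sub>C x + w"
  shows "w = 0"
proof -
  define A where "A l y = \<sigma> y - l *\<^sub>C y" for l y
  define Q where "Q ls = foldr (\<lambda>l g. A l \<circ> g) ls id" for ls
  have lin: "clinear \<sigma>" using ss by (simp add: semisimple_op_def)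
  have linA: "clinear (A l)" for l
    unfolding clinear_iff A_def
    by (simp add: clinear_add[OF lin] clinear_scale[OF lin] scaleC_add_right scaleC_scaleC mult.commute
        cvec.scale_right_diff_distrib)
  have QC: "Q (l # ls) y = A l (Q ls y)" and Q0: "Q [] y = y" for l ls y by (simp_all add: Q_def)
  have linP: "clinear (Q ls)" for ls
    using linA by (induction ls) (simp_all add: QC Q0 clinear_iff)
  have commA: "A l (A m y) = A m (A l y)" for l m y
    by (simp add: A_def clinear_diff[OF lin] clinear_scale[OF lin] cvec.scale_right_diff_distrib
        scaleC_scaleC algebra_simps mult.commute)
  have QA: "Q ls (A l y) = A l (Q ls y)" for l ls y
    by (induction ls) (simp_all add: QC Q0 commA)
  have del: "Q ls y = A l (Q (remove1 l ls) y)" if "l \<in> set ls" for l ls y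
    using that by (induction ls) (auto simp: QC commA)
  \<comment> \<open>A larger product is zero as well, because the factors commute.\<close>
  have sup: "Q ls y = 0" if "Q ks y = 0" "set ks \<subseteq> set ls" "distinct ks" for ks ls y
    using that
  proof (induction ks arbitrary: ls y)
    case Nil then show ?case by (simp add: Q0 clinear_zero[OF linP])
  next
    case (Cons k ks)
    have "Q ks (A k y) = 0" using Cons.prems by (simp add: QC QA)
    moreover have "set ks \<subseteq> set (remove1 k ls)"
      using Cons.prems by (metis distinct.simps(2) in_set_remove1 list.set_intros(2) subsetD subsetI)
    ultimately have "Q (remove1 k ls) (A k y) = 0" using Cons by auto
    then show ?case using del[of k ls y] Cons.prems by (simp add: QA)
  qed
  have ex: "\<exists>ls. distinct ls \<and> Q ls y = 0" for y
  proof (rule eigenvector_induct[OF ss, of "\<lambda>y. \<exists>ls. distinct ls \<and> Q ls y = 0"])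
    show "\<exists>ls. distinct ls \<and> Q ls 0 = 0" by (auto intro!: exI[of _ "[]"] simp: Q0)
    show "\<exists>ls. distinct ls \<and> Q ls (y + z) = 0" if yz: "\<exists>ls. distinct ls \<and> Q ls y = 0" "\<exists>ls. distinct ls \<and> Q ls z = 0" for y z
    proof -
      obtain ks ls where "distinct ks" "Q ks y = 0" "distinct ls" "Q ls z = 0" using yz by auto
      then have "Q (remdups (ks @ ls)) (y + z) = 0"
        by (simp add: clinear_add[OF linP] sup[of ks y] sup[of ls z] del: remdups.simps)
      then show ?thesis using distinct_remdups by blast
    qed
    show "\<exists>ls. distinct ls \<and> Q ls y = 0" if "\<sigma> y = c *\<^sub>C y" for c y
      using that by (intro exI[of _ "[c]"]) (simp add: QC Q0 A_def)
  qed
  obtain ls where ls: "distinct ls" "Q ls x = 0" using ex by blast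
  have "Q (remove1 \<nu> ls) w = 0"
  proof -
    have "A \<nu> x = w" using x by (simp add: A_def)
    then have eq: "Q (remove1 \<nu> ls) w = A \<nu> (Q (remove1 \<nu> ls) x)" by (simp flip: QA)
    show ?thesis
    proof (cases "\<nu> \<in> set ls")
      case True then show ?thesis using ls(2) del eq by simp
    next
      case False
      then show ?thesis using ls(2) eq by (simp add: remove1_idem clinear_zero[OF linA])
    qed
  qed
  moreover have "\<exists>c. c \<noteq> 0 \<and> Q ks w = c *\<^sub>C w" if "\<nu> \<notin> set ks" for ks
    using that
  proof (induction ks)
    case Nil then show ?case by (auto simp: Q0 scaleC_one intro: exI[of _ 1])
  next
    case (Cons k ks)
    then obtain c where "c \<noteq> 0" "Q ks w = c *\<^sub>C w" by auto
    then show ?case using Cons.prems w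
      by (intro exI[of _ "c * (\<nu> - k)"])
        (auto simp: QC A_def clinear_scale[OF lin] scaleC_scaleC cvec.scale_left_diff_distrib algebra_simps)
  qed
  moreover have "\<nu> \<notin> set (remove1 \<nu> ls)" using ls(1) by simp
  ultimately show ?thesis by (metis cvec.scale_eq_0_iff)
qed

lemma jordan_decompD:
  assumes "jordan_decomp \<phi> \<sigma> N"
  shows "semisimple_op \<sigma>" "clinear \<sigma>" "locally_nilpotent N" "clinear N"
    and "\<sigma> (N x) = N (\<sigma> x)" "\<phi> x = \<sigma> (exp_op (- 2 * of_real pi * \<i>) N x)"
  using assms unfolding jordan_decomp_def semisimple_op_def locally_nilpotent_def by auto

lemma funpow_eigenvector:
  assumes "\<And>x. \<sigma> (N x) = N (\<sigma> x)" "clinear N" "\<sigma> x = \<tau> *\<^sub>C x"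
  shows "\<sigma> ((N ^^ j) x) = \<tau> *\<^sub>C (N ^^ j) x"
  using assms by (induction j) (simp_all add: clinear_scale)

lemma exp_op_eigenvector:
  assumes "clinear \<sigma>" "\<And>x. \<sigma> (N x) = N (\<sigma> x)" "locally_nilpotent N" "\<sigma> x = \<tau> *\<^sub>C x"
  shows "\<sigma> (exp_op c N x) = \<tau> *\<^sub>C exp_op c N x"
proof -
  have lin: "clinear N" using assms by (simp add: locally_nilpotent_def)
  obtain n where "(N ^^ n) x = 0" using assms by (auto simp: locally_nilpotent_def)
  then show ?thesis
    by (simp add: exp_op_eq_sum[OF lin] clinear_sum[OF assms(1)] clinear_scale[OF assms(1)]
        funpow_eigenvector[OF assms(2) lin assms(4)] cvec.scale_sum_right scaleC_scaleC mult.commute)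
qed

text \<open>Splitting off the constant term shows that \<open>exp(c f) x - x\<close> is built from iterates of \<open>f x\<close>, a vector
of smaller nilpotency degree than \<open>x\<close>; inductions on that degree rest on this.\<close>

lemma exp_op_minus_id:
  assumes "clinear f" "(f ^^ Suc n) x = 0"
  shows "exp_op c f x = x + (\<Sum>j<n. (c ^ Suc j / fact (Suc j)) *\<^sub>C (f ^^ j) (f x))"
proof -
  have "exp_op c f x = (c ^ 0 / fact 0) *\<^sub>C (f ^^ 0) x + (\<Sum>j<n. (c ^ Suc j / fact (Suc j)) *\<^sub>C (f ^^ Suc j) x)"
    unfolding exp_op_eq_sum[OF assms] by (rule sum.lessThan_Suc_shift)
  then show ?thesis by (simp add: scaleC_one funpow_swap1)
qed

text \<open>Induction on the nilpotency degree of \<open>x\<close>: applied to \<open>N x\<close>, the induction hypothesis says that all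
terms of \<open>exp(cN) x\<close> but the first are eigenvectors of \<open>\<sigma>\<close>. Hence \<open>(\<sigma> - \<nu>) x\<close> is an eigenvector for \<open>\<nu>\<close>, which
leaves only \<open>0\<close> by \<open>semisimple_no_generalized\<close>.\<close>

lemma jordan_generalized_eigenvector:
  assumes J: "jordan_decomp \<phi> \<sigma> N" and w: "\<sigma> w = \<nu> *\<^sub>C w" and x: "\<phi> x = \<nu> *\<^sub>C x + w"
  shows "\<sigma> x = \<nu> *\<^sub>C x"
proof -
  note [simp] = jordan_decompD(5)[OF J]
  have lin: "clinear N" and lins: "clinear \<sigma>" using jordan_decompD[OF J] by auto
  have phiN: "\<phi> (N x) = N (\<phi> x)" for x
  proof -
    obtain n where n: "(N ^^ n) x = 0" using jordan_decompD(3)[OF J] by (auto simp: locally_nilpotent_def)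
    have n': "(N ^^ n) (N x) = 0" using n by (simp add: funpow_swap1[symmetric] clinear_zero[OF lin])
    have "exp_op c N (N x) = N (exp_op c N x)" for c
      unfolding exp_op_eq_sum[OF lin n] exp_op_eq_sum[OF lin n']
      by (simp add: clinear_sum[OF lin] clinear_scale[OF lin] funpow_swap1)
    then show ?thesis by (simp add: jordan_decompD(6)[OF J])
  qed
  have "(N ^^ n) x = 0 \<Longrightarrow> \<sigma> w = \<nu> *\<^sub>C w \<Longrightarrow> \<phi> x = \<nu> *\<^sub>C x + w \<Longrightarrow> \<sigma> x = \<nu> *\<^sub>C x" for n x w
  proof (induction n arbitrary: x w)
    case 0 then show ?case by (simp add: clinear_zero[OF lins])
  next
    case (Suc n)
    have Nx: "\<sigma> (N x) = \<nu> *\<^sub>C N x"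
    proof (rule Suc.IH)
      show "(N ^^ n) (N x) = 0" using Suc.prems by (simp add: funpow_swap1)
      show "\<sigma> (N w) = \<nu> *\<^sub>C N w" using Suc.prems by (simp add: clinear_scale[OF lin])
      show "\<phi> (N x) = \<nu> *\<^sub>C N x + N w" using Suc.prems by (simp add: phiN clinear_add[OF lin] clinear_scale[OF lin])
    qed
    define d where "d j = (- 2 * of_real pi * \<i>) ^ Suc j / fact (Suc j)" for j
    define y where "y = (\<Sum>j<n. d j *\<^sub>C (N ^^ j) (N x))"
    have y: "\<sigma> y = \<nu> *\<^sub>C y"
      unfolding y_def using funpow_eigenvector[OF jordan_decompD(5)[OF J] lin Nx]
      by (simp add: clinear_sum[OF lins] clinear_scale[OF lins] cvec.scale_sum_right scaleC_scaleC mult.commute)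
    have "\<phi> x = \<sigma> x + \<nu> *\<^sub>C y"
      unfolding jordan_decompD(6)[OF J] exp_op_minus_id[OF lin Suc.prems(1)] d_def[symmetric] y_def[symmetric]
      by (simp add: clinear_add[OF lins] y)
    then have "\<sigma> x = \<nu> *\<^sub>C x + (w - \<nu> *\<^sub>C y)" using Suc.prems(3) by (simp add: algebra_simps)
    moreover have "\<sigma> (w - \<nu> *\<^sub>C y) = \<nu> *\<^sub>C (w - \<nu> *\<^sub>C y)"
      using Suc.prems(2) y by (simp add: clinear_diff[OF lins] clinear_scale[OF lins] cvec.scale_right_diff_distrib)
    ultimately show ?case using semisimple_no_generalized[OF jordan_decompD(1)[OF J]] by (metis add.right_neutral)
  qed
  moreover obtain n where "(N ^^ n) x = 0" using jordan_decompD(3)[OF J] by (auto simp: locally_nilpotent_def)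
  ultimately show ?thesis using w x by blast
qed

lemma jordan_eigenvector_nonzero:
  assumes "jordan_decomp \<phi> \<sigma> N" "inj \<phi>" "\<sigma> x = \<tau> *\<^sub>C x" "x \<noteq> 0"
  shows "\<tau> \<noteq> 0"
proof
  assume "\<tau> = 0"
  then have "\<phi> x = 0" "\<phi> 0 = 0"
    using exp_op_eigenvector[OF jordan_decompD(2,5,3)[OF assms(1)] assms(3)]
      exp_op_eigenvector[OF jordan_decompD(2,5,3)[OF assms(1)], of 0 0]
      jordan_decompD(6)[OF assms(1)] clinear_zero[OF jordan_decompD(2)[OF assms(1)]] by auto
  then show False using assms(2,4) by (metis injD)
qed

lemma jordan_eigenvector_power:
  assumes J: "jordan_decomp \<phi> \<sigma> N" and x: "\<sigma> x = \<tau> *\<^sub>C x" 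
  shows "(\<phi> ^^ m) x = \<tau> ^ m *\<^sub>C exp_op (of_nat m * (- 2 * of_real pi * \<i>)) N x"
proof (induction m)
  case 0
  obtain n where "(N ^^ n) x = 0" using jordan_decompD(3)[OF J] by (auto simp: locally_nilpotent_def)
  then have "(N ^^ Suc n) x = 0" by (simp add: clinear_zero[OF jordan_decompD(4)[OF J]])
  from exp_op_minus_id[OF jordan_decompD(4)[OF J] this, of 0] show ?case by (simp add: scaleC_one)
next
  case (Suc m)
  have lins: "clinear \<sigma>" using jordan_decompD[OF J] by auto
  let ?c = "- 2 * of_real pi * \<i>"
  define y where "y = exp_op (of_nat m * ?c) N x"
  have y: "\<sigma> (exp_op ?c N y) = \<tau> *\<^sub>C exp_op ?c N y"
    unfolding y_def by (intro exp_op_eigenvector jordan_decompD[OF J] x)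
  note exp = exp_op_scale[OF jordan_decompD(3)[OF J]]
  have "(\<phi> ^^ Suc m) x = \<sigma> (exp_op ?c N (\<tau> ^ m *\<^sub>C y))" by (simp add: Suc y_def jordan_decompD(6)[OF J])
  also have "\<dots> = \<tau> ^ Suc m *\<^sub>C exp_op ?c N y"
    unfolding exp clinear_scale[OF lins] y by (simp add: scaleC_scaleC mult.commute)
  also have "exp_op ?c N y = exp_op (of_nat (Suc m) * ?c) N x"
    unfolding y_def exp_op_add[OF jordan_decompD(3)[OF J]] by (simp add: algebra_simps)
  finally show ?case .
qed

text \<open>Induction on the sum of the nilpotency degrees of \<open>a\<close> and \<open>b\<close>. The unipotent parts change \<open>a\<close> and \<open>b\<close> by
vectors \<open>a'\<close> and \<open>b'\<close> of smaller degree in the same eigenspaces. Hence \<open>\<phi>3\<close> acts on \<open>f a b\<close> as the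
scalar \<open>\<tau>\<mu>\<close> up to an eigenvector for \<open>\<tau>\<mu>\<close>, and \<open>jordan_generalized_eigenvector\<close> applies.\<close>

lemma jordan_bilinear_semisimple_eigenvectors:
  assumes J1: "jordan_decomp \<phi>1 \<sigma>1 N1" and J2: "jordan_decomp \<phi>2 \<sigma>2 N2" and J3: "jordan_decomp \<phi>3 \<sigma>3 N3"
    and f: "cbilinear f" and eq: "\<And>a b. \<phi>3 (f a b) = f (\<phi>1 a) (\<phi>2 b)"
    and a: "\<sigma>1 a = \<tau> *\<^sub>C a" and b: "\<sigma>2 b = \<mu> *\<^sub>C b"
  shows "\<sigma>3 (f a b) = (\<tau> * \<mu>) *\<^sub>C f a b"
proof -
  note l1 = jordan_decompD(4)[OF J1] and l2 = jordan_decompD(4)[OF J2]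
  note s1 = jordan_decompD(2)[OF J1] and s2 = jordan_decompD(2)[OF J2] and s3 = jordan_decompD(2)[OF J3]
  note fr = cbilinear_right[OF f] and fl = cbilinear_left[OF f]
  let ?c = "- 2 * of_real pi * \<i> :: complex"
  have "p + q \<le> n \<Longrightarrow> (N1 ^^ p) a = 0 \<Longrightarrow> (N2 ^^ q) b = 0 \<Longrightarrow> \<sigma>1 a = \<tau> *\<^sub>C a \<Longrightarrow> \<sigma>2 b = \<mu> *\<^sub>C b \<Longrightarrow>
    \<sigma>3 (f a b) = (\<tau> * \<mu>) *\<^sub>C f a b" for n p q a b
  proof (induction n arbitrary: p q a b)
    case 0 then show ?case by (simp add: clinear_zero[OF fl] clinear_zero[OF s3])
  next
    case (Suc n)
    show ?case
    proof (cases "p = 0 \<or> q = 0")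
      case True
      then show ?thesis using Suc.prems by (auto simp: clinear_zero[OF fl] clinear_zero[OF fr] clinear_zero[OF s3])
    next
      case False
      then obtain p' q' where p: "p = Suc p'" and q: "q = Suc q'" by (metis not0_implies_Suc)
      define d where "d j = ?c ^ Suc j / fact (Suc j)" for j
      define a' where "a' = (\<Sum>j<p'. d j *\<^sub>C (N1 ^^ j) (N1 a))"
      define b' where "b' = (\<Sum>j<q'. d j *\<^sub>C (N2 ^^ j) (N2 b))"
      have ea: "exp_op ?c N1 a = a + a'" and eb: "exp_op ?c N2 b = b + b'"
        using exp_op_minus_id[OF l1, of p' a ?c] exp_op_minus_id[OF l2, of q' b ?c] Suc.prems p q
        by (simp_all add: a'_def b'_def d_def)
      have Na: "\<sigma>1 (N1 a) = \<tau> *\<^sub>C N1 a" and Nb: "\<sigma>2 (N2 b) = \<mu> *\<^sub>C N2 b"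
        using Suc.prems jordan_decompD(5)[OF J1] jordan_decompD(5)[OF J2] by (simp_all add: clinear_scale[OF l1] clinear_scale[OF l2])
      have sa: "\<sigma>1 a' = \<tau> *\<^sub>C a'"
        unfolding a'_def using funpow_eigenvector[OF jordan_decompD(5)[OF J1] l1 Na]
        by (simp add: clinear_sum[OF s1] clinear_scale[OF s1] cvec.scale_sum_right scaleC_scaleC mult.commute)
      have sb: "\<sigma>2 b' = \<mu> *\<^sub>C b'"
        unfolding b'_def using funpow_eigenvector[OF jordan_decompD(5)[OF J2] l2 Nb]
        by (simp add: clinear_sum[OF s2] clinear_scale[OF s2] cvec.scale_sum_right scaleC_scaleC mult.commute)
      have na: "(N1 ^^ p') a' = 0"
      proof -
        have "(N1 ^^ p') ((N1 ^^ j) (N1 a)) = 0" for j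
        proof -
          have "(N1 ^^ (p' + j + 1)) a = 0" by (rule funpow_zero_mono[OF l1 Suc.prems(2)]) (simp add: p)
          then show ?thesis by (simp add: funpow_add funpow_swap1)
        qed
        then show ?thesis by (simp add: a'_def clinear_sum[OF clinear_funpow[OF l1]] clinear_scale[OF clinear_funpow[OF l1]])
      qed
      have nb: "(N2 ^^ q') b' = 0"
      proof -
        have "(N2 ^^ q') ((N2 ^^ j) (N2 b)) = 0" for j
        proof -
          have "(N2 ^^ (q' + j + 1)) b = 0" by (rule funpow_zero_mono[OF l2 Suc.prems(3)]) (simp add: q)
          then show ?thesis by (simp add: funpow_add funpow_swap1)
        qed
        then show ?thesis by (simp add: b'_def clinear_sum[OF clinear_funpow[OF l2]] clinear_scale[OF clinear_funpow[OF l2]])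
      qed
      have IH: "\<sigma>3 (f a' b) = (\<tau> * \<mu>) *\<^sub>C f a' b" "\<sigma>3 (f a b') = (\<tau> * \<mu>) *\<^sub>C f a b'" "\<sigma>3 (f a' b') = (\<tau> * \<mu>) *\<^sub>C f a' b'"
        using Suc.IH[of p' q a' b] Suc.IH[of p q' a b'] Suc.IH[of p' q' a' b'] Suc.prems sa sb na nb p q by auto
      have "\<phi>1 a = \<tau> *\<^sub>C (a + a')" "\<phi>2 b = \<mu> *\<^sub>C (b + b')"
        unfolding jordan_decompD(6)[OF J1] jordan_decompD(6)[OF J2] ea eb using Suc.prems sa sb
        by (simp_all add: clinear_add[OF s1] clinear_add[OF s2] scaleC_add_right)
      then have "\<phi>3 (f a b) = (\<tau> * \<mu>) *\<^sub>C f a b + (\<tau> * \<mu>) *\<^sub>C (f a' b + f a b' + f a' b')"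
        by (simp add: eq clinear_scale[OF fl] clinear_scale[OF fr] clinear_add[OF fl] clinear_add[OF fr] scaleC_scaleC
            scaleC_add_right mult.commute)
      moreover have "\<sigma>3 ((\<tau> * \<mu>) *\<^sub>C (f a' b + f a b' + f a' b')) = (\<tau> * \<mu>) *\<^sub>C ((\<tau> * \<mu>) *\<^sub>C (f a' b + f a b' + f a' b'))"
        by (simp add: IH clinear_add[OF s3] clinear_scale[OF s3] scaleC_add_right)
      ultimately show ?thesis using jordan_generalized_eigenvector[OF J3] by blast
    qed
  qed
  moreover obtain p q where "(N1 ^^ p) a = 0" "(N2 ^^ q) b = 0"
    using jordan_decompD(3)[OF J1] jordan_decompD(3)[OF J2] unfolding locally_nilpotent_def by metis
  ultimately show ?thesis using a b by blast
qed

text \<open>On eigenvectors, the compatibility of \<open>f\<close> with the powers \<open>\<phi>\<^sup>m\<close> reads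
\<open>exp(mcN) f(a,b) = f(exp(mcN) a, exp(mcN) b)\<close> after division by the eigenvalues. Both sides are
polynomials in \<open>m\<close> with vector coefficients, and the claim is the equality of their linear
coefficients. Injectivity makes the eigenvalues nonzero.\<close>

lemma jordan_bilinear_nilpotent:
  assumes J1: "jordan_decomp \<phi>1 \<sigma>1 N1" and J2: "jordan_decomp \<phi>2 \<sigma>2 N2" and J3: "jordan_decomp \<phi>3 \<sigma>3 N3"
    and inj: "inj \<phi>1" "inj \<phi>2"
    and f: "cbilinear f" and eq: "\<And>a b. \<phi>3 (f a b) = f (\<phi>1 a) (\<phi>2 b)"
  shows "N3 (f a b) = f (N1 a) b + f a (N2 b)"
proof -
  note l1 = jordan_decompD(4)[OF J1] and l2 = jordan_decompD(4)[OF J2] and l3 = jordan_decompD(4)[OF J3]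
  note fr = cbilinear_right[OF f] and fl = cbilinear_left[OF f]
  define c :: complex where "c = - 2 * of_real pi * \<i>"
  have eig: "N3 (f a b) = f (N1 a) b + f a (N2 b)" if a: "\<sigma>1 a = \<tau> *\<^sub>C a" and b: "\<sigma>2 b = \<mu> *\<^sub>C b" for a b \<tau> \<mu>
  proof (cases "a = 0 \<or> b = 0")
    case True
    then show ?thesis by (auto simp: clinear_zero[OF fl] clinear_zero[OF fr] clinear_zero[OF l1] clinear_zero[OF l2] clinear_zero[OF l3])
  next
    case False
    have nz: "\<tau> * \<mu> \<noteq> 0"
      using False jordan_eigenvector_nonzero[OF J1 inj(1) a] jordan_eigenvector_nonzero[OF J2 inj(2) b] by auto
    obtain p q r where pqr: "(N1 ^^ p) a = 0" "(N2 ^^ q) b = 0" "(N3 ^^ r) (f a b) = 0"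
      using jordan_decompD(3)[OF J1] jordan_decompD(3)[OF J2] jordan_decompD(3)[OF J3]
      unfolding locally_nilpotent_def by metis
    define n where "n = p + q + r + 2"
    have n: "(N1 ^^ n) a = 0" "(N2 ^^ n) b = 0" "(N3 ^^ n) (f a b) = 0" "n \<ge> 2"
      by (rule funpow_zero_mono[OF l1 pqr(1)] funpow_zero_mono[OF l2 pqr(2)] funpow_zero_mono[OF l3 pqr(3)]; simp add: n_def)+
        (simp add: n_def)
    define w where "w l = (c ^ l / fact l) *\<^sub>C (N3 ^^ l) (f a b)" for l
    define u where "u ij = (case ij of (i, j) \<Rightarrow> (c ^ (i + j) / (fact i * fact j)) *\<^sub>C f ((N1 ^^ i) a) ((N2 ^^ j) b))" for ij
    have sab: "\<sigma>3 (f a b) = (\<tau> * \<mu>) *\<^sub>C f a b"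
      by (rule jordan_bilinear_semisimple_eigenvectors[OF J1 J2 J3 f eq a b])
    have key: "(\<Sum>l<n. of_nat m ^ l *\<^sub>C w l) = (\<Sum>ij\<in>{..<n} \<times> {..<n}. of_nat m ^ (fst ij + snd ij) *\<^sub>C u ij)" for m
    proof -
      have "(\<phi>3 ^^ m) (f a b) = f ((\<phi>1 ^^ m) a) ((\<phi>2 ^^ m) b)" by (induction m) (simp_all add: eq)
      then have "(\<tau> * \<mu>) ^ m *\<^sub>C exp_op (of_nat m * c) N3 (f a b) = (\<tau> * \<mu>) ^ m *\<^sub>C f (exp_op (of_nat m * c) N1 a) (exp_op (of_nat m * c) N2 b)"
        by (simp add: jordan_eigenvector_power[OF J1 a, folded c_def] jordan_eigenvector_power[OF J2 b, folded c_def] jordan_eigenvector_power[OF J3 sab, folded c_def]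
            clinear_scale[OF fl] clinear_scale[OF fr] scaleC_scaleC power_mult_distrib mult.commute)
      then have "exp_op (of_nat m * c) N3 (f a b) = f (exp_op (of_nat m * c) N1 a) (exp_op (of_nat m * c) N2 b)" using nz by simp
      moreover have "exp_op (of_nat m * c) N3 (f a b) = (\<Sum>l<n. of_nat m ^ l *\<^sub>C w l)"
        unfolding exp_op_eq_sum[OF l3 n(3)] w_def by (simp add: scaleC_scaleC power_mult_distrib)
      moreover have "f (exp_op (of_nat m * c) N1 a) (exp_op (of_nat m * c) N2 b) = (\<Sum>ij\<in>{..<n} \<times> {..<n}. of_nat m ^ (fst ij + snd ij) *\<^sub>C u ij)"
      proof -
        let ?A = "\<lambda>i. ((of_nat m * c) ^ i / fact i) *\<^sub>C (N1 ^^ i) a"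
        let ?B = "\<lambda>j. ((of_nat m * c) ^ j / fact j) *\<^sub>C (N2 ^^ j) b"
        have "f (sum ?A {..<n}) (sum ?B {..<n}) = (\<Sum>i<n. f (?A i) (sum ?B {..<n}))"
          by (rule clinear_sum[OF fl])
        also have "\<dots> = (\<Sum>i<n. \<Sum>j<n. f (?A i) (?B j))" by (simp only: clinear_sum[OF fr])
        also have "\<dots> = (\<Sum>i<n. \<Sum>j<n. of_nat m ^ (i + j) *\<^sub>C u (i, j))"
        proof (intro sum.cong refl)
          fix i j
          have "f (?A i) (?B j) = (((of_nat m * c) ^ i / fact i) * ((of_nat m * c) ^ j / fact j)) *\<^sub>C f ((N1 ^^ i) a) ((N2 ^^ j) b)"
            by (simp only: clinear_scale[OF fl] clinear_scale[OF fr] scaleC_scaleC mult.commute)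
          also have "((of_nat m * c) ^ i / fact i) * ((of_nat m * c) ^ j / fact j) = of_nat m ^ (i + j) * (c ^ (i + j) / (fact i * fact j))"
            by (simp add: power_mult_distrib power_add)
          finally show "f (?A i) (?B j) = of_nat m ^ (i + j) *\<^sub>C u (i, j)" by (simp add: u_def scaleC_scaleC)
        qed
        also have "\<dots> = (\<Sum>ij\<in>{..<n} \<times> {..<n}. of_nat m ^ (fst ij + snd ij) *\<^sub>C u ij)"
          by (simp add: sum.cartesian_product case_prod_unfold)
        finally show ?thesis unfolding exp_op_eq_sum[OF l1 n(1)] exp_op_eq_sum[OF l2 n(2)] .
      qed
      ultimately show ?thesis by simp
    qed
    have "(\<Sum>l\<in>{l\<in>{..<n}. l = 1}. w l) = (\<Sum>ij\<in>{ij\<in>{..<n} \<times> {..<n}. fst ij + snd ij = 1}. u ij)"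
      by (rule vector_polynomial_coefficients_unique[OF _ _ key]) auto
    moreover have "{l\<in>{..<n}. l = 1} = {1}" "{ij\<in>{..<n} \<times> {..<n}. fst ij + snd ij = 1} = {(0, 1), (1, 0)}"
      using n(4) by auto
    ultimately have "w 1 = u (0, 1) + u (1, 0)" by simp
    then have "c *\<^sub>C N3 (f a b) = c *\<^sub>C (f (N1 a) b + f a (N2 b))"
      by (simp add: w_def u_def scaleC_add_right add.commute)
    moreover have "c \<noteq> 0" by (simp add: c_def)
    ultimately show ?thesis by (metis cvec.scale_left_imp_eq)
  qed
  have cl: "clinear (\<lambda>b. f (N1 a) b + f a (N2 b))" "clinear (\<lambda>b. N3 (f a b))"
     "clinear (\<lambda>a. f (N1 a) b + f a (N2 b))" "clinear (\<lambda>a. N3 (f a b))" for a b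
    by (simp_all add: clinear_iff clinear_add[OF fl] clinear_scale[OF fl] clinear_add[OF fr] clinear_scale[OF fr]
        clinear_add[OF l1] clinear_scale[OF l1] clinear_add[OF l2] clinear_scale[OF l2] clinear_add[OF l3] clinear_scale[OF l3]
        scaleC_add_right)
  have "N3 (f a b) = f (N1 a) b + f a (N2 b)" if a: "\<sigma>1 a = \<tau> *\<^sub>C a" for a \<tau>
    by (rule clinear_eq_on_eigenvectors[OF jordan_decompD(1)[OF J2] cl(2) cl(1)]) (rule eig[OF a])
  then show ?thesis
    by (rule clinear_eq_on_eigenvectors[OF jordan_decompD(1)[OF J1] cl(4) cl(3)])
qed

text \<open>A linear map \<open>f\<close> is handled as the bilinear map \<open>(a, c) \<mapsto> c f(a)\<close>, with the trivial automorphism on the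
second argument.\<close>

lemma jordan_decomp_id_complex: "jordan_decomp id id (\<lambda>_. 0 :: complex)"
proof -
  have "semisimple_op (id :: complex \<Rightarrow> complex)"
  proof -
    have "{x :: complex. \<exists>c. id x = c *\<^sub>C x} = UNIV" by (auto intro!: exI[of _ 1] simp: scaleC_one)
    then show ?thesis by (simp add: semisimple_op_def clinear_iff)
  qed
  moreover have "clinear (\<lambda>_. 0 :: complex)" by (simp add: clinear_iff)
  moreover have "((\<lambda>_. 0 :: complex) ^^ 1) x = 0" for x :: complex by simp
  moreover have "exp_op c (\<lambda>_. 0 :: complex) x = x" for c x
    using exp_op_minus_id[of "\<lambda>_. 0 :: complex" 0 x c] \<open>clinear (\<lambda>_. 0)\<close> by simp
  ultimately show ?thesis unfolding jordan_decomp_def locally_nilpotent_def id_apply by metis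
qed

lemma cbilinear_scaleC:
  assumes "clinear f"
  shows "cbilinear (\<lambda>a c. c *\<^sub>C f a)"
  using assms by (simp add: cbilinear_def clinear_iff scaleC_add_left scaleC_add_right scaleC_scaleC scaleC_complex_def mult.commute)

lemma
  assumes J1: "jordan_decomp \<phi>1 \<sigma>1 N1" and J3: "jordan_decomp \<phi>3 \<sigma>3 N3"
    and f: "clinear f" and eq: "\<And>a. \<phi>3 (f a) = f (\<phi>1 a)"
  shows jordan_linear_semisimple_eigenvector: "\<sigma>1 a = \<tau> *\<^sub>C a \<Longrightarrow> \<sigma>3 (f a) = \<tau> *\<^sub>C f a"
    and jordan_linear_nilpotent: "inj \<phi>1 \<Longrightarrow> N3 (f a) = f (N1 a)"
proof -
  have lin: "clinear \<phi>3"
  proof -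
    note [simp] = clinear_add[OF jordan_decompD(2)[OF J3]] clinear_scale[OF jordan_decompD(2)[OF J3]]
    have "exp_op c N3 (x + y) = exp_op c N3 x + exp_op c N3 y" for c x y
    proof -
      note l = jordan_decompD(4)[OF J3]
      obtain p q where pq: "(N3 ^^ p) x = 0" "(N3 ^^ q) y = 0"
        using jordan_decompD(3)[OF J3] unfolding locally_nilpotent_def by metis
      have n: "(N3 ^^ (p + q)) x = 0" "(N3 ^^ (p + q)) y = 0"
        using funpow_zero_mono[OF l pq(1)] funpow_zero_mono[OF l pq(2)] by simp_all
      then have n': "(N3 ^^ (p + q)) (x + y) = 0" by (simp add: clinear_add[OF clinear_funpow[OF l]])
      show ?thesis unfolding exp_op_eq_sum[OF l n(1)] exp_op_eq_sum[OF l n(2)] exp_op_eq_sum[OF l n']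
        by (simp add: clinear_add[OF clinear_funpow[OF l]] scaleC_add_right sum.distrib)
    qed
    then show ?thesis using exp_op_scale[OF jordan_decompD(3)[OF J3]]
      by (simp add: clinear_iff jordan_decompD(6)[OF J3])
  qed
  let ?g = "\<lambda>a c. c *\<^sub>C f a"
  have g: "cbilinear ?g" by (rule cbilinear_scaleC[OF f])
  have eqg: "\<phi>3 (?g a c) = ?g (\<phi>1 a) (id c)" for a c by (simp add: clinear_scale[OF lin] eq)
  show "\<sigma>3 (f a) = \<tau> *\<^sub>C f a" if "\<sigma>1 a = \<tau> *\<^sub>C a"
  proof -
    have "\<sigma>3 (?g a 1) = (\<tau> * 1) *\<^sub>C ?g a 1"
      by (rule jordan_bilinear_semisimple_eigenvectors[OF J1 jordan_decomp_id_complex J3 g eqg])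
        (simp_all add: that scaleC_one)
    then show ?thesis by (simp add: scaleC_one)
  qed
  show "N3 (f a) = f (N1 a)" if "inj \<phi>1"
  proof -
    have "N3 (?g a 1) = ?g (N1 a) 1 + ?g a 0"
      by (rule jordan_bilinear_nilpotent[OF J1 jordan_decomp_id_complex J3 _ _ g eqg]) (simp_all add: that)
    then show ?thesis by (simp add: scaleC_one)
  qed
qed

section \<open>Dependence of a twisted module on the logarithm\<close>

definition zeta_deriv :: "(nat \<Rightarrow>\<^sub>0 'w::complex_vector) \<Rightarrow> nat \<Rightarrow>\<^sub>0 'w"
  where "zeta_deriv p = Abs_poly_mapping (\<lambda>k. of_nat (Suc k) *\<^sub>C Poly_Mapping.lookup p (Suc k))"

lemma lookup_zeta_deriv:
  "Poly_Mapping.lookup (zeta_deriv p) k = of_nat (Suc k) *\<^sub>C Poly_Mapping.lookup p (Suc k)"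
proof -
  have "finite (Suc -` Poly_Mapping.keys p)" by (intro finite_vimageI) auto
  then have "finite {k. of_nat (Suc k) *\<^sub>C Poly_Mapping.lookup p (Suc k) \<noteq> 0}"
    by (rule finite_subset[rotated]) (auto simp: in_keys_iff)
  then show ?thesis unfolding zeta_deriv_def by simp
qed

lemma lookup_zeta_deriv_power:
  "Poly_Mapping.lookup ((zeta_deriv ^^ i) p) k = (fact (k + i) / fact k) *\<^sub>C Poly_Mapping.lookup p (k + i)"
proof (induction i arbitrary: k)
  case (Suc i)
  have "fact (Suc (k + i)) / fact (Suc k) * of_nat (Suc k) = (fact (Suc (k + i)) / fact k :: complex)"
    by (simp add: field_simps del: of_nat_Suc)
  then show ?case by (simp add: lookup_zeta_deriv Suc scaleC_scaleC mult.commute del: of_nat_Suc fact_Suc)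
qed (simp add: scaleC_one)

lemma clinear_zeta_deriv: "clinear zeta_deriv"
  unfolding clinear_iff
  by (auto intro!: poly_mapping_eqI simp: lookup_zeta_deriv lookup_add lookup_scaleC scaleC_add_right scaleC_scaleC mult.commute)

lemma neg_zeta_deriv_power:
  "((\<lambda>p. - zeta_deriv p) ^^ i) p = (-1) ^ i *\<^sub>C (zeta_deriv ^^ i) p"
  by (induction i) (simp_all add: scaleC_one clinear_scale[OF clinear_zeta_deriv])

lemma locally_nilpotent_neg_zeta_deriv: "locally_nilpotent (\<lambda>p. - zeta_deriv p)"
  unfolding locally_nilpotent_def
proof (intro conjI allI)
  show "clinear (\<lambda>p. - zeta_deriv p)"
    by (simp add: clinear_iff clinear_add[OF clinear_zeta_deriv] clinear_scale[OF clinear_zeta_deriv])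
  fix p :: "nat \<Rightarrow>\<^sub>0 'w::complex_vector"
  obtain n where n: "\<And>k. k \<in> Poly_Mapping.keys p \<Longrightarrow> k < n"
    using finite_nat_set_iff_bounded[of "Poly_Mapping.keys p"] by auto
  have "Poly_Mapping.lookup p (k + n) = 0" for k using n[of "k + n"] by (auto simp: in_keys_iff)
  then have "(zeta_deriv ^^ n) p = 0" by (intro poly_mapping_eqI) (simp add: lookup_zeta_deriv_power)
  then show "\<exists>n. ((\<lambda>p. - zeta_deriv p) ^^ n) p = 0" by (intro exI[of _ n]) (simp add: neg_zeta_deriv_power)
qed

text \<open>Taylor's formula: \<open>exp(c \<partial>\<^sub>\<zeta>)\<close> is the substitution of \<open>\<zeta> + c\<close> for \<open>\<zeta>\<close>. Both signs are negative to match
the convention \<open>\<phi> = \<sigma> exp(- 2\<pi>\<i>\<N>)\<close> with \<open>\<N> = - \<partial>\<^sub>\<zeta>\<close>.\<close>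

lemma lookup_exp_neg_zeta_deriv:
  "Poly_Mapping.lookup (exp_op (- c) (\<lambda>p. - zeta_deriv p) p) k =
    Sum_any (\<lambda>j. (of_nat (j choose k) * c ^ (j - k)) *\<^sub>C Poly_Mapping.lookup p j)"
proof -
  let ?N = "\<lambda>p :: nat \<Rightarrow>\<^sub>0 'a. - zeta_deriv p"
  have "locally_nilpotent ?N" by (rule locally_nilpotent_neg_zeta_deriv)
  then have lin: "clinear ?N" by (simp add: locally_nilpotent_def)
  obtain n where n: "(?N ^^ n) p = 0" using locally_nilpotent_neg_zeta_deriv unfolding locally_nilpotent_def by blast
  have z: "Poly_Mapping.lookup p j = 0" if "j \<ge> n" for j
  proof -
    have "((-1) ^ n * (fact j / fact (j - n))) *\<^sub>C Poly_Mapping.lookup p j = 0"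
      using arg_cong[OF n, of "\<lambda>q. Poly_Mapping.lookup q (j - n)"] that
      by (simp add: neg_zeta_deriv_power lookup_scaleC lookup_zeta_deriv_power scaleC_scaleC)
    then show ?thesis by simp
  qed
  have "Poly_Mapping.lookup (exp_op (- c) ?N p) k = (\<Sum>i<n. ((- c) ^ i / fact i) *\<^sub>C Poly_Mapping.lookup ((?N ^^ i) p) k)"
    unfolding exp_op_eq_sum[OF lin n] by (simp add: lookup_sum lookup_scaleC)
  also have "\<dots> = (\<Sum>i<n. (of_nat (i + k choose k) * c ^ (i + k - k)) *\<^sub>C Poly_Mapping.lookup p (i + k))"
  proof (rule sum.cong[OF refl])
    fix i
    have "(- c) ^ i / fact i * ((-1) ^ i * (fact (k + i) / fact k)) = of_nat (i + k choose k) * c ^ (i + k - k)"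
      by (simp add: binomial_fact power_minus[of c] add.commute field_simps)
    then show "((- c) ^ i / fact i) *\<^sub>C Poly_Mapping.lookup ((?N ^^ i) p) k =
        (of_nat (i + k choose k) * c ^ (i + k - k)) *\<^sub>C Poly_Mapping.lookup p (i + k)"
      by (simp add: neg_zeta_deriv_power lookup_scaleC lookup_zeta_deriv_power scaleC_scaleC add.commute)
  qed
  also have "\<dots> = (\<Sum>j\<in>{0+k..<n+k}. (of_nat (j choose k) * c ^ (j - k)) *\<^sub>C Poly_Mapping.lookup p j)"
    unfolding sum.shift_bounds_nat_ivl by (simp add: lessThan_atLeast0)
  also have "\<dots> = Sum_any (\<lambda>j. (of_nat (j choose k) * c ^ (j - k)) *\<^sub>C Poly_Mapping.lookup p j)"
  proof (rule Sum_any.expand_superset[symmetric])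
    have *: "k \<le> j \<and> j < n + k" if "(of_nat (j choose k) * c ^ (j - k)) *\<^sub>C Poly_Mapping.lookup p j \<noteq> 0" for j
      using that z[of j] by (cases "j < k"; cases "n \<le> j") auto
    then show "{j. (of_nat (j choose k) * c ^ (j - k)) *\<^sub>C Poly_Mapping.lookup p j \<noteq> 0} \<subseteq> {0+k..<n+k}"
      by (intro subsetI) (use * in \<open>simp only: mem_Collect_eq atLeastLessThan_iff add_0\<close>)
  qed simp
  finally show ?thesis .
qed

text \<open>For fixed \<open>w\<close> and \<open>\<gamma>\<close>, the coefficient of \<open>z\<^sup>\<gamma>\<close> in \<open>Y(a)w\<close> is a polynomial in \<open>\<zeta>\<close>. On such polynomials the
monodromy has the Jordan decomposition with semisimple part \<open>exp(2\<pi>\<i>\<gamma>)\<close> and nilpotent part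
\<open>- \<partial>\<^sub>\<zeta>\<close>, and \<open>Y\<close> intertwines \<open>\<phi>\<close> with it.\<close>

lemma
  assumes Y: "clinear Y" and fin: "\<And>a. finite {k. Y a w \<gamma> k \<noteq> 0}"
    and mon: "\<And>a. Y (\<phi> a) = monodromy (Y a)" and J: "jordan_decomp \<phi> \<sigma> N"
  shows twisted_zeta_derivative: "inj \<phi> \<Longrightarrow> of_nat (Suc k) *\<^sub>C Y a w \<gamma> (Suc k) = - Y (N a) w \<gamma> k"
    and twisted_exponents: "\<sigma> a = \<tau> *\<^sub>C a \<Longrightarrow> Y a w \<gamma> k \<noteq> 0 \<Longrightarrow> exp (2 * of_real pi * \<i> * \<gamma>) = \<tau>"
proof -
  define e where "e = exp (2 * of_real pi * \<i> * \<gamma>)"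
  define y where "y a = Abs_poly_mapping (Y a w \<gamma>)" for a
  have y: "Poly_Mapping.lookup (y a) = Y a w \<gamma>" for a using fin unfolding y_def by simp
  let ?N = "\<lambda>p :: nat \<Rightarrow>\<^sub>0 'b. - zeta_deriv p"
  define \<sigma>3 where "\<sigma>3 p = e *\<^sub>C p" for p :: "nat \<Rightarrow>\<^sub>0 'b"
  define \<phi>3 where "\<phi>3 p = \<sigma>3 (exp_op (- 2 * of_real pi * \<i>) ?N p)" for p
  have liny: "clinear y"
    unfolding clinear_iff
    by (auto intro!: poly_mapping_eqI simp: y lookup_add lookup_scaleC clinear_add[OF Y] clinear_scale[OF Y] scaleC_fun_def)
  have "semisimple_op \<sigma>3"
  proof -
    have "{x. \<exists>c. \<sigma>3 x = c *\<^sub>C x} = UNIV" by (auto simp: \<sigma>3_def)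
    then show ?thesis by (simp add: semisimple_op_def clinear_iff \<sigma>3_def scaleC_add_right scaleC_scaleC mult.commute)
  qed
  then have J3: "jordan_decomp \<phi>3 \<sigma>3 ?N"
    by (simp add: jordan_decomp_def locally_nilpotent_neg_zeta_deriv \<phi>3_def \<sigma>3_def clinear_scale[OF clinear_zeta_deriv])
  have eq: "\<phi>3 (y a) = y (\<phi> a)" for a
  proof (rule poly_mapping_eqI)
    fix k
    show "Poly_Mapping.lookup (\<phi>3 (y a)) k = Poly_Mapping.lookup (y (\<phi> a)) k"
      using lookup_exp_neg_zeta_deriv[of "2 * of_real pi * \<i>" "y a" k]
      by (simp add: y mon monodromy_def \<phi>3_def \<sigma>3_def lookup_scaleC e_def)
  qed
  show "of_nat (Suc k) *\<^sub>C Y a w \<gamma> (Suc k) = - Y (N a) w \<gamma> k" if "inj \<phi>"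
    using arg_cong[OF jordan_linear_nilpotent[OF J J3 liny eq that, of a], of "\<lambda>p. Poly_Mapping.lookup p k"]
    by (simp add: y lookup_zeta_deriv minus_equation_iff del: of_nat_Suc)
  show "exp (2 * of_real pi * \<i> * \<gamma>) = \<tau>" if "\<sigma> a = \<tau> *\<^sub>C a" "Y a w \<gamma> k \<noteq> 0"
  proof -
    have "e *\<^sub>C Y a w \<gamma> k = \<tau> *\<^sub>C Y a w \<gamma> k"
      using arg_cong[OF jordan_linear_semisimple_eigenvector[OF J J3 liny eq that(1)], of "\<lambda>p. Poly_Mapping.lookup p k"]
      by (simp add: y \<sigma>3_def lookup_scaleC)
    then show ?thesis using that(2) by (simp add: e_def)
  qed
qed

text \<open>The \<open>\<zeta>\<close>-derivatives of \<open>Y(a)\<close> are \<open>(- 1)\<^sup>j Y(N\<^sup>j a)\<close>, so \<open>exp(\<zeta>N)\<close> cancels the dependence on \<open>\<zeta>\<close>; on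
coefficients this is the vanishing of alternating sums of binomial coefficients.\<close>

lemma X_field_eq:
  assumes deriv: "\<And>k a. of_nat (Suc k) *\<^sub>C Y a w \<gamma> (Suc k) = - Y (N a) w \<gamma> k"
  shows "X_field N Y a w \<gamma> k = (if k = 0 then Y a w \<gamma> 0 else 0)"
proof -
  have pow: "Y ((N ^^ j) a) w \<gamma> m = ((-1) ^ j * (fact (m + j) / fact m)) *\<^sub>C Y a w \<gamma> (m + j)" for j m
  proof (induction j arbitrary: m)
    case (Suc j)
    have "Y ((N ^^ Suc j) a) w \<gamma> m = - (of_nat (Suc m) *\<^sub>C Y ((N ^^ j) a) w \<gamma> (Suc m))"
      by (simp only: deriv funpow.simps comp_apply minus_minus)
    also have "\<dots> = (- (of_nat (Suc m) * ((-1) ^ j * (fact (Suc m + j) / fact (Suc m))))) *\<^sub>C Y a w \<gamma> (m + Suc j)"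
      by (simp add: Suc scaleC_scaleC del: of_nat_Suc fact_Suc)
    also have "- (of_nat (Suc m) * ((-1) ^ j * (fact (Suc m + j) / fact (Suc m)))) = ((-1) ^ Suc j * (fact (m + Suc j) / fact m) :: complex)"
      by (simp add: field_simps del: of_nat_Suc)
    finally show ?case .
  qed (simp add: scaleC_one)
  have "X_field N Y a w \<gamma> k = (\<Sum>j\<le>k. ((-1) ^ j * of_nat (k choose j)) *\<^sub>C Y a w \<gamma> k)"
    unfolding X_field_def pow by (rule sum.cong) (auto simp: scaleC_scaleC binomial_fact)
  also have "\<dots> = (\<Sum>j\<le>k. (-1) ^ j * of_nat (k choose j)) *\<^sub>C Y a w \<gamma> k" by (simp add: cvec.scale_sum_left)
  also have "\<dots> = (if k = 0 then Y a w \<gamma> 0 else 0)"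
    using choose_alternating_sum[of k, where 'a = complex] by (auto simp: scaleC_one)
  finally show ?thesis .
qed

section \<open>Exponents of logarithmic fields\<close>

text \<open>The exponents of an element of \<^const>\<open>LFie\<close>, a finite sum of fields of different classes, lie in
finitely many translates of the natural numbers.\<close>

definition bounded_below_exponents :: "complex set \<Rightarrow> bool"
  where "bounded_below_exponents A \<longleftrightarrow> (\<exists>C. finite C \<and> A \<subseteq> (\<Union>c\<in>C. range (\<lambda>i::nat. c + of_nat i)))"

lemma bounded_below_exponents_subset:
  "bounded_below_exponents A \<Longrightarrow> B \<subseteq> A \<Longrightarrow> bounded_below_exponents B"
  unfolding bounded_below_exponents_def by (meson order_trans)

lemma bounded_below_exponents_Un:
  assumes "bounded_below_exponents A" "bounded_below_exponents B"
  shows "bounded_below_exponents (A \<union> B)"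
proof -
  obtain C D where "finite C" "A \<subseteq> (\<Union>c\<in>C. range (\<lambda>i::nat. c + of_nat i))"
    "finite D" "B \<subseteq> (\<Union>c\<in>D. range (\<lambda>i::nat. c + of_nat i))"
    using assms unfolding bounded_below_exponents_def by blast
  then show ?thesis unfolding bounded_below_exponents_def by (intro exI[of _ "C \<union> D"]) auto
qed

lemma bounded_below_exponents_shift:
  assumes "bounded_below_exponents A"
  shows "bounded_below_exponents ((+) d ` A)"
proof -
  obtain C where "finite C" "A \<subseteq> (\<Union>c\<in>C. range (\<lambda>i::nat. c + of_nat i))"
    using assms unfolding bounded_below_exponents_def by blast
  then show ?thesis unfolding bounded_below_exponents_def
    by (intro exI[of _ "(+) d ` C"]) (auto simp: image_iff subset_eq add.assoc)
qed

lemma bounded_below_exponents_Re: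
  assumes "bounded_below_exponents A"
  shows "finite {\<gamma>\<in>A. Re \<gamma> \<le> r}"
proof -
  obtain C where C: "finite C" "A \<subseteq> (\<Union>c\<in>C. range (\<lambda>i::nat. c + of_nat i))"
    using assms unfolding bounded_below_exponents_def by blast
  have "{\<gamma>\<in>A. Re \<gamma> \<le> r} \<subseteq> (\<Union>c\<in>C. (\<lambda>i. c + of_nat i) ` {..nat \<lceil>r - Re c\<rceil>})"
  proof
    fix \<gamma> assume "\<gamma> \<in> {\<gamma>\<in>A. Re \<gamma> \<le> r}"
    then obtain c i where "c \<in> C" "\<gamma> = c + of_nat i" "Re \<gamma> \<le> r" using C(2) by auto
    then have "real i \<le> r - Re c" by simp
    then have "i \<le> nat \<lceil>r - Re c\<rceil>" by linarith
    then show "\<gamma> \<in> (\<Union>c\<in>C. (\<lambda>i. c + of_nat i) ` {..nat \<lceil>r - Re c\<rceil>})" using \<open>c \<in> C\<close> \<open>\<gamma> = _\<close> by auto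
  qed
  then show ?thesis by (rule finite_subset) (use C(1) in auto)
qed

lemma bounded_below_exponents_finite_pairs:
  assumes "bounded_below_exponents A" "bounded_below_exponents B"
  shows "finite {\<gamma>1\<in>A. \<gamma> - \<gamma>1 \<in> B}"
proof -
  obtain D where D: "finite D" "B \<subseteq> (\<Union>c\<in>D. range (\<lambda>i::nat. c + of_nat i))"
    using assms(2) unfolding bounded_below_exponents_def by blast
  define m where "m = (if D = {} then 0 else Min (Re ` D))"
  have "Re \<gamma>1 \<le> Re \<gamma> - m" if B: "\<gamma> - \<gamma>1 \<in> B" for \<gamma>1
  proof -
    obtain c i where "c \<in> D" "\<gamma> - \<gamma>1 = c + of_nat i" using B D(2) by blast
    then have "Re (\<gamma> - \<gamma>1) = Re (c + of_nat i)" by (simp only:)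
    then have "Re \<gamma> - Re \<gamma>1 = Re c + real i" by simp
    moreover have "m \<le> Re c" using \<open>c \<in> D\<close> D(1) by (auto simp: m_def)
    ultimately show ?thesis by linarith
  qed
  then have "{\<gamma>1\<in>A. \<gamma> - \<gamma>1 \<in> B} \<subseteq> {\<gamma>1\<in>A. Re \<gamma>1 \<le> Re \<gamma> - m}" by auto
  then show ?thesis using bounded_below_exponents_Re[OF assms(1)] finite_subset by blast
qed

definition exponents :: "'w::zero series \<Rightarrow> complex set"
  where "exponents f = {\<gamma>. \<exists>k. f \<gamma> k \<noteq> 0}"

lemma
  assumes "a \<in> LFie"
  shows LFie_clinear: "clinear a"
    and LFie_finite: "finite {k. a v \<gamma> k \<noteq> 0}"
    and LFie_exponents: "bounded_below_exponents (exponents (a v))"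
proof -
  define S where "S = {a :: 'a lfield. clinear a \<and> (\<forall>v \<gamma>. finite {k. a v \<gamma> k \<noteq> 0}) \<and> (\<forall>v. bounded_below_exponents (exponents (a v)))}"
  have "LFie_at \<alpha> \<subseteq> S" for \<alpha>
  proof
    fix a :: "'a lfield" assume a: "a \<in> LFie_at \<alpha>"
    have "bounded_below_exponents (exponents (a v))" for v
    proof -
      obtain n :: int where "\<forall>\<gamma> k. a v \<gamma> k \<noteq> 0 \<longrightarrow> (\<exists>i::nat. \<gamma> = of_nat i - (\<alpha> + of_int n))"
        using a unfolding LFie_at_def log_series_def by blast
      then show ?thesis unfolding bounded_below_exponents_def
        by (intro exI[of _ "{- (\<alpha> + of_int n)}"]) (force simp: exponents_def)
    qed
    then show "a \<in> S" using a by (auto simp: S_def LFie_at_def log_series_def)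
  qed
  moreover have "cvec.subspace S"
  proof (rule cvec.subspaceI)
    show "0 \<in> S" by (auto simp: S_def clinear_iff exponents_def bounded_below_exponents_def)
    show "x + y \<in> S" if "x \<in> S" "y \<in> S" for x y
    proof -
      have "finite {k. (x + y) v \<gamma> k \<noteq> 0}" for v \<gamma>
        by (rule finite_subset[of _ "{k. x v \<gamma> k \<noteq> 0} \<union> {k. y v \<gamma> k \<noteq> 0}"])
          (use that in \<open>auto simp: S_def\<close>)
      moreover have "exponents ((x + y) v) \<subseteq> exponents (x v) \<union> exponents (y v)" for v
        by (auto simp: exponents_def)
      then have "bounded_below_exponents (exponents ((x + y) v))" for v
        by (rule bounded_below_exponents_subset[OF bounded_below_exponents_Un, rotated 2])
          (use that in \<open>simp_all add: S_def\<close>)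
      moreover have "clinear (x + y)" using that by (simp add: S_def clinear_iff scaleC_add_right)
      ultimately show ?thesis by (simp add: S_def)
    qed
    show "c *\<^sub>C x \<in> S" if "x \<in> S" for c x
    proof -
      have "finite {k. (c *\<^sub>C x) v \<gamma> k \<noteq> 0}" for v \<gamma>
        by (rule finite_subset[of _ "{k. x v \<gamma> k \<noteq> 0}"]) (use that in \<open>auto simp: S_def scaleC_fun_def\<close>)
      moreover have "exponents ((c *\<^sub>C x) v) \<subseteq> exponents (x v)" for v
        by (auto simp: exponents_def scaleC_fun_def)
      then have "bounded_below_exponents (exponents ((c *\<^sub>C x) v))" for v
        by (rule bounded_below_exponents_subset[rotated]) (use that in \<open>simp add: S_def\<close>)
      moreover have "clinear (c *\<^sub>C x)"
        using that by (simp add: S_def clinear_iff scaleC_fun_def fun_eq_iff scaleC_add_right scaleC_scaleC mult.commute)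
      ultimately show ?thesis by (simp add: S_def)
    qed
  qed
  ultimately have "LFie \<subseteq> S" unfolding LFie_def by (intro cvec.span_minimal) auto
  then show "clinear a" "finite {k. a v \<gamma> k \<noteq> 0}" "bounded_below_exponents (exponents (a v))"
    using assms by (auto simp: S_def)
qed

section \<open>Restriction to the diagonal\<close>

lemma Sum_any_shift:
  fixes g :: "complex \<Rightarrow> 'a::comm_monoid_add"
  shows "Sum_any (\<lambda>x. g (x + c)) = Sum_any g"
  by (rule Sum_any.reindex_cong[of "\<lambda>x. x + c", symmetric]) (auto simp: inj_def image_iff fun_eq_iff intro!: bijI surjI[of _ "\<lambda>x. x - c"])

text \<open>The condition under which \<^const>\<open>diag_subst\<close> is given by finite sums, and hence is linear.\<close>

definition diag_finite :: "'w::complex_vector series2 \<Rightarrow> bool"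
  where "diag_finite F \<longleftrightarrow> (\<forall>\<gamma>. finite {\<gamma>1. \<exists>k1 k2. F \<gamma>1 (\<gamma> - \<gamma>1) k1 k2 \<noteq> 0})"

lemma diag_finiteI:
  "(\<And>\<gamma>. finite (A \<gamma>)) \<Longrightarrow> (\<And>\<gamma>1 \<gamma>2 k1 k2. F \<gamma>1 \<gamma>2 k1 k2 \<noteq> 0 \<Longrightarrow> \<gamma>1 \<in> A (\<gamma>1 + \<gamma>2)) \<Longrightarrow> diag_finite F"
  unfolding diag_finite_def by (intro allI, rule finite_subset[of _ "A _"]) force+

lemma diag_finite_add:
  assumes "diag_finite F" "diag_finite G"
  shows "diag_finite (F + G)"
proof (rule diag_finiteI)
  let ?S = "\<lambda>F \<gamma>. {\<gamma>1. \<exists>k1 k2. F \<gamma>1 (\<gamma> - \<gamma>1) k1 k2 \<noteq> (0::'a)}"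
  show "finite (?S F \<gamma> \<union> ?S G \<gamma>)" for \<gamma> using assms by (simp add: diag_finite_def)
  show "\<gamma>1 \<in> ?S F (\<gamma>1 + \<gamma>2) \<union> ?S G (\<gamma>1 + \<gamma>2)" if "(F + G) \<gamma>1 \<gamma>2 k1 k2 \<noteq> 0" for \<gamma>1 \<gamma>2 k1 k2
  proof -
    have "F \<gamma>1 \<gamma>2 k1 k2 \<noteq> 0 \<or> G \<gamma>1 \<gamma>2 k1 k2 \<noteq> 0" using that by auto
    then show ?thesis by auto
  qed
qed

lemma diag_finite_scale:
  assumes "diag_finite F" shows "diag_finite (c *\<^sub>C F)"
proof (rule diag_finiteI)
  let ?S = "\<lambda>F \<gamma>. {\<gamma>1. \<exists>k1 k2. F \<gamma>1 (\<gamma> - \<gamma>1) k1 k2 \<noteq> (0::'a)}"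
  show "finite (?S F \<gamma>)" for \<gamma> using assms by (simp add: diag_finite_def)
  show "\<gamma>1 \<in> ?S F (\<gamma>1 + \<gamma>2)" if "(c *\<^sub>C F) \<gamma>1 \<gamma>2 k1 k2 \<noteq> 0" for \<gamma>1 \<gamma>2 k1 k2
    using that by (auto simp: scaleC_fun_def)
qed

lemma diag_finite_diff: "diag_finite F \<Longrightarrow> diag_finite G \<Longrightarrow> diag_finite (F - G)"
  using diag_finite_add[of F "(-1) *\<^sub>C G"] diag_finite_scale[of G "-1"] by (simp add: scaleC_one)

lemma diag_finite_z12_times:
  assumes "diag_finite F" shows "diag_finite (z12_times F)"
proof (rule diag_finiteI)
  let ?S = "\<lambda>F \<gamma>. {\<gamma>1. \<exists>k1 k2. F \<gamma>1 (\<gamma> - \<gamma>1) k1 k2 \<noteq> (0::'a)}"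
  show "finite ((\<lambda>\<gamma>1. \<gamma>1 + 1) ` ?S F (\<gamma> - 1) \<union> ?S F (\<gamma> - 1))" for \<gamma> using assms by (simp add: diag_finite_def)
  show "\<gamma>1 \<in> (\<lambda>\<gamma>1. \<gamma>1 + 1) ` ?S F (\<gamma>1 + \<gamma>2 - 1) \<union> ?S F (\<gamma>1 + \<gamma>2 - 1)" if nz: "z12_times F \<gamma>1 \<gamma>2 k1 k2 \<noteq> 0" for \<gamma>1 \<gamma>2 k1 k2
  proof -
    have "F (\<gamma>1 - 1) \<gamma>2 k1 k2 \<noteq> 0 \<or> F \<gamma>1 (\<gamma>2 - 1) k1 k2 \<noteq> 0" using nz by (auto simp: z12_times_def)
    then consider "F (\<gamma>1 - 1) \<gamma>2 k1 k2 \<noteq> 0" | "F \<gamma>1 (\<gamma>2 - 1) k1 k2 \<noteq> 0" by blast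
    then show ?thesis
    proof cases
      case 1
      then have "\<gamma>1 - 1 \<in> ?S F (\<gamma>1 + \<gamma>2 - 1)" by auto
      then show ?thesis by (intro UnI1 image_eqI[of _ _ "\<gamma>1 - 1"]) auto
    next
      case 2
      then have "\<gamma>1 \<in> ?S F (\<gamma>1 + \<gamma>2 - 1)" by (auto simp: algebra_simps)
      then show ?thesis by simp
    qed
  qed
qed

lemma diag_finite_D_z1:
  assumes "diag_finite F" shows "diag_finite (D_z1 F)"
proof (rule diag_finiteI)
  let ?S = "\<lambda>F \<gamma>. {\<gamma>1. \<exists>k1 k2. F \<gamma>1 (\<gamma> - \<gamma>1) k1 k2 \<noteq> (0::'a)}"
  show "finite ((\<lambda>\<gamma>1. \<gamma>1 - 1) ` ?S F (\<gamma> + 1))" for \<gamma> using assms by (simp add: diag_finite_def)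
  show "\<gamma>1 \<in> (\<lambda>\<gamma>1. \<gamma>1 - 1) ` ?S F (\<gamma>1 + \<gamma>2 + 1)" if nz: "D_z1 F \<gamma>1 \<gamma>2 k1 k2 \<noteq> 0" for \<gamma>1 \<gamma>2 k1 k2
  proof -
    have "F (\<gamma>1 + 1) \<gamma>2 k1 k2 \<noteq> 0 \<or> F (\<gamma>1 + 1) \<gamma>2 (k1 + 1) k2 \<noteq> 0" using nz by (auto simp: D_z1_def)
    then have "\<gamma>1 + 1 \<in> ?S F (\<gamma>1 + \<gamma>2 + 1)" by auto
    then show ?thesis by (intro image_eqI[of _ _ "\<gamma>1 + 1"]) auto
  qed
qed

lemma diag_finite_D_z1_power: "diag_finite F \<Longrightarrow> diag_finite ((D_z1 ^^ k) F)"
  by (induction k) (simp_all add: diag_finite_D_z1)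

lemma diag_finite_z12_power: "diag_finite F \<Longrightarrow> diag_finite ((z12_times ^^ k) F)"
  by (induction k) (simp_all add: diag_finite_z12_times)

lemma diag_finite_slice:
  assumes "diag_finite F"
  shows "finite {\<gamma>1. (\<Sum>i\<le>k. F \<gamma>1 (\<gamma> - \<gamma>1) i (k - i)) \<noteq> 0}"
proof (rule finite_subset)
  show "finite {\<gamma>1. \<exists>k1 k2. F \<gamma>1 (\<gamma> - \<gamma>1) k1 k2 \<noteq> 0}" using assms by (simp add: diag_finite_def)
  show "{\<gamma>1. (\<Sum>i\<le>k. F \<gamma>1 (\<gamma> - \<gamma>1) i (k - i)) \<noteq> 0} \<subseteq> {\<gamma>1. \<exists>k1 k2. F \<gamma>1 (\<gamma> - \<gamma>1) k1 k2 \<noteq> 0}"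
    by (auto dest: sum.not_neutral_contains_not_neutral)
qed

lemma diag_subst_add:
  assumes "diag_finite F" "diag_finite G"
  shows "diag_subst (F + G) = diag_subst F + diag_subst G"
proof (intro ext)
  fix \<gamma> k
  show "diag_subst (F + G) \<gamma> k = (diag_subst F + diag_subst G) \<gamma> k"
    using Sum_any.distrib[OF diag_finite_slice[OF assms(1)] diag_finite_slice[OF assms(2)], of \<gamma> k \<gamma> k]
    by (simp add: diag_subst_def sum.distrib)
qed

lemma diag_subst_scale:
  assumes "diag_finite F"
  shows "diag_subst (c *\<^sub>C F) = c *\<^sub>C diag_subst F"
proof (intro ext)
  fix \<gamma> k
  let ?s = "\<lambda>\<gamma>1. \<Sum>i\<le>k. F \<gamma>1 (\<gamma> - \<gamma>1) i (k - i)"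
  have fin: "finite {\<gamma>1. ?s \<gamma>1 \<noteq> 0}" by (rule diag_finite_slice[OF assms])
  have "diag_subst (c *\<^sub>C F) \<gamma> k = Sum_any (\<lambda>\<gamma>1. c *\<^sub>C ?s \<gamma>1)"
    by (simp add: diag_subst_def scaleC_fun_def cvec.scale_sum_right)
  also have "\<dots> = (\<Sum>\<gamma>1 | ?s \<gamma>1 \<noteq> 0. c *\<^sub>C ?s \<gamma>1)"
    by (rule Sum_any.expand_superset[OF fin]) auto
  also have "\<dots> = c *\<^sub>C Sum_any ?s" by (simp add: cvec.scale_sum_right Sum_any.expand_set)
  finally show "diag_subst (c *\<^sub>C F) \<gamma> k = (c *\<^sub>C diag_subst F) \<gamma> k"
    by (simp add: diag_subst_def scaleC_fun_def)
qed

lemma diag_subst_diff: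
  assumes "diag_finite F" "diag_finite G"
  shows "diag_subst (F - G) = diag_subst F - diag_subst G"
  using diag_subst_add[OF assms(1) diag_finite_scale[OF assms(2), of "-1"]] diag_subst_scale[OF assms(2), of "-1"]
  by (simp add: scaleC_one)

lemma diag_subst_sum:
  assumes "\<And>i. i \<in> I \<Longrightarrow> diag_finite (F i)"
  shows "diag_finite (sum F I) \<and> diag_subst (sum F I) = (\<Sum>i\<in>I. diag_subst (F i))"
  using assms
proof (induction I rule: infinite_finite_induct)
  case (insert x I)
  have fin: "diag_finite (F x)" "diag_finite (sum F I)" and IH: "diag_subst (sum F I) = (\<Sum>i\<in>I. diag_subst (F i))"
    using insert by auto
  show ?case
    by (simp only: sum.insert[OF insert(1,2)] diag_subst_add[OF fin] IH diag_finite_add[OF fin])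
qed (auto simp: diag_finite_def diag_subst_def fun_eq_iff)

lemma diag_subst_z12_times:
  assumes "diag_finite F"
  shows "diag_subst (z12_times F) = 0"
proof (intro ext)
  fix \<gamma> k
  let ?g = "\<lambda>\<gamma>1. \<Sum>i\<le>k. F \<gamma>1 ((\<gamma> - 1) - \<gamma>1) i (k - i)"
  have fin: "finite {x. ?g x \<noteq> 0}" by (rule diag_finite_slice[OF assms])
  have fin': "finite {x. - ?g x \<noteq> 0}" using fin by simp
  have fin1: "finite {x. ?g (x + (-1)) \<noteq> 0}"
  proof -
    have "{x. ?g (x + (-1)) \<noteq> 0} \<subseteq> (\<lambda>x. x + 1) ` {x. ?g x \<noteq> 0}"
      by (auto intro!: image_eqI[of _ "\<lambda>x. x + 1" "_ - 1"])
    then show ?thesis using fin finite_subset by blast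
  qed
  have neg: "Sum_any (\<lambda>x. - ?g x) = - Sum_any ?g"
    by (simp add: Sum_any.expand_set sum_negf)
  have "diag_subst (z12_times F) \<gamma> k = Sum_any (\<lambda>x. ?g (x + (-1)) + - ?g x)"
    by (simp add: diag_subst_def z12_times_def sum_subtractf algebra_simps)
  also have "\<dots> = 0"
    by (simp only: Sum_any.distrib[OF fin1 fin'] Sum_any_shift[of ?g] neg) simp
  finally show "diag_subst (z12_times F) \<gamma> k = 0 \<gamma> k" by simp
qed

lemma clinear_z12_times: "clinear z12_times"
  by (auto simp: clinear_iff z12_times_def scaleC_fun_def fun_eq_iff cvec.scale_right_diff_distrib)

lemma clinear_D_z1: "clinear D_z1"
  by (auto simp: clinear_iff D_z1_def scaleC_fun_def fun_eq_iff scaleC_add_right scaleC_scaleC mult.commute)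

text \<open>\<open>D\<close> is a derivation with \<open>D z\<^sub>1\<^sub>2 = 1\<close>; together with the vanishing of \<open>z\<^sub>1\<^sub>2\<close> on the diagonal this gives
the usual rule for the derivatives of \<open>z\<^sub>1\<^sub>2\<^sup>N G\<close> at \<open>z\<^sub>1\<^sub>2 = 0\<close>.\<close>

lemma D_z1_z12_times: "D_z1 (z12_times F) = z12_times (D_z1 F) + F"
  by (auto simp: D_z1_def z12_times_def fun_eq_iff cvec.scale_right_diff_distrib scaleC_add_left scaleC_one algebra_simps)

lemma D_z1_power_z12_times:
  "(D_z1 ^^ k) (z12_times F) = z12_times ((D_z1 ^^ k) F) + of_nat k *\<^sub>C (D_z1 ^^ (k - 1)) F"
proof (induction k)
  case (Suc k)
  show ?case
  proof (cases k)
    case 0 then show ?thesis by (simp add: D_z1_z12_times scaleC_one)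
  next
    case (Suc k')
    have "(D_z1 ^^ Suc k) (z12_times F) = D_z1 (z12_times ((D_z1 ^^ k) F)) + of_nat k *\<^sub>C D_z1 ((D_z1 ^^ (k - 1)) F)"
      by (simp only: funpow.simps comp_apply Suc.IH clinear_add[OF clinear_D_z1] clinear_scale[OF clinear_D_z1])
    also have "D_z1 ((D_z1 ^^ (k - 1)) F) = (D_z1 ^^ k) F" by (simp add: Suc)
    finally show ?thesis
      by (simp only: D_z1_z12_times of_nat_Suc scaleC_add_left scaleC_one add.assoc funpow.simps comp_apply diff_Suc_1)
  qed
qed simp

lemma diag_subst_D_z1_z12:
  assumes "diag_finite G"
  shows "diag_subst ((D_z1 ^^ k) ((z12_times ^^ N) G)) =
    (if k < N then 0 else (fact k / fact (k - N)) *\<^sub>C diag_subst ((D_z1 ^^ (k - N)) G))"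
proof (induction N arbitrary: k)
  case 0 then show ?case by (simp add: scaleC_one)
next
  case (Suc N)
  let ?H = "(z12_times ^^ N) G"
  have fin: "diag_finite ((D_z1 ^^ k) ?H)" for k
    using assms by (simp add: diag_finite_D_z1_power diag_finite_z12_power)
  have eq: "diag_subst ((D_z1 ^^ k) ((z12_times ^^ Suc N) G)) = of_nat k *\<^sub>C diag_subst ((D_z1 ^^ (k - 1)) ?H)"
    by (simp only: funpow.simps comp_apply D_z1_power_z12_times diag_subst_add diag_subst_scale diag_finite_scale
        diag_finite_z12_times fin diag_subst_z12_times add_0)
  show ?case
  proof (cases k)
    case 0 then show ?thesis unfolding eq by simp
  next
    case (Suc k')
    then show ?thesis unfolding eq
      by (auto simp: Suc.IH scaleC_scaleC scaleC_fun_def fun_eq_iff)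
  qed
qed

section \<open>Products of local fields\<close>

definition exponents1 :: "'w::zero series2 \<Rightarrow> complex set"
  where "exponents1 F = {\<gamma>1. \<exists>\<gamma>2 k1 k2. F \<gamma>1 \<gamma>2 k1 k2 \<noteq> 0}"

definition exponents2 :: "'w::zero series2 \<Rightarrow> complex set"
  where "exponents2 F = {\<gamma>2. \<exists>\<gamma>1 k1 k2. F \<gamma>1 \<gamma>2 k1 k2 \<noteq> 0}"

lemma diag_finite_bounded_below:
  assumes "bounded_below_exponents (exponents1 F)" "bounded_below_exponents (exponents2 F)"
  shows "diag_finite F"
proof (rule diag_finiteI[of "\<lambda>\<gamma>. {\<gamma>1 \<in> exponents1 F. \<gamma> - \<gamma>1 \<in> exponents2 F}"])
  show "finite {\<gamma>1 \<in> exponents1 F. \<gamma> - \<gamma>1 \<in> exponents2 F}" for \<gamma>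
    by (rule bounded_below_exponents_finite_pairs[OF assms])
qed (auto simp: exponents1_def exponents2_def)

lemma exponents_z12_times:
  shows "exponents1 (z12_times F) \<subseteq> exponents1 F \<union> (+) 1 ` exponents1 F"
    and "exponents2 (z12_times F) \<subseteq> exponents2 F \<union> (+) 1 ` exponents2 F"
proof -
  show "exponents1 (z12_times F) \<subseteq> exponents1 F \<union> (+) 1 ` exponents1 F"
  proof
    fix \<gamma>1 assume "\<gamma>1 \<in> exponents1 (z12_times F)"
    then obtain \<gamma>2 k1 k2 where "F (\<gamma>1 - 1) \<gamma>2 k1 k2 - F \<gamma>1 (\<gamma>2 - 1) k1 k2 \<noteq> 0"
      by (auto simp: exponents1_def z12_times_def)
    then have "F (\<gamma>1 - 1) \<gamma>2 k1 k2 \<noteq> 0 \<or> F \<gamma>1 (\<gamma>2 - 1) k1 k2 \<noteq> 0" by auto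
    then have "\<gamma>1 - 1 \<in> exponents1 F \<or> \<gamma>1 \<in> exponents1 F" unfolding exponents1_def by blast
    then show "\<gamma>1 \<in> exponents1 F \<union> (+) 1 ` exponents1 F" by (auto intro: image_eqI[of _ _ "\<gamma>1 - 1"])
  qed
  show "exponents2 (z12_times F) \<subseteq> exponents2 F \<union> (+) 1 ` exponents2 F"
  proof
    fix \<gamma>2 assume "\<gamma>2 \<in> exponents2 (z12_times F)"
    then obtain \<gamma>1 k1 k2 where "F (\<gamma>1 - 1) \<gamma>2 k1 k2 - F \<gamma>1 (\<gamma>2 - 1) k1 k2 \<noteq> 0"
      by (auto simp: exponents2_def z12_times_def)
    then have "F (\<gamma>1 - 1) \<gamma>2 k1 k2 \<noteq> 0 \<or> F \<gamma>1 (\<gamma>2 - 1) k1 k2 \<noteq> 0" by auto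
    then have "\<gamma>2 - 1 \<in> exponents2 F \<or> \<gamma>2 \<in> exponents2 F" unfolding exponents2_def by blast
    then show "\<gamma>2 \<in> exponents2 F \<union> (+) 1 ` exponents2 F" by (auto intro: image_eqI[of _ _ "\<gamma>2 - 1"])
  qed
qed

lemma exponents1_z12_power_closed:
  assumes "exponents1 F \<subseteq> A" "\<And>\<gamma>. \<gamma> \<in> A \<Longrightarrow> \<gamma> + 1 \<in> A"
  shows "exponents1 ((z12_times ^^ N) F) \<subseteq> A"
proof (induction N)
  case (Suc N)
  have "(+) 1 ` A \<subseteq> A" using assms(2) by (auto simp: add.commute)
  then show ?case using Suc exponents_z12_times(1)[of "(z12_times ^^ N) F"] by (simp; blast)
qed (use assms in simp)

lemma exponents1_z12_power_less:
  assumes "exponents1 F \<subseteq> {\<gamma>. Re \<gamma> < r}"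
  shows "exponents1 ((z12_times ^^ N) F) \<subseteq> {\<gamma>. Re \<gamma> < r + real N}"
proof (induction N)
  case (Suc N)
  show ?case
  proof
    fix \<gamma> assume "\<gamma> \<in> exponents1 ((z12_times ^^ Suc N) F)"
    then obtain \<delta> where "\<delta> \<in> exponents1 ((z12_times ^^ N) F)" "\<gamma> = \<delta> \<or> \<gamma> = 1 + \<delta>"
      using exponents_z12_times(1)[of "(z12_times ^^ N) F"] by auto
    moreover then have "Re \<delta> < r + real N" using Suc by auto
    ultimately show "\<gamma> \<in> {\<gamma>. Re \<gamma> < r + real (Suc N)}" by auto
  qed
qed (use assms in simp)

lemma bounded_below_z12_power:
  shows "bounded_below_exponents (exponents1 F) \<Longrightarrow> bounded_below_exponents (exponents1 ((z12_times ^^ N) F))"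
    and "bounded_below_exponents (exponents2 F) \<Longrightarrow> bounded_below_exponents (exponents2 ((z12_times ^^ N) F))"
proof (induction N)
  case (Suc N)
  { case 1 then show ?case
      using bounded_below_exponents_subset[OF bounded_below_exponents_Un[OF _ bounded_below_exponents_shift] exponents_z12_times(1)] Suc by simp }
  { case 2 then show ?case
      using bounded_below_exponents_subset[OF bounded_below_exponents_Un[OF _ bounded_below_exponents_shift] exponents_z12_times(2)] Suc by simp }
qed simp_all

lemma exponents2_comp12:
  assumes "clinear a" shows "exponents2 (comp12 a b v) \<subseteq> exponents (b v)"
  by (auto simp: exponents2_def exponents_def comp12_def) (metis clinear_zero[OF assms] zero_fun_apply)

lemma exponents1_comp21:
  assumes "clinear b" shows "exponents1 (comp21 b a v) \<subseteq> exponents (a v)"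
  by (auto simp: exponents1_def exponents_def comp21_def) (metis clinear_zero[OF assms] zero_fun_apply)

text \<open>\<open>z\<^sub>1\<^sub>2\<^sup>N a(z\<^sub>1)b(z\<^sub>2)v\<close> is bounded below in \<open>z\<^sub>2\<close> because \<open>b(z\<^sub>2)v\<close> is, and by locality it is bounded below in
\<open>z\<^sub>1\<close> because \<open>a(z\<^sub>1)v\<close> is.\<close>

lemma diag_finite_local:
  assumes a: "a \<in> LFie" and b: "b \<in> LFie" and loc: "local_order N a b"
  shows "diag_finite ((z12_times ^^ N) (comp12 a b v))"
proof (rule diag_finite_bounded_below)
  show "bounded_below_exponents (exponents2 ((z12_times ^^ N) (comp12 a b v)))"
    by (intro bounded_below_z12_power bounded_below_exponents_subset[OF LFie_exponents[OF b] exponents2_comp12] LFie_clinear[OF a])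
  have "(z12_times ^^ N) (comp12 a b v) = (z12_times ^^ N) (comp21 b a v)" using loc by (simp add: local_order_def)
  then show "bounded_below_exponents (exponents1 ((z12_times ^^ N) (comp12 a b v)))"
    by (simp, intro bounded_below_z12_power bounded_below_exponents_subset[OF LFie_exponents[OF a] exponents1_comp21] LFie_clinear[OF b])
qed

lemma local_order_mono:
  assumes "local_order N a b" "N \<le> M"
  shows "local_order M a b"
proof -
  have "z12_times ^^ M = z12_times ^^ (M - N) \<circ> (z12_times ^^ N :: 'a series2 \<Rightarrow> _)"
    using assms(2) by (simp flip: funpow_add)
  then show ?thesis using assms(1) by (simp add: local_order_def)
qed

text \<open>The definition of the products uses the least possible \<open>N\<close>. Formulas that involve several fields at once
need a common \<open>N\<close>; replacing \<open>N\<close> by \<open>N + 1\<close> multiplies the series by \<open>z\<^sub>1\<^sub>2\<close> and asks for one more derivative.\<close>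

lemma field_prod_eq:
  assumes a: "a \<in> LFie" and b: "b \<in> LFie" and loc: "local_order N a b" and n: "n = int N - 1 - int k"
  shows "field_prod n a b v = (1 / fact k) *\<^sub>C diag_subst ((D_z1 ^^ k) ((z12_times ^^ N) (comp12 a b v)))"
proof -
  define N0 where "N0 = (LEAST N. local_order N a b)"
  have loc0: "local_order N0 a b" unfolding N0_def using loc by (rule LeastI)
  have le: "N0 \<le> N" unfolding N0_def using loc by (rule Least_le)
  define F where "F = (z12_times ^^ N0) (comp12 a b v)"
  have F: "diag_finite F" unfolding F_def by (rule diag_finite_local[OF a b loc0])
  have "z12_times ^^ N = z12_times ^^ (N - N0) \<circ> (z12_times ^^ N0 :: 'a series2 \<Rightarrow> _)"
    using le by (simp flip: funpow_add)
  then have FN: "(z12_times ^^ N) (comp12 a b v) = (z12_times ^^ (N - N0)) F" by (simp add: F_def)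
  show ?thesis
  proof (cases "n \<le> int N0 - 1")
    case True
    define k0 where "k0 = nat (int N0 - 1 - n)"
    have k: "k = N - N0 + k0" using True le n by (simp add: k0_def)
    have "field_prod n a b v = (1 / fact k0) *\<^sub>C diag_subst ((D_z1 ^^ k0) F)"
      using True F by (simp add: field_prod_def N0_def[symmetric] k0_def Let_def F_def diag_subst_scale diag_finite_D_z1_power)
    also have "\<dots> = (1 / fact k) *\<^sub>C diag_subst ((D_z1 ^^ k) ((z12_times ^^ (N - N0)) F))"
      by (simp add: diag_subst_D_z1_z12[OF F] k scaleC_scaleC)
    finally show ?thesis by (simp add: FN)
  next
    case False
    then have "k < N - N0" using n by linarith
    then have "diag_subst ((D_z1 ^^ k) ((z12_times ^^ N) (comp12 a b v))) = 0"
      by (simp add: FN diag_subst_D_z1_z12[OF F])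
    then show ?thesis using False by (simp add: field_prod_def N0_def[symmetric] Let_def)
  qed
qed

section \<open>A Leibniz formula\<close>

fun falling_factorial_op :: "('f::complex_vector \<Rightarrow> 'f) \<Rightarrow> nat \<Rightarrow> 'f \<Rightarrow> 'f" where
  "falling_factorial_op T 0 x = x"
| "falling_factorial_op T (Suc j) x = T (falling_factorial_op T j x) - of_nat j *\<^sub>C falling_factorial_op T j x"

lemma falling_factorial_op_commute:
  assumes "\<And>x. D (T x) = T (D x)" "clinear D"
  shows "D (falling_factorial_op T j x) = falling_factorial_op T j (D x)"
  by (induction j) (simp_all add: assms(1) clinear_diff[OF assms(2)] clinear_scale[OF assms(2)])

text \<open>The formula for the \<open>n\<close>-th derivative of a product with \<open>z\<^sup>T\<close>, multiplied by \<open>z\<^sup>-\<^sup>T\<close>: conjugation by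
\<open>z\<^sup>T\<close> turns \<open>D\<close> into \<open>D + z\<^sup>-\<^sup>1 T\<close>, with \<open>Z\<close> in the role of \<open>z\<^sup>-\<^sup>1\<close>.\<close>

lemma twisted_leibniz:
  fixes D Z T :: "'f::complex_vector \<Rightarrow> 'f"
  assumes D: "clinear D" and Z: "clinear Z" and T: "clinear T"
    and DZ: "\<And>x. D (Z x) = Z (D x) - Z (Z x)"
    and DT: "\<And>x. D (T x) = T (D x)" and ZT: "\<And>x. Z (T x) = T (Z x)"
  shows "((\<lambda>x. D x + Z (T x)) ^^ n) x =
    (\<Sum>j\<le>n. of_nat (n choose j) *\<^sub>C (Z ^^ j) (falling_factorial_op T j ((D ^^ (n - j)) x)))"
proof -
  let ?f = "falling_factorial_op T"
  have Zj: "clinear (Z ^^ j)" for j by (rule clinear_funpow[OF Z])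
  have DZj: "D ((Z ^^ j) y) = (Z ^^ j) (D y) - of_nat j *\<^sub>C (Z ^^ Suc j) y" for j y
  proof (induction j)
    case (Suc j)
    have "D ((Z ^^ Suc j) y) = Z (D ((Z ^^ j) y)) - (Z ^^ Suc (Suc j)) y" by (simp only: funpow.simps comp_apply DZ)
    also have "\<dots> = (Z ^^ Suc j) (D y) - of_nat j *\<^sub>C (Z ^^ Suc (Suc j)) y - (Z ^^ Suc (Suc j)) y"
      by (simp only: Suc clinear_diff[OF Z] clinear_scale[OF Z] funpow.simps comp_apply)
    finally show ?case by (simp only: of_nat_Suc scaleC_add_left scaleC_one) (simp only: diff_diff_eq add.commute)
  qed simp
  have TZj: "T ((Z ^^ j) y) = (Z ^^ j) (T y)" for j y by (induction j) (simp_all add: ZT[symmetric])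
  \<comment> \<open>Each summand contributes to two neighbouring summands of the next power, as in Pascal's rule.\<close>
  have step: "D ((Z ^^ j) (?f j y)) + Z (T ((Z ^^ j) (?f j y))) = (Z ^^ j) (?f j (D y)) + (Z ^^ Suc j) (?f (Suc j) y)" for j y
  proof -
    have "(Z ^^ Suc j) (?f (Suc j) y) = (Z ^^ Suc j) (T (?f j y)) - of_nat j *\<^sub>C (Z ^^ Suc j) (?f j y)"
      by (simp only: falling_factorial_op.simps clinear_diff[OF Zj] clinear_scale[OF Zj])
    moreover have "Z (T ((Z ^^ j) (?f j y))) = (Z ^^ Suc j) (T (?f j y))" by (simp only: TZj funpow.simps comp_apply)
    ultimately show ?thesis by (simp add: DZj falling_factorial_op_commute[where D = D and T = T, OF DT D])
  qed
  show ?thesis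
  proof (induction n)
    case (Suc n)
    define t where "t j = (Z ^^ j) (?f j ((D ^^ (Suc n - j)) x))" for j
    have E: "clinear (\<lambda>x. D x + Z (T x))"
      using D Z T by (simp add: clinear_iff scaleC_add_right)
    have "((\<lambda>x. D x + Z (T x)) ^^ Suc n) x =
        (\<Sum>j\<le>n. of_nat (n choose j) *\<^sub>C (D ((Z ^^ j) (?f j ((D ^^ (n - j)) x))) + Z (T ((Z ^^ j) (?f j ((D ^^ (n - j)) x))))))"
      by (simp only: funpow.simps comp_apply Suc clinear_sum[OF E] clinear_scale[OF E])
    also have "\<dots> = (\<Sum>j\<le>n. of_nat (n choose j) *\<^sub>C (t j + t (Suc j)))"
    proof (rule sum.cong[OF refl])
      fix j assume "j \<in> {..n}"
      then have "D ((D ^^ (n - j)) x) = (D ^^ (Suc n - j)) x" by (simp add: Suc_diff_le)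
      then show "of_nat (n choose j) *\<^sub>C (D ((Z ^^ j) (?f j ((D ^^ (n - j)) x))) + Z (T ((Z ^^ j) (?f j ((D ^^ (n - j)) x))))) =
          of_nat (n choose j) *\<^sub>C (t j + t (Suc j))"
        unfolding step by (simp only: t_def diff_Suc_Suc)
    qed
    also have "\<dots> = (\<Sum>j\<le>n. of_nat (n choose j) *\<^sub>C t j) + (\<Sum>j\<le>n. of_nat (n choose j) *\<^sub>C t (Suc j))"
      by (simp only: scaleC_add_right sum.distrib)
    also have "(\<Sum>j\<le>n. of_nat (n choose j) *\<^sub>C t j) = (\<Sum>j\<le>Suc n. of_nat (n choose j) *\<^sub>C t j)"
      by (simp add: binomial_eq_0)
    also have "\<dots> = t 0 + (\<Sum>j\<le>n. of_nat (n choose Suc j) *\<^sub>C t (Suc j))"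
      by (subst sum.atMost_Suc_shift) (simp add: scaleC_one)
    also have "t 0 + (\<Sum>j\<le>n. of_nat (n choose Suc j) *\<^sub>C t (Suc j)) + (\<Sum>j\<le>n. of_nat (n choose j) *\<^sub>C t (Suc j)) =
        t 0 + (\<Sum>j\<le>n. of_nat (Suc n choose Suc j) *\<^sub>C t (Suc j))"
      by (simp add: scaleC_add_left sum.distrib add.assoc add.commute)
    also have "\<dots> = (\<Sum>j\<le>Suc n. of_nat (Suc n choose j) *\<^sub>C t j)"
      by (subst sum.atMost_Suc_shift) (simp add: scaleC_one)
    finally show ?case unfolding t_def .
  qed (simp add: scaleC_one)
qed

section \<open>Expansion of the normally ordered product\<close>

definition z1_inverse_times :: "'w series2 \<Rightarrow> 'w series2"
  where "z1_inverse_times F = (\<lambda>\<gamma>1 \<gamma>2 k1 k2. F (\<gamma>1 + 1) \<gamma>2 k1 k2)"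

lemma z1_inverse_times_power:
  "(z1_inverse_times ^^ j) F = (\<lambda>\<gamma>1 \<gamma>2 k1 k2. F (\<gamma>1 + of_nat j) \<gamma>2 k1 k2)"
  by (induction j) (simp_all add: z1_inverse_times_def ac_simps)

lemma diag_finite_z1_inverse_times_power:
  assumes "diag_finite F" shows "diag_finite ((z1_inverse_times ^^ j) F)"
proof (rule diag_finiteI)
  let ?S = "\<lambda>\<gamma>. {\<gamma>1. \<exists>k1 k2. F \<gamma>1 (\<gamma> - \<gamma>1) k1 k2 \<noteq> 0}"
  show "finite ((\<lambda>\<gamma>1. \<gamma>1 - of_nat j) ` ?S (\<gamma> + of_nat j))" for \<gamma> using assms by (simp add: diag_finite_def)
  show "\<gamma>1 \<in> (\<lambda>\<gamma>1. \<gamma>1 - of_nat j) ` ?S (\<gamma>1 + \<gamma>2 + of_nat j)" if "(z1_inverse_times ^^ j) F \<gamma>1 \<gamma>2 k1 k2 \<noteq> 0" for \<gamma>1 \<gamma>2 k1 k2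
    using that by (intro image_eqI[of _ _ "\<gamma>1 + of_nat j"]) (auto simp: z1_inverse_times_power)
qed

lemma diag_subst_z1_inverse_times_power:
  "diag_subst ((z1_inverse_times ^^ j) F) \<gamma> k = diag_subst F (\<gamma> + of_nat j) k"
proof -
  let ?g = "\<lambda>\<gamma>1. \<Sum>i\<le>k. F \<gamma>1 (\<gamma> + of_nat j - \<gamma>1) i (k - i)"
  have "diag_subst ((z1_inverse_times ^^ j) F) \<gamma> k = Sum_any (\<lambda>x. ?g (x + of_nat j))"
    by (simp add: diag_subst_def z1_inverse_times_power)
  also have "\<dots> = Sum_any ?g" by (rule Sum_any_shift)
  finally show ?thesis by (simp add: diag_subst_def)
qed

lemma sum_apply: "(\<Sum>i\<in>I. f i) x = (\<Sum>i\<in>I. f i x)"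
  for f :: "'i \<Rightarrow> 'x \<Rightarrow> 'a::comm_monoid_add"
  by (induction I rule: infinite_finite_induct) auto

lemma D_z1_z1_inverse_times:
  "D_z1 (z1_inverse_times F) = z1_inverse_times (D_z1 F) - z1_inverse_times (z1_inverse_times F)"
  by (auto simp: D_z1_def z1_inverse_times_def fun_eq_iff scaleC_add_left scaleC_one)

text \<open>On the diagonal the sum of the two exponents is given. In the first summand \<open>Re \<gamma>\<^sub>1 \<ge> 0\<close> then bounds the exponent
of \<open>z\<^sub>2\<close> from above, and \<open>b(z\<^sub>2)v\<close> bounds it from below. In the second one the exponent of \<open>z\<^sub>1\<close> is bounded by
\<open>Re \<gamma>\<^sub>1 < 0\<close> from above, and by \<open>a(z\<^sub>1)v\<close> from below.\<close>

lemma diag_finite_normal_ordered: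
  assumes a: "a \<in> LFie" and b: "b \<in> LFie"
  shows "diag_finite (comp12 (plus_part a) b v + comp21 b (minus_part a) v)"
proof (rule diag_finite_add)
  note la = LFie_clinear[OF a] and lb = LFie_clinear[OF b]
  show "diag_finite (comp12 (plus_part a) b v)"
  proof (rule diag_finiteI)
    show "finite ((\<lambda>\<gamma>2. \<gamma> - \<gamma>2) ` {\<gamma>2 \<in> exponents (b v). Re \<gamma>2 \<le> Re \<gamma>})" for \<gamma>
      by (intro finite_imageI bounded_below_exponents_Re LFie_exponents b)
    fix \<gamma>1 \<gamma>2 k1 k2
    assume "comp12 (plus_part a) b v \<gamma>1 \<gamma>2 k1 k2 \<noteq> 0"
    then have nz: "Re \<gamma>1 \<ge> 0" "a (b v \<gamma>2 k2) \<gamma>1 k1 \<noteq> 0" by (auto simp: comp12_def plus_part_def split: if_splits)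
    then have "b v \<gamma>2 k2 \<noteq> 0" using clinear_zero[OF la] by auto
    then show "\<gamma>1 \<in> (\<lambda>\<gamma>2'. \<gamma>1 + \<gamma>2 - \<gamma>2') ` {\<gamma>2' \<in> exponents (b v). Re \<gamma>2' \<le> Re (\<gamma>1 + \<gamma>2)}"
      using nz(1) by (intro image_eqI[of _ _ \<gamma>2]) (auto simp: exponents_def)
  qed
  show "diag_finite (comp21 b (minus_part a) v)"
  proof (rule diag_finiteI)
    show "finite {\<gamma>1 \<in> exponents (a v). Re \<gamma>1 \<le> 0}" for \<gamma> :: complex
      by (intro bounded_below_exponents_Re LFie_exponents a)
    fix \<gamma>1 \<gamma>2 k1 k2
    assume "comp21 b (minus_part a) v \<gamma>1 \<gamma>2 k1 k2 \<noteq> 0"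
    then have "minus_part a v \<gamma>1 k1 \<noteq> 0" using clinear_zero[OF lb] by (auto simp: comp21_def)
    then show "\<gamma>1 \<in> {\<gamma>1 \<in> exponents (a v). Re \<gamma>1 \<le> 0}"
      by (auto simp: minus_part_def exponents_def split: if_splits)
  qed
qed

text \<open>The assumptions say that \<open>y(a,z)\<close> is \<open>z\<^sup>-\<^sup>S exp(- \<zeta>M)\<close>, acting on \<open>a\<close>, up to integral powers of \<open>z\<close>. The strip
\<open>-1 < Re \<alpha> \<le> 0\<close> for the eigenvalues of \<open>S\<close> matches the splitting of fields at \<open>Re \<gamma> = 0\<close>: exponents
\<open>l - \<alpha>\<close> with \<open>l\<close> an integer have nonnegative real part exactly if \<open>l \<ge> 0\<close>.\<close>

theorem normal_ordered_expansion:
  fixes y :: "'g::complex_vector \<Rightarrow> 'w::complex_vector lfield"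
  assumes y: "clinear y" and yL: "\<And>a. y a \<in> LFie" and b: "b \<in> LFie" and loc: "\<And>a. local_order N (y a) b"
    and S: "clinear S" and M: "clinear M" and comm: "\<And>a. S (M a) = M (S a)"
    and deriv: "\<And>a v \<gamma> k. of_nat (Suc k) *\<^sub>C y a v \<gamma> (Suc k) = - y (M a) v \<gamma> k"
    and span: "cvec.span A = UNIV"
    and eig: "\<And>a. a \<in> A \<Longrightarrow> \<exists>\<alpha>. - 1 < Re \<alpha> \<and> Re \<alpha> \<le> 0 \<and> S a = \<alpha> *\<^sub>C a \<and> (\<forall>v \<gamma> k. y a v \<gamma> k \<noteq> 0 \<longrightarrow> \<gamma> + \<alpha> \<in> \<int>)"
  shows "normal_ordered (y a) b v \<gamma> k =
    (\<Sum>j\<le>N. (1 / fact j) *\<^sub>C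
      field_prod (int j - 1) (y (falling_factorial_op (\<lambda>a. S a + M a) j a)) b v (\<gamma> + of_nat j) k)"
proof -
  let ?T = "\<lambda>a. S a + M a"
  let ?ff = "falling_factorial_op ?T"
  note lb = LFie_clinear[OF b] and ly = LFie_clinear[OF yL]
  define F where "F a = (z12_times ^^ N) (comp12 (y a) b v)" for a
  define G where "G a = comp12 (plus_part (y a)) b v + comp21 b (minus_part (y a)) v" for a
  define P where "P a = F a - (z12_times ^^ N) (G a)" for a
  define C where "C a = comp12 (minus_part (y a)) b v - comp21 b (minus_part (y a)) v" for a
  define C' where "C' a = comp21 b (plus_part (y a)) v - comp12 (plus_part (y a)) b v" for a
  have zN: "clinear (z12_times ^^ N :: 'w series2 \<Rightarrow> _)" by (rule clinear_funpow[OF clinear_z12_times])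
  have finF: "diag_finite (F a)" for a unfolding F_def by (rule diag_finite_local[OF yL b loc])
  have finG: "diag_finite (G a)" for a unfolding G_def by (rule diag_finite_normal_ordered[OF yL b])
  have finP: "diag_finite (P a)" for a
    unfolding P_def by (intro diag_finite_diff finF diag_finite_z12_power finG)
  \<comment> \<open>\<open>P\<close> comes from the commutator with the negative part of \<open>y a\<close>, and by locality also from minus the
    commutator with the nonnegative part.\<close>
  have PC: "P a = (z12_times ^^ N) (C a)" for a
  proof -
    have "comp12 (y a) b v - G a = C a"
      by (auto simp: C_def G_def comp12_def plus_part_def minus_part_def fun_eq_iff)
    then show ?thesis unfolding P_def F_def by (simp only: clinear_diff[OF zN, symmetric])
  qed
  have PC': "P a = (z12_times ^^ N) (C' a)" for a
  proof -
    have "comp21 b (y a) v - G a = C' a"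
      by (auto simp: C'_def G_def comp21_def plus_part_def minus_part_def fun_eq_iff clinear_zero[OF lb])
    moreover have "F a = (z12_times ^^ N) (comp21 b (y a) v)" using loc[of a] by (simp add: F_def local_order_def)
    ultimately show ?thesis unfolding P_def by (simp only: clinear_diff[OF zN, symmetric])
  qed
  have linC: "clinear C"
    by (auto simp: clinear_iff C_def comp12_def comp21_def minus_part_def fun_eq_iff scaleC_fun_def
        clinear_add[OF y] clinear_scale[OF y] clinear_add[OF lb] clinear_scale[OF lb] clinear_zero[OF lb]
        cvec.scale_right_diff_distrib)
  have linP: "clinear P"
    unfolding clinear_iff PC by (simp only: clinear_add[OF linC] clinear_scale[OF linC] clinear_add[OF zN] clinear_scale[OF zN]) simp
  \<comment> \<open>The dependence on \<open>\<zeta>\<^sub>1\<close> is inherited from \<open>y\<close>.\<close>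
  have derivP: "of_nat (Suc k1) *\<^sub>C P a \<gamma>1 \<gamma>2 (Suc k1) k2 = - P (M a) \<gamma>1 \<gamma>2 k1 k2" for a \<gamma>1 \<gamma>2 k1 k2
  proof -
    define d where "d F = (\<lambda>\<gamma>1 \<gamma>2 k1 k2. of_nat (Suc k1) *\<^sub>C F \<gamma>1 \<gamma>2 (Suc k1) k2)" for F :: "'w series2"
    have dz: "d (z12_times F) = z12_times (d F)" for F
      by (simp add: d_def z12_times_def cvec.scale_right_diff_distrib)
    have dzN: "d ((z12_times ^^ n) F) = (z12_times ^^ n) (d F)" for n F
      by (induction n) (simp_all add: dz)
    have "d (C a) = - C (M a)"
    proof (intro ext)
      fix \<gamma>1 \<gamma>2 k1 k2
      have "of_nat (Suc k1) *\<^sub>C b (y a v \<gamma>1 (Suc k1)) \<gamma>2 k2 = b (of_nat (Suc k1) *\<^sub>C y a v \<gamma>1 (Suc k1)) \<gamma>2 k2"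
        by (simp only: clinear_scale[OF lb] scaleC_fun_def)
      also have "\<dots> = - b (y (M a) v \<gamma>1 k1) \<gamma>2 k2"
        by (simp only: deriv clinear_neg[OF lb] fun_Compl_def)
      finally show "d (C a) \<gamma>1 \<gamma>2 k1 k2 = (- C (M a)) \<gamma>1 \<gamma>2 k1 k2"
        by (simp add: d_def C_def comp12_def comp21_def minus_part_def deriv cvec.scale_right_diff_distrib
            clinear_zero[OF lb] del: of_nat_Suc)
    qed
    then have "d (P a) = - P (M a)" unfolding PC dzN by (simp only: clinear_neg[OF zN])
    then have "d (P a) \<gamma>1 \<gamma>2 k1 k2 = (- P (M a)) \<gamma>1 \<gamma>2 k1 k2" by simp
    then show ?thesis by (simp add: d_def del: of_nat_Suc)
  qed
  \<comment> \<open>Up to the factor \<open>z\<^sub>1\<close> to the power \<open>- \<alpha>\<close>, the series \<open>P\<^sub>a\<close> is a polynomial in \<open>z\<^sub>1\<close> of degree less than \<open>N\<close>.\<close>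
  have expP: "\<exists>l<N. \<gamma>1 = of_nat l - \<alpha>"
    if \<alpha>: "- 1 < Re \<alpha>" "Re \<alpha> \<le> 0" "\<And>v \<gamma> k. y a v \<gamma> k \<noteq> 0 \<Longrightarrow> \<gamma> + \<alpha> \<in> \<int>" and nz: "P a \<gamma>1 \<gamma>2 k1 k2 \<noteq> 0" for a \<alpha> \<gamma>1 \<gamma>2 k1 k2
  proof -
    have C: "Re \<gamma> < 0 \<and> \<gamma> + \<alpha> \<in> \<int>" if "\<gamma> \<in> exponents1 (C a)" for \<gamma>
    proof -
      obtain \<gamma>2 k1 k2 where "C a \<gamma> \<gamma>2 k1 k2 \<noteq> 0" using \<open>\<gamma> \<in> exponents1 (C a)\<close> by (auto simp: exponents1_def)
      then have "minus_part (y a) (b v \<gamma>2 k2) \<gamma> k1 \<noteq> 0 \<or> minus_part (y a) v \<gamma> k1 \<noteq> 0"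
        by (auto simp: C_def comp12_def comp21_def clinear_zero[OF lb])
      then show ?thesis using \<alpha>(3) by (auto simp: minus_part_def split: if_splits)
    qed
    have in1: "\<gamma>1 \<in> exponents1 (P a)" using nz by (auto simp: exponents1_def)
    have "exponents1 (P a) \<subseteq> {\<gamma>. Re \<gamma> < 0 + real N}"
      unfolding PC by (rule exponents1_z12_power_less) (use C in auto)
    moreover have "exponents1 (P a) \<subseteq> {\<gamma>. \<gamma> + \<alpha> \<in> \<int>}"
      unfolding PC
    proof (rule exponents1_z12_power_closed)
      fix \<gamma> assume "\<gamma> \<in> {\<gamma>. \<gamma> + \<alpha> \<in> \<int>}"
      then have "(\<gamma> + \<alpha>) + 1 \<in> \<int>" by simp
      then show "\<gamma> + 1 \<in> {\<gamma>. \<gamma> + \<alpha> \<in> \<int>}" by (simp add: algebra_simps)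
    qed (use C in auto)
    ultimately have 1: "Re \<gamma>1 < real N" "\<gamma>1 + \<alpha> \<in> \<int>" using in1 by auto
    have "exponents1 (C' a) \<subseteq> {\<gamma>. Re \<gamma> \<ge> 0}"
      by (auto simp: exponents1_def C'_def comp12_def comp21_def plus_part_def clinear_zero[OF lb] split: if_splits)
    then have "exponents1 (P a) \<subseteq> {\<gamma>. Re \<gamma> \<ge> 0}"
      unfolding PC' by (rule exponents1_z12_power_closed) auto
    then have 2: "Re \<gamma>1 \<ge> 0" using in1 by auto
    obtain l where l: "\<gamma>1 + \<alpha> = of_int l" using 1(2) by (auto elim: Ints_cases)
    have "Re \<gamma>1 + Re \<alpha> = real_of_int l" using arg_cong[OF l, of Re] by simp
    then have "0 \<le> l" "l < int N" using 1(1) 2 \<alpha>(1,2) by auto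
    then show ?thesis using l by (intro exI[of _ "nat l"]) (auto simp: algebra_simps)
  qed
  \<comment> \<open>The Leibniz formula is applied in the space of all families \<open>Q\<close> of series indexed by vectors \<open>a\<close>,
    on which \<open>T\<close> acts through the index.\<close>
  define D where "D Q = (\<lambda>a. D_z1 (Q a))" for Q :: "'g \<Rightarrow> 'w series2"
  define Z where "Z Q = (\<lambda>a. z1_inverse_times (Q a))" for Q :: "'g \<Rightarrow> 'w series2"
  define T where "T Q = (\<lambda>a. Q (?T a))" for Q :: "'g \<Rightarrow> 'w series2"
  have linD: "clinear D" and linZ: "clinear Z" and linT: "clinear T"
    by (auto simp: clinear_iff D_def Z_def T_def fun_eq_iff scaleC_fun_def D_z1_def z1_inverse_times_def
        scaleC_add_right scaleC_scaleC mult.commute)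
  define E where "E n = ((\<lambda>Q. D Q + Z (T Q)) ^^ n) P" for n
  have E0: "E 0 = P" and ES: "E (Suc n) = D (E n) + Z (T (E n))" for n by (simp_all add: E_def)
  \<comment> \<open>The part \<open>M\<close> of \<open>T\<close> compensates \<open>\<partial>\<^sub>\<zeta>\<close> in \<open>D\<close>, so that on an eigenvector \<open>D + z\<^sub>1\<^sup>-\<^sup>1 T\<close> lowers the exponent \<open>l - \<alpha>\<close>
    by one and multiplies by \<open>l\<close>. Its \<open>N\<close>-th power is zero because \<open>0 \<le> l < N\<close>.\<close>
  have E: "clinear (E n) \<and>
    (\<forall>a \<gamma>1 \<gamma>2 k1 k2. of_nat (Suc k1) *\<^sub>C E n a \<gamma>1 \<gamma>2 (Suc k1) k2 = - E n (M a) \<gamma>1 \<gamma>2 k1 k2) \<and>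
    (\<forall>a \<alpha> \<gamma>1 \<gamma>2 k1 k2. S a = \<alpha> *\<^sub>C a \<longrightarrow>
      E n a \<gamma>1 \<gamma>2 k1 k2 = (\<Prod>i<n. \<gamma>1 + 1 + of_nat i + \<alpha>) *\<^sub>C P a (\<gamma>1 + of_nat n) \<gamma>2 k1 k2)" for n
  proof (induction n)
    case 0
    then show ?case using linP derivP by (simp add: E0 scaleC_one del: of_nat_Suc)
  next
    case (Suc n)
    then have linE: "clinear (E n)" 
      and derE: "\<And>a \<gamma>1 \<gamma>2 k1 k2. of_nat (Suc k1) *\<^sub>C E n a \<gamma>1 \<gamma>2 (Suc k1) k2 = - E n (M a) \<gamma>1 \<gamma>2 k1 k2"
      and eigE: "\<And>a \<alpha> \<gamma>1 \<gamma>2 k1 k2. S a = \<alpha> *\<^sub>C a \<Longrightarrow>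
        E n a \<gamma>1 \<gamma>2 k1 k2 = (\<Prod>i<n. \<gamma>1 + 1 + of_nat i + \<alpha>) *\<^sub>C P a (\<gamma>1 + of_nat n) \<gamma>2 k1 k2"
      by blast+
    have linE': "E n (a + a') \<gamma>1 \<gamma>2 k1 k2 = E n a \<gamma>1 \<gamma>2 k1 k2 + E n a' \<gamma>1 \<gamma>2 k1 k2"
       "E n (c *\<^sub>C a) \<gamma>1 \<gamma>2 k1 k2 = c *\<^sub>C E n a \<gamma>1 \<gamma>2 k1 k2" for a a' c \<gamma>1 \<gamma>2 k1 k2
      by (simp_all add: clinear_add[OF linE] clinear_scale[OF linE] scaleC_fun_def)
    have rec: "E (Suc n) a \<gamma>1 \<gamma>2 k1 k2 = (\<gamma>1 + 1) *\<^sub>C E n a (\<gamma>1 + 1) \<gamma>2 k1 k2 + E n (S a) (\<gamma>1 + 1) \<gamma>2 k1 k2"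
      for a \<gamma>1 \<gamma>2 k1 k2
      using derE[of k1 a "\<gamma>1 + 1" \<gamma>2 k2]
      by (simp add: ES D_def Z_def T_def D_z1_def z1_inverse_times_def linE' del: of_nat_Suc)
    have "clinear (E (Suc n))"
      unfolding clinear_iff fun_eq_iff
      by (simp add: rec linE' scaleC_fun_def clinear_add[OF S] clinear_scale[OF S] scaleC_add_right scaleC_scaleC mult.commute)
    moreover have "of_nat (Suc k1) *\<^sub>C E (Suc n) a \<gamma>1 \<gamma>2 (Suc k1) k2 = - E (Suc n) (M a) \<gamma>1 \<gamma>2 k1 k2" for a \<gamma>1 \<gamma>2 k1 k2
    proof -
      have "of_nat (Suc k1) *\<^sub>C (\<gamma>1 + 1) *\<^sub>C E n a (\<gamma>1 + 1) \<gamma>2 (Suc k1) k2 = (\<gamma>1 + 1) *\<^sub>C (- E n (M a) (\<gamma>1 + 1) \<gamma>2 k1 k2)"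
        by (simp only: derE[symmetric] scaleC_scaleC mult.commute)
      then show ?thesis by (simp add: rec scaleC_add_right derE comm del: of_nat_Suc)
    qed
    moreover have "E (Suc n) a \<gamma>1 \<gamma>2 k1 k2 = (\<Prod>i<Suc n. \<gamma>1 + 1 + of_nat i + \<alpha>) *\<^sub>C P a (\<gamma>1 + of_nat (Suc n)) \<gamma>2 k1 k2"
      if a: "S a = \<alpha> *\<^sub>C a" for a \<alpha> \<gamma>1 \<gamma>2 k1 k2
    proof -
      have "E (Suc n) a \<gamma>1 \<gamma>2 k1 k2 = (\<gamma>1 + 1 + \<alpha>) *\<^sub>C E n a (\<gamma>1 + 1) \<gamma>2 k1 k2"
        by (simp only: rec a linE' scaleC_add_left)
      also have "\<dots> = ((\<gamma>1 + 1 + \<alpha>) * (\<Prod>i<n. \<gamma>1 + 1 + 1 + of_nat i + \<alpha>)) *\<^sub>C P a (\<gamma>1 + 1 + of_nat n) \<gamma>2 k1 k2"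
        by (simp only: eigE[OF a] scaleC_scaleC)
      also have "(\<gamma>1 + 1 + \<alpha>) * (\<Prod>i<n. \<gamma>1 + 1 + 1 + of_nat i + \<alpha>) = (\<Prod>i<Suc n. \<gamma>1 + 1 + of_nat i + \<alpha>)"
        by (subst prod.lessThan_Suc_shift) (simp add: add.assoc)
      finally show ?thesis by (simp add: add.assoc)
    qed
    ultimately show ?case by blast
  qed
  have "E N a = 0" for a
  proof -
    have linE: "clinear (E N)" using E by blast
    have "a \<in> cvec.span A" using span by simp
    then show ?thesis
    proof (induction rule: cvec.span_induct)
      show "cvec.subspace {a. E N a = 0}"
        by (rule cvec.subspaceI) (simp_all only: mem_Collect_eq clinear_zero[OF linE] clinear_add[OF linE] clinear_scale[OF linE] add_0 cvec.scale_zero_right)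
    next
      fix a assume "a \<in> A"
      then obtain \<alpha> where \<alpha>: "- 1 < Re \<alpha>" "Re \<alpha> \<le> 0" "S a = \<alpha> *\<^sub>C a" "\<And>v \<gamma> k. y a v \<gamma> k \<noteq> 0 \<Longrightarrow> \<gamma> + \<alpha> \<in> \<int>"
        using eig by blast
      show "E N a = 0"
      proof (intro ext)
        fix \<gamma>1 \<gamma>2 k1 k2
        have EN: "E N a \<gamma>1 \<gamma>2 k1 k2 = (\<Prod>i<N. \<gamma>1 + 1 + of_nat i + \<alpha>) *\<^sub>C P a (\<gamma>1 + of_nat N) \<gamma>2 k1 k2"
          using E \<alpha>(3) by blast
        show "E N a \<gamma>1 \<gamma>2 k1 k2 = 0 \<gamma>1 \<gamma>2 k1 k2"
        proof (cases "P a (\<gamma>1 + of_nat N) \<gamma>2 k1 k2 = 0")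
          case False
          then have "\<exists>l<N. \<gamma>1 + of_nat N = of_nat l - \<alpha>" by (rule expP[OF \<alpha>(1,2,4), rotated])
          then obtain l where l: "l < N" "\<gamma>1 + of_nat N = of_nat l - \<alpha>" by blast
          then have "\<gamma>1 = of_nat l - \<alpha> - of_nat N" by (simp add: algebra_simps)
          then have "\<gamma>1 + 1 + of_nat (N - 1 - l) + \<alpha> = 0" using l(1) by (simp add: of_nat_diff)
          then have "(\<Prod>i<N. \<gamma>1 + 1 + of_nat i + \<alpha>) = 0"
            using l(1) by (intro prod_zero) (auto intro!: bexI[of _ "N - 1 - l"])
          then show ?thesis using EN by simp
        qed (simp add: EN)
      qed
    qed
  qed
  moreover have "E N a = (\<Sum>j\<le>N. of_nat (N choose j) *\<^sub>C (z1_inverse_times ^^ j) ((D_z1 ^^ (N - j)) (P (?ff j a))))" for a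
  proof -
    have linT': "clinear ?T" using S M by (simp add: clinear_iff scaleC_add_right)
    have Zp: "(Z ^^ j) Q = (\<lambda>a. (z1_inverse_times ^^ j) (Q a))" for j Q by (induction j) (simp_all add: Z_def)
    have Dp: "(D ^^ j) Q = (\<lambda>a. (D_z1 ^^ j) (Q a))" for j Q by (induction j) (simp_all add: D_def)
    have ffT: "falling_factorial_op T j Q = (\<lambda>a. Q (?ff j a))" if "clinear Q" for j Q
    proof (induction j)
      case (Suc j)
      have ff: "?ff j (?T a) = ?T (?ff j a)" for a
        by (rule falling_factorial_op_commute[symmetric]) (rule refl, rule linT')
      have "falling_factorial_op T (Suc j) Q = T (\<lambda>a. Q (?ff j a)) - of_nat j *\<^sub>C (\<lambda>a. Q (?ff j a))"
        by (simp only: falling_factorial_op.simps Suc)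
      also have "\<dots> = (\<lambda>a. Q (?ff (Suc j) a))"
      proof
        fix a
        have "(T (\<lambda>a. Q (?ff j a)) - of_nat j *\<^sub>C (\<lambda>a. Q (?ff j a))) a = Q (?ff j (?T a)) - of_nat j *\<^sub>C Q (?ff j a)"
          by (simp add: T_def scaleC_fun_def fun_diff_def)
        also have "\<dots> = Q (?ff (Suc j) a)"
          unfolding ff by (simp only: falling_factorial_op.simps clinear_diff[OF that] clinear_scale[OF that])
        finally show "(T (\<lambda>a. Q (?ff j a)) - of_nat j *\<^sub>C (\<lambda>a. Q (?ff j a))) a = Q (?ff (Suc j) a)" .
      qed
      finally show ?case .
    qed simp
    have linDP: "clinear ((D ^^ j) P)" for j
      unfolding clinear_iff Dp
      by (simp only: clinear_add[OF linP] clinear_scale[OF linP] clinear_add[OF clinear_funpow[OF clinear_D_z1]]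
          clinear_scale[OF clinear_funpow[OF clinear_D_z1]]) (auto simp: fun_eq_iff scaleC_fun_def)
    have "E N = (\<Sum>j\<le>N. of_nat (N choose j) *\<^sub>C (Z ^^ j) (falling_factorial_op T j ((D ^^ (N - j)) P)))"
      unfolding E_def
      by (rule twisted_leibniz[OF linD linZ linT])
        (simp_all only: D_def Z_def T_def D_z1_z1_inverse_times fun_diff_def)
    then show ?thesis by (simp only: ffT[OF linDP] sum_apply) (simp only: Zp Dp scaleC_fun_def[of _ "_ :: 'g \<Rightarrow> _"])
  qed
  ultimately have "(\<Sum>j\<le>N. of_nat (N choose j) *\<^sub>C (z1_inverse_times ^^ j) ((D_z1 ^^ (N - j)) (P (?ff j a)))) = 0"
    by metis
  then have "0 = diag_subst (\<Sum>j\<le>N. of_nat (N choose j) *\<^sub>C (z1_inverse_times ^^ j) ((D_z1 ^^ (N - j)) (P (?ff j a)))) \<gamma> k"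
    by (simp only:) (simp add: diag_subst_def)
  also have "\<dots> = (\<Sum>j\<le>N. of_nat (N choose j) *\<^sub>C diag_subst ((D_z1 ^^ (N - j)) (P (?ff j a))) (\<gamma> + of_nat j) k)"
  proof -
    have fin: "diag_finite ((z1_inverse_times ^^ j) ((D_z1 ^^ (N - j)) (P (?ff j a))))" for j
      by (intro diag_finite_z1_inverse_times_power diag_finite_D_z1_power finP)
    show ?thesis
      by (simp only: diag_subst_sum[OF diag_finite_scale[OF fin], THEN conjunct2] diag_subst_scale[OF fin] sum_apply)
        (simp only: scaleC_fun_def diag_subst_z1_inverse_times_power)
  qed
  also have "\<dots> = (\<Sum>j\<le>N. fact N *\<^sub>C ((1 / fact j) *\<^sub>C field_prod (int j - 1) (y (?ff j a)) b v (\<gamma> + of_nat j) k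
      - (if j = 0 then normal_ordered (y a) b v \<gamma> k else 0)))"
  proof (rule sum.cong[OF refl])
    fix j assume "j \<in> {..N}"
    then have j: "j \<le> N" by simp
    let ?c = "?ff j a"
    have fp: "field_prod (int j - 1) (y ?c) b v = (1 / fact (N - j)) *\<^sub>C diag_subst ((D_z1 ^^ (N - j)) (F ?c))"
      unfolding F_def by (rule field_prod_eq[OF yL b loc]) (use j in simp)
    have "diag_subst ((D_z1 ^^ (N - j)) (P ?c)) =
        diag_subst ((D_z1 ^^ (N - j)) (F ?c)) - diag_subst ((D_z1 ^^ (N - j)) ((z12_times ^^ N) (G ?c)))"
      unfolding P_def clinear_diff[OF clinear_funpow[OF clinear_D_z1]]
      by (intro diag_subst_diff diag_finite_D_z1_power diag_finite_z12_power finF finG)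
    moreover have "normal_ordered (y a) b v = diag_subst (G a)" by (simp add: normal_ordered_def G_def)
    ultimately have "diag_subst ((D_z1 ^^ (N - j)) (P ?c)) (\<gamma> + of_nat j) k =
      fact (N - j) *\<^sub>C field_prod (int j - 1) (y ?c) b v (\<gamma> + of_nat j) k
        - (if j = 0 then fact N *\<^sub>C normal_ordered (y a) b v \<gamma> k else 0)"
      using j by (simp add: fp scaleC_fun_def scaleC_scaleC diag_subst_D_z1_z12[OF finG])
    moreover have "of_nat (N choose j) * fact (N - j) = (fact N / fact j :: complex)"
      using j by (simp add: binomial_fact)
    ultimately show "of_nat (N choose j) *\<^sub>C diag_subst ((D_z1 ^^ (N - j)) (P ?c)) (\<gamma> + of_nat j) k =
      fact N *\<^sub>C ((1 / fact j) *\<^sub>C field_prod (int j - 1) (y ?c) b v (\<gamma> + of_nat j) k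
      - (if j = 0 then normal_ordered (y a) b v \<gamma> k else 0))"
      by (simp add: cvec.scale_right_diff_distrib scaleC_scaleC)
  qed
  also have "\<dots> = fact N *\<^sub>C ((\<Sum>j\<le>N. (1 / fact j) *\<^sub>C field_prod (int j - 1) (y (?ff j a)) b v (\<gamma> + of_nat j) k)
      - normal_ordered (y a) b v \<gamma> k)"
    by (simp add: cvec.scale_sum_right[symmetric] sum_subtractf)
  finally show ?thesis by simp
qed

section \<open>Products of generators in the affine vertex algebra\<close>

lemma words_apply_superset:
  assumes "finite K" "Poly_Mapping.keys p \<subseteq> K"
  shows "words_apply \<rho> v p = (\<Sum>w\<in>K. Poly_Mapping.lookup p w *\<^sub>C foldr \<rho> w v)"
  unfolding words_apply_def using assms by (intro sum.mono_neutral_left) (auto simp: in_keys_iff)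

lemma induced_module_character:
  assumes M: "induced_module br S \<chi> \<rho> v" and x: "x \<in> S"
  shows "\<rho> x v = \<chi> x *\<^sub>C v"
proof -
  define p where "p = Poly_Mapping.single [x] 1 - Poly_Mapping.single [] (\<chi> x)"
  have "Poly_Mapping.single ([] @ [x]) 1 - Poly_Mapping.single [] (\<chi> x) \<in> induced_relations br S \<chi>"
    using x unfolding induced_relations_def by blast
  then have "p \<in> cvec.span (induced_relations br S \<chi>)" by (simp add: p_def cvec.span_base)
  then have "words_apply \<rho> v p = 0" using M unfolding induced_module_def by blast
  moreover have "words_apply \<rho> v p = (\<Sum>w\<in>{[x], []}. Poly_Mapping.lookup p w *\<^sub>C foldr \<rho> w v)"
    by (rule words_apply_superset) (auto simp: p_def in_keys_iff lookup_minus lookup_single when_def split: if_splits)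
  ultimately show ?thesis by (simp add: p_def lookup_minus lookup_single scaleC_one)
qed

lemma affine_bracket_loop:
  assumes br: "cbilinear br" and B: "cbilinear B"
  shows "affine_bracket br B (loop a m) (loop b n) =
    (Poly_Mapping.single (m + n) (br a b), if m + n = 0 then of_int m * B a b else 0)"
proof (cases "a = 0 \<or> b = 0")
  case True
  then show ?thesis
    using clinear_zero[OF cbilinear_right[OF br]] clinear_zero[OF cbilinear_left[OF br]]
      clinear_zero[OF cbilinear_right[OF B]] clinear_zero[OF cbilinear_left[OF B]]
    by (auto simp: affine_bracket_def loop_def prod_eq_iff)
next
  case False
  then show ?thesis
    using clinear_zero[OF cbilinear_right[OF B]]
    by (auto simp: affine_bracket_def loop_def prod_eq_iff lookup_single when_def)
qed

text \<open>For \<open>m \<ge> 0\<close> the mode \<open>at\<^sup>m\<close> annihilates the vacuum, so it acts on \<open>(bt\<^sup>-\<^sup>1)\<one>\<close> by its bracket with \<open>bt\<^sup>-\<^sup>1\<close>.\<close>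

lemma
  assumes U: "universal_affine_va br B \<kappa> vac pr \<rho>" and br: "cbilinear br" and B: "cbilinear B"
  shows clinear_affine_embed: "clinear (affine_embed vac \<rho>)"
    and affine_product_0: "pr 0 (affine_embed vac \<rho> a) (affine_embed vac \<rho> b) = affine_embed vac \<rho> (br a b)"
    and affine_product_1: "pr 1 (affine_embed vac \<rho> a) (affine_embed vac \<rho> b) = (\<kappa> * B a b) *\<^sub>C vac"
    and affine_product_ge_2: "m \<ge> 2 \<Longrightarrow> pr m (affine_embed vac \<rho> a) (affine_embed vac \<rho> b) = 0"
proof -
  let ?\<iota> = "affine_embed vac \<rho>"
  have I: "induced_module (affine_bracket br B) affine_plus (\<lambda>x. \<kappa> * snd x) \<rho> vac"
    and modes: "\<And>a m v. pr m (?\<iota> a) v = \<rho> (loop a m) v"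
    using U by (auto simp: universal_affine_va_def affine_embed_def)
  have \<rho>: "cbilinear \<rho>" and mod: "\<And>x y v. \<rho> (affine_bracket br B x y) v = \<rho> x (\<rho> y v) - \<rho> y (\<rho> x v)"
    using I by (auto simp: induced_module_def lie_module_def)
  have "loop (a + b) m = loop a m + loop b m" "loop (c *\<^sub>C a) m = c *\<^sub>C loop a m" for a b :: 'a and m c
    by (auto simp: loop_def single_add scaleC_prod_def intro!: poly_mapping_eqI simp: lookup_scaleC lookup_single when_def scaleC_complex_def)
  then show "clinear ?\<iota>"
    by (simp add: clinear_iff affine_embed_def clinear_add[OF cbilinear_left[OF \<rho>]] clinear_scale[OF cbilinear_left[OF \<rho>]])
  have plus: "\<rho> x vac = (\<kappa> * snd x) *\<^sub>C vac" if "x \<in> affine_plus" for x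
    using induced_module_character[OF I that] .
  have prod: "pr m (?\<iota> a) (?\<iota> b) = \<rho> (Poly_Mapping.single (m - 1) (br a b), if m = 1 then B a b else 0) vac"
    if "m \<ge> 0" for a b m
  proof -
    have "\<rho> (loop a m) vac = 0"
      using plus[of "loop a m"] that by (auto simp: affine_plus_def loop_def)
    then have "\<rho> (loop a m) (\<rho> (loop b (-1)) vac) = \<rho> (affine_bracket br B (loop a m) (loop b (-1))) vac"
      by (simp add: mod clinear_zero[OF cbilinear_right[OF \<rho>]])
    then show ?thesis
      using modes[of m a "?\<iota> b"] by (auto simp: affine_embed_def affine_bracket_loop[OF br B])
  qed
  show "pr 0 (?\<iota> a) (?\<iota> b) = ?\<iota> (br a b)"
    using prod[where m = 0 and a = a and b = b] by (simp add: affine_embed_def loop_def)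
  have "\<rho> (Poly_Mapping.single 0 (br a b), B a b) vac = (\<kappa> * B a b) *\<^sub>C vac"
    by (subst plus) (auto simp: affine_plus_def)
  then show "pr 1 (?\<iota> a) (?\<iota> b) = (\<kappa> * B a b) *\<^sub>C vac"
    using prod[where m = 1 and a = a and b = b] by simp
  show "pr m (?\<iota> a) (?\<iota> b) = 0" if "m \<ge> 2"
  proof -
    have "\<rho> (Poly_Mapping.single (m - 1) (br a b), 0) vac = 0"
      by (subst plus) (use that in \<open>auto simp: affine_plus_def\<close>)
    then show ?thesis using prod[where m = m and a = a and b = b] that by simp
  qed
qed

section \<open>Traces and invariant tensors\<close>

text \<open>Bases of the ranges of \<open>f\<^sup>n\<close>, \<open>f\<^sup>n\<^sup>-\<^sup>1\<close>, \<dots>, \<open>f\<^sup>0\<close> are chosen, each extending the one before. Then \<open>f\<close> maps a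
new basis vector into the span of the preceding ones.\<close>

lemma nilpotent_adapted_basis:
  fixes f :: "'a::complex_vector \<Rightarrow> 'a"
  assumes f: "clinear f" and nil: "\<And>x. (f ^^ n) x = 0"
  shows "\<exists>E. cvec.independent E \<and> cvec.span E = UNIV \<and> (\<forall>e\<in>E. cvec.representation E (f e) e = 0)"
proof -
  have sub: "cvec.subspace (range (f ^^ k))" for k
    by (rule cvec.subspaceI)
      (auto simp: clinear_zero[OF clinear_funpow[OF f]] clinear_add[OF clinear_funpow[OF f], symmetric]
        clinear_scale[OF clinear_funpow[OF f], symmetric] intro: range_eqI[of _ _ 0])
  have "\<exists>E. cvec.independent E \<and> cvec.span E = range (f ^^ (n - k)) \<and> (\<forall>e\<in>E. cvec.representation E (f e) e = 0)" for k
  proof (induction k)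
    case 0
    have "range (f ^^ n) = {0}" using nil by auto
    then show ?case by (intro exI[of _ "{}"]) (simp add: cvec.independent_empty)
  next
    case (Suc k)
    show ?case
    proof (cases "k < n")
      case False then show ?thesis using Suc by simp
    next
      case True
      let ?U = "range (f ^^ (n - k))" and ?V = "range (f ^^ (n - Suc k))"
      obtain E where E: "cvec.independent E" "cvec.span E = ?U" "\<forall>e\<in>E. cvec.representation E (f e) e = 0"
        using Suc by blast
      have pw: "f ^^ (n - k) = f ^^ (n - Suc k) \<circ> f"
        using True by (metis Suc_diff_Suc funpow_Suc_right)
      have "?U \<subseteq> ?V" unfolding pw by auto
      then have "E \<subseteq> ?V" using E(2) cvec.span_superset by blast
      then obtain F where F: "E \<subseteq> F" "F \<subseteq> ?V" "cvec.independent F" "?V \<subseteq> cvec.span F"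
        using cvec.maximal_independent_subset_extend[OF _ E(1)] by blast
      have spF: "cvec.span F = ?V" using F sub by (simp add: cvec.span_minimal subset_antisym)
      have "cvec.representation F (f e) e = 0" if e: "e \<in> F" for e
      proof -
        obtain x where "e = (f ^^ (n - Suc k)) x" using e F(2) by auto
        then have "f e = (f ^^ (n - k)) x" by (simp add: pw funpow_swap1)
        then have fe: "f e \<in> cvec.span E" using E(2) by simp
        have "cvec.representation F (f e) e = cvec.representation E (f e) e"
          by (simp add: cvec.representation_extend[OF F(3) fe F(1)])
        moreover have "cvec.representation E (f e) e = 0"
          using E(3) cvec.representation_ne_zero by blast
        ultimately show ?thesis by simp
      qed
      then show ?thesis using F(3) spF by blast
    qed
  qed
  from this[of n] show ?thesis by simp
qed

lemma fin_dim_nilpotent: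
  assumes fd: "fin_dim TYPE('a::complex_vector)" and f: "locally_nilpotent (f :: 'a \<Rightarrow> 'a)"
  shows "\<exists>n. \<forall>x. (f ^^ n) x = 0"
proof -
  note lin = f[unfolded locally_nilpotent_def, THEN conjunct1]
  obtain T :: "'a set" where T: "finite T" "cvec.span T = UNIV" using fd by (auto simp: fin_dim_def)
  obtain d where d: "\<And>x. (f ^^ d x) x = 0" using f unfolding locally_nilpotent_def by metis
  define n where "n = (\<Sum>t\<in>T. d t)"
  have "(f ^^ n) x = 0" for x
  proof -
    have "x \<in> cvec.span T" using T by simp
    then show ?thesis
    proof (induction rule: cvec.span_induct)
      show "cvec.subspace {x. (f ^^ n) x = 0}"
        by (rule cvec.subspaceI)
          (simp_all add: clinear_zero[OF clinear_funpow[OF lin]] clinear_add[OF clinear_funpow[OF lin]] clinear_scale[OF clinear_funpow[OF lin]])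
      show "(f ^^ n) t = 0" if "t \<in> T" for t
        by (rule funpow_zero_mono[OF lin d[of t]]) (use T(1) that in \<open>simp add: n_def member_le_sum\<close>)
    qed
  qed
  then show ?thesis by blast
qed

lemma dual_bases_expansion:
  fixes x :: "'g::complex_vector" and v w :: "nat \<Rightarrow> 'g"
  assumes B: "cbilinear B" and db: "dual_bases B v w"
  shows "x = (\<Sum>i=1..cvec.dim (UNIV :: 'g set). B (v i) x *\<^sub>C w i)"
proof -
  let ?I = "{1..cvec.dim (UNIV :: 'g set)}"
  have span: "cvec.span (w ` ?I) = UNIV" and orth: "\<And>i j. i \<in> ?I \<Longrightarrow> j \<in> ?I \<Longrightarrow> B (v i) (w j) = (if i = j then 1 else 0)"
    using db by (auto simp: dual_bases_def is_basis_family_def Let_def)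
  note l = cbilinear_right[OF B]
  have "x \<in> cvec.span (w ` ?I)" using span by simp
  then show ?thesis
  proof (induction rule: cvec.span_induct)
    have "(\<Sum>i\<in>?I. B (v i) (c *\<^sub>C x) *\<^sub>C w i) = c *\<^sub>C (\<Sum>i\<in>?I. B (v i) x *\<^sub>C w i)" for c x
      by (simp add: clinear_scale[OF l] scaleC_complex_def cvec.scale_sum_right scaleC_scaleC)
    then show "cvec.subspace {x. x = (\<Sum>i\<in>?I. B (v i) x *\<^sub>C w i)}"
      by (intro cvec.subspaceI) (simp_all add: clinear_zero[OF l] clinear_add[OF l] scaleC_add_left sum.distrib)
    show "x = (\<Sum>i\<in>?I. B (v i) x *\<^sub>C w i)" if x: "x \<in> w ` ?I" for x
    proof -
      obtain j where j: "j \<in> ?I" "x = w j" using x by blast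
      have "(\<Sum>i\<in>?I. B (v i) x *\<^sub>C w i) = (\<Sum>i\<in>?I. if i = j then w i else 0)"
        unfolding j(2)
      proof (rule sum.cong[OF refl])
        fix i assume "i \<in> ?I"
        then have "B (v i) (w j) = (if i = j then 1 else 0)" using j(1) by (rule orth)
        then show "B (v i) (w j) *\<^sub>C w i = (if i = j then w i else 0)" by (simp add: scaleC_one)
      qed
      then show ?thesis using j by simp
    qed
  qed
qed

lemma dual_bases_trace:
  fixes v w :: "nat \<Rightarrow> 'g::complex_vector"
  assumes fd: "fin_dim TYPE('g)" and B: "cbilinear B" and db: "dual_bases B v w" and f: "clinear f"
    and E: "cvec.independent E" "cvec.span E = UNIV"
  shows "(\<Sum>i=1..cvec.dim (UNIV :: 'g set). B (v i) (f (w i))) = (\<Sum>e\<in>E. cvec.representation E (f e) e)"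
proof -
  let ?I = "{1..cvec.dim (UNIV :: 'g set)}"
  let ?r = "cvec.representation E"
  obtain T :: "'g set" where T: "finite T" "cvec.span T = UNIV" using fd by (auto simp: fin_dim_def)
  have finE: "finite E" using cvec.independent_span_bound[OF T(1) E(1)] T(2) by simp
  have rep: "(\<Sum>e\<in>E. ?r x e *\<^sub>C e) = x" for x by (rule cvec.sum_representation_eq) (use E finE in auto)
  have lr: "clinear (\<lambda>x. ?r x e)" for e
    using E by (auto simp: clinear_iff cvec.representation_add cvec.representation_scale scaleC_complex_def)
  note l = cbilinear_right[OF B]
  have "(\<Sum>i\<in>?I. B (v i) (f (w i))) = (\<Sum>i\<in>?I. \<Sum>e\<in>E. ?r (w i) e * B (v i) (f e))"
  proof (rule sum.cong[OF refl])
    fix i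
    have "B (v i) (f (w i)) = B (v i) (f (\<Sum>e\<in>E. ?r (w i) e *\<^sub>C e))" by (simp add: rep)
    also have "\<dots> = (\<Sum>e\<in>E. ?r (w i) e * B (v i) (f e))"
      by (simp only: clinear_sum[OF f] clinear_sum[OF l] clinear_scale[OF f] clinear_scale[OF l] scaleC_complex_def)
    finally show "B (v i) (f (w i)) = (\<Sum>e\<in>E. ?r (w i) e * B (v i) (f e))" .
  qed
  also have "\<dots> = (\<Sum>e\<in>E. \<Sum>i\<in>?I. ?r (w i) e * B (v i) (f e))" by (rule sum.swap)
  also have "\<dots> = (\<Sum>e\<in>E. ?r (\<Sum>i\<in>?I. B (v i) (f e) *\<^sub>C w i) e)"
    by (simp only: clinear_sum[OF lr] clinear_scale[OF lr] scaleC_complex_def mult.commute)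
  also have "\<dots> = (\<Sum>e\<in>E. ?r (f e) e)" by (simp only: dual_bases_expansion[OF B db, symmetric])
  finally show ?thesis .
qed

lemma op_trace_eq:
  fixes v w :: "nat \<Rightarrow> 'g::complex_vector"
  assumes fd: "fin_dim TYPE('g)" and B: "cbilinear B" and db: "dual_bases B v w" and f: "clinear f"
  shows "op_trace f = (\<Sum>i=1..cvec.dim (UNIV :: 'g set). B (v i) (f (w i)))"
proof -
  obtain E0 :: "'g set" where "cvec.independent E0" "cvec.span E0 = UNIV"
    by (rule cvec.maximal_independent_subset[of UNIV]) (auto simp: top.extremum_unique)
  then have ex: "\<exists>E. cvec.independent E \<and> cvec.span E = (UNIV :: 'g set)" by blast
  define E where "E = (SOME E. cvec.independent E \<and> cvec.span E = (UNIV :: 'g set))"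
  have "cvec.independent E \<and> cvec.span E = UNIV" unfolding E_def by (rule someI_ex[OF ex])
  moreover have "op_trace f = (\<Sum>e\<in>E. cvec.representation E (f e) e)"
    by (simp add: op_trace_def Let_def E_def)
  ultimately show ?thesis using dual_bases_trace[OF fd B db f, of E] by simp
qed

lemma dual_bases_trace_nilpotent:
  fixes v w :: "nat \<Rightarrow> 'g::complex_vector"
  assumes fd: "fin_dim TYPE('g)" and B: "cbilinear B" and db: "dual_bases B v w" and f: "locally_nilpotent f"
  shows "(\<Sum>i=1..cvec.dim (UNIV :: 'g set). B (v i) (f (w i))) = 0"
proof -
  have lin: "clinear f" using f by (simp add: locally_nilpotent_def)
  obtain n where n: "\<And>x. (f ^^ n) x = 0" using fin_dim_nilpotent[OF fd f] by blast
  obtain E where E: "cvec.independent E" "cvec.span E = UNIV" "\<forall>e\<in>E. cvec.representation E (f e) e = 0"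
    using nilpotent_adapted_basis[OF lin n] by blast
  show ?thesis unfolding dual_bases_trace[OF fd B db lin E(1,2)] using E(3) by simp
qed

lemma dual_bases_commute:
  assumes "\<And>x y. B x y = B y x" "dual_bases B v w"
  shows "dual_bases B w v"
  using assms by (auto simp: dual_bases_def Let_def)

text \<open>The tensor \<open>\<Sum> w\<^sub>i \<otimes> v\<^sub>i\<close> is dual to the form and is therefore annihilated by every operator that is skew for the
form.\<close>

lemma dual_bases_skew_invariant:
  fixes v w :: "nat \<Rightarrow> 'g::complex_vector"
  assumes B: "cbilinear B" and sym: "\<And>x y. B x y = B y x" and db: "dual_bases B v w"
    and f: "cbilinear f" and skew: "\<And>x y. B (N x) y + B x (N y) = 0"
  shows "(\<Sum>i=1..cvec.dim (UNIV :: 'g set). f (N (w i)) (v i) + f (w i) (N (v i))) = 0"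
proof -
  let ?I = "{1..cvec.dim (UNIV :: 'g set)}"
  note exp = dual_bases_expansion[OF B db] and exp' = dual_bases_expansion[OF B dual_bases_commute[OF sym db]]
  note fl = cbilinear_left[OF f] and fr = cbilinear_right[OF f]
  have 1: "f (N (w i)) (v i) = (\<Sum>j\<in>?I. B (v j) (N (w i)) *\<^sub>C f (w j) (v i))" for i
    by (subst exp[of "N (w i)"]) (simp only: clinear_sum[OF fl] clinear_scale[OF fl])
  have 2: "f (w i) (N (v i)) = (\<Sum>j\<in>?I. B (w j) (N (v i)) *\<^sub>C f (w i) (v j))" for i
    by (subst exp'[of "N (v i)"]) (simp only: clinear_sum[OF fr] clinear_scale[OF fr])
  have "(\<Sum>i\<in>?I. f (w i) (N (v i))) = (\<Sum>i\<in>?I. \<Sum>j\<in>?I. B (w i) (N (v j)) *\<^sub>C f (w j) (v i))"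
    unfolding 2 by (rule sum.swap)
  also have "\<dots> = (\<Sum>i\<in>?I. \<Sum>j\<in>?I. - (B (v j) (N (w i)) *\<^sub>C f (w j) (v i)))"
  proof (intro sum.cong refl)
    fix i j
    have "B (w i) (N (v j)) = - B (v j) (N (w i))"
      using skew[of "w i" "v j"] sym[of "N (w i)" "v j"] by (simp add: eq_neg_iff_add_eq_0 add.commute)
    then show "B (w i) (N (v j)) *\<^sub>C f (w j) (v i) = - (B (v j) (N (w i)) *\<^sub>C f (w j) (v i))" by simp
  qed
  also have "\<dots> = - (\<Sum>i\<in>?I. f (N (w i)) (v i))" unfolding 1 by (simp add: sum_negf)
  finally show ?thesis by (simp add: sum.distrib)
qed

section \<open>Logarithms of the eigenvalues\<close>

lemma nonzero_eq_exp_strip: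
  assumes "\<tau> \<noteq> 0"
  shows "\<exists>\<alpha>. - 1 < Re \<alpha> \<and> Re \<alpha> \<le> 0 \<and> \<tau> = exp (- 2 * of_real pi * \<i> * \<alpha>)"
proof -
  define z where "z = of_real (ln (cmod \<tau>)) + \<i> * of_real (Arg \<tau>)"
  have "exp z = rcis (cmod \<tau>) (Arg \<tau>)"
    using assms by (simp add: z_def exp_add exp_of_real rcis_def cis_conv_exp)
  then have z: "exp z = \<tau>" by (simp add: rcis_cmod_Arg)
  define \<beta> where "\<beta> = \<i> * z / (2 * of_real pi)"
  have \<beta>: "- 2 * of_real pi * \<i> * \<beta> = z" by (simp add: \<beta>_def field_simps)
  define n where "n = \<lceil>Re \<beta>\<rceil>"
  have "- 2 * of_real pi * \<i> * (\<beta> - of_int n) = - 2 * of_real pi * \<i> * \<beta> + \<i> * of_real (2 * pi * of_int n)"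
    by (simp add: algebra_simps)
  then have "exp (- 2 * of_real pi * \<i> * (\<beta> - of_int n)) = \<tau> * cis (2 * pi * of_int n)"
    by (simp only: \<beta> exp_add z cis_conv_exp)
  also have "cis (2 * pi * of_int n) = 1" by (rule cis_multiple_2pi) simp
  finally have "\<tau> = exp (- 2 * of_real pi * \<i> * (\<beta> - of_int n))" by simp
  moreover have "of_int n - 1 < Re \<beta>" "Re \<beta> \<le> of_int n" unfolding n_def by linarith+
  then have "- 1 < Re (\<beta> - of_int n)" "Re (\<beta> - of_int n) \<le> 0" by simp_all
  ultimately show ?thesis by blast
qed

lemma exp_eq_exp_imp_Ints:
  assumes "exp (2 * of_real pi * \<i> * \<gamma>) = exp (- 2 * of_real pi * \<i> * \<alpha>)"
  shows "\<gamma> + \<alpha> \<in> \<int>"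
proof -
  let ?z = "2 * of_real pi * \<i> * (\<gamma> + \<alpha>)"
  have "exp ?z = exp (2 * of_real pi * \<i> * \<gamma>) * exp (2 * of_real pi * \<i> * \<alpha>)"
    by (simp only: distrib_left exp_add)
  also have "\<dots> = exp (- (2 * of_real pi * \<i> * \<alpha>)) * exp (2 * of_real pi * \<i> * \<alpha>)" using assms by simp
  finally have e: "exp ?z = 1" by (simp flip: exp_add)
  have "exp (Re ?z) = 1" using arg_cong[OF e, of cmod] by simp
  then have "Re ?z = 0" by (simp only: exp_eq_one_iff)
  then have im: "Im (\<gamma> + \<alpha>) = 0" by simp
  have "cos (Im ?z) = 1" using arg_cong[OF e, of Re] \<open>Re ?z = 0\<close> by (simp add: Re_exp)
  then obtain n :: int where "Im ?z = of_int n * 2 * pi" using cos_one_2pi_int by blast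
  then have "Re (\<gamma> + \<alpha>) = of_int n" by simp
  then have "\<gamma> + \<alpha> = of_int n" using im by (simp add: complex_eq_iff)
  then show ?thesis by simp
qed

section \<open>The Sugawara field in a twisted module\<close>

lemma normal_ordered_zeta_free:
  assumes a: "clinear a" and b: "clinear b"
    and a0: "\<And>v \<gamma> k. a0 v \<gamma> k = (if k = 0 then a v \<gamma> 0 else 0)"
    and b0: "\<And>v \<gamma> k. b0 v \<gamma> k = (if k = 0 then b v \<gamma> 0 else 0)"
  shows "normal_ordered a0 b0 v \<gamma> k = (if k = 0 then normal_ordered a b v \<gamma> 0 else 0)"
proof -
  let ?F = "\<lambda>a b. comp12 (plus_part a) b v + comp21 b (minus_part a) v"
  have F: "?F a0 b0 \<gamma>1 \<gamma>2 k1 k2 = (if k1 = 0 \<and> k2 = 0 then ?F a b \<gamma>1 \<gamma>2 0 0 else 0)" for \<gamma>1 \<gamma>2 k1 k2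
    by (auto simp: comp12_def comp21_def plus_part_def minus_part_def a0 b0 clinear_zero[OF a] clinear_zero[OF b])
  show ?thesis
  proof (cases k)
    case 0
    then show ?thesis by (simp add: normal_ordered_def diag_subst_def F del: plus_fun_apply)
  next
    case (Suc k')
    then have "(\<Sum>i\<le>k. ?F a0 b0 \<gamma>1 \<gamma>2 i (k - i)) = 0" for \<gamma>1 \<gamma>2
      by (intro sum.neutral) (simp add: F del: plus_fun_apply)
    then show ?thesis using Suc by (simp add: normal_ordered_def diag_subst_def del: plus_fun_apply)
  qed
qed

text \<open>Locality of a fixed order is a linear condition, so it is enough to bound the orders on a finite spanning set.\<close>

lemma local_order_common:
  assumes fd: "fin_dim TYPE('g::complex_vector)" and y: "clinear (y :: 'g \<Rightarrow> 'w::complex_vector lfield)"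
    and b: "clinear b" and loc: "\<And>a. \<exists>N. local_order N (y a) b"
  shows "\<exists>N\<ge>M. \<forall>a. local_order N (y a) b"
proof -
  obtain T :: "'g set" where T: "finite T" "cvec.span T = UNIV" using fd by (auto simp: fin_dim_def)
  obtain d where d: "\<And>a. local_order (d a) (y a) b" using loc by metis
  define N where "N = M + (\<Sum>t\<in>T. d t)"
  have zN: "clinear (z12_times ^^ N :: 'w series2 \<Rightarrow> _)" by (rule clinear_funpow[OF clinear_z12_times])
  have "local_order N (y a) b" for a
  proof -
    have "a \<in> cvec.span T" using T by simp
    then show ?thesis
    proof (induction rule: cvec.span_induct)
      have c12: "comp12 (y (a + a')) b v = comp12 (y a) b v + comp12 (y a') b v"
        "comp12 (y (c *\<^sub>C a)) b v = c *\<^sub>C comp12 (y a) b v"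
        "comp12 (y 0) b v = 0" for a a' c v
        by (auto simp: comp12_def fun_eq_iff clinear_add[OF y] clinear_scale[OF y] clinear_zero[OF y] scaleC_fun_def)
      have c21: "comp21 b (y (a + a')) v = comp21 b (y a) v + comp21 b (y a') v"
        "comp21 b (y (c *\<^sub>C a)) v = c *\<^sub>C comp21 b (y a) v"
        "comp21 b (y 0) v = 0" for a a' c v
        by (auto simp: comp21_def fun_eq_iff clinear_add[OF y] clinear_scale[OF y] clinear_zero[OF y] scaleC_fun_def
            clinear_add[OF b] clinear_scale[OF b, unfolded scaleC_fun_def] clinear_zero[OF b])
      show "cvec.subspace {a. local_order N (y a) b}"
        by (rule cvec.subspaceI)
          (simp_all only: local_order_def mem_Collect_eq c12 c21 clinear_add[OF zN] clinear_scale[OF zN] simp_thms)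
      show "local_order N (y t) b" if "t \<in> T" for t
        by (rule local_order_mono[OF d[of t]]) (use T(1) that in \<open>simp add: N_def member_le_sum trans_le_add2\<close>)
    qed
  qed
  then show ?thesis unfolding N_def by (intro exI[of _ "M + (\<Sum>t\<in>T. d t)"]) simp
qed

lemma is_S_op_commute:
  assumes J: "jordan_decomp \<phi> \<sigma> \<N>" and inj: "inj \<phi>" and S: "is_S_op \<sigma> \<S>"
  shows "\<S> (\<N> a) = \<N> (\<S> a)"
proof (rule clinear_eq_on_eigenvectors[OF jordan_decompD(1)[OF J], where f = "\<lambda>a. \<S> (\<N> a)" and g = "\<lambda>a. \<N> (\<S> a)"])
  note lN = jordan_decompD(4)[OF J]
  have lS: "clinear \<S>" using S by (simp add: is_S_op_def)
  show "clinear (\<lambda>a. \<S> (\<N> a))" "clinear (\<lambda>a. \<N> (\<S> a))"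
    by (simp_all add: clinear_iff clinear_add[OF lN] clinear_scale[OF lN] clinear_add[OF lS] clinear_scale[OF lS])
  fix \<tau> a assume a: "\<sigma> a = \<tau> *\<^sub>C a"
  show "\<S> (\<N> a) = \<N> (\<S> a)"
  proof (cases "a = 0")
    case True then show ?thesis by (simp add: clinear_zero[OF lN] clinear_zero[OF lS])
  next
    case False
    then obtain \<alpha> where \<alpha>: "- 1 < Re \<alpha>" "Re \<alpha> \<le> 0" "\<tau> = exp (- 2 * of_real pi * \<i> * \<alpha>)"
      using nonzero_eq_exp_strip jordan_eigenvector_nonzero[OF J inj a] by blast
    have "\<sigma> (\<N> a) = \<tau> *\<^sub>C \<N> a" by (simp add: jordan_decompD(5)[OF J] a clinear_scale[OF lN])
    then have "\<S> (\<N> a) = \<alpha> *\<^sub>C \<N> a" "\<S> a = \<alpha> *\<^sub>C a" using S a \<alpha> unfolding is_S_op_def by blast+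
    then show ?thesis by (simp add: clinear_scale[OF lN])
  qed
qed

theorem lemma6p4:
  fixes br :: "'g::complex_vector \<Rightarrow> 'g \<Rightarrow> 'g"
    and B :: "'g \<Rightarrow> 'g \<Rightarrow> complex"
    and h \<kappa> :: complex
    and vac :: "'v::complex_vector"
    and pr :: "int \<Rightarrow> 'v \<Rightarrow> 'v \<Rightarrow> 'v"
    and \<rho> :: "'g affine \<Rightarrow> 'v \<Rightarrow> 'v"
    and \<phi> \<sigma> \<N> \<S> :: "'g \<Rightarrow> 'g"
    and \<phi>V \<sigma>V \<N>V :: "'v \<Rightarrow> 'v"
    and v_low v_up :: "nat \<Rightarrow> 'g"
    and Y :: "'v \<Rightarrow> 'w::complex_vector lfield"
    and \<iota> :: "'g \<Rightarrow> 'v"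
    and X :: "'v \<Rightarrow> 'w lfield"
    and \<omega> :: 'v
    and \<omega>bar :: 'g
  assumes "fin_dim TYPE('g)"
    and "lie_algebra br"
    and "nondeg_inv_form br B"
    and "simple_lie br \<and> normalized_form br B \<or> abelian_lie br"
    and "h = of_nat (dual_coxeter br B)"
    and "\<kappa> \<noteq> - h"
    and "universal_affine_va br B \<kappa> vac pr \<rho>"
    and "\<iota> = affine_embed vac \<rho>"
    and "lie_automorphism br \<phi>"
    and "\<forall>a b. B (\<phi> a) (\<phi> b) = B a b"
    and "va_automorphism vac pr \<phi>V" and "\<forall>a. \<phi>V (\<iota> a) = \<iota> (\<phi> a)"
    and "jordan_decomp \<phi> \<sigma> \<N>"
    and "jordan_decomp \<phi>V \<sigma>V \<N>V"
    and "is_S_op \<sigma> \<S>"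
    and "dual_bases B v_low v_up"
    and "\<omega> = (1 / (2 * (\<kappa> + h))) *\<^sub>C
           (\<Sum>i=1..cvec.dim (UNIV :: 'g set). pr (-1) (\<iota> (v_up i)) (\<iota> (v_low i)))"
    and "\<omega>bar = (\<Sum>i=1..cvec.dim (UNIV :: 'g set).
           br (\<S> (v_up i) + \<N> (v_up i)) (v_low i))"
    and "twisted_module vac pr \<phi>V Y"
    and "X = X_field \<N>V Y"
  shows "(2 * (\<kappa> + h)) *\<^sub>C Y \<omega> =
    (\<Sum>i=1..cvec.dim (UNIV :: 'g set). normal_ordered (X (\<iota> (v_up i))) (X (\<iota> (v_low i))))
    - z_times (-1) (X (\<iota> \<omega>bar))
    - z_times (-2) ((\<kappa> * op_trace (op_choose_2 \<S>)) *\<^sub>C id_field)"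
proof -
  let ?I = "{1..cvec.dim (UNIV :: 'g set)}"
  note fd = assms(1) and U = assms(7)
  have br: "cbilinear br" using assms(2) by (simp add: lie_algebra_def)
  have B: "cbilinear B" and sym: "\<And>x y. B x y = B y x" using assms(3) by (auto simp: nondeg_inv_form_def)
  have inj: "inj \<phi>" using assms(9) by (simp add: lie_automorphism_def bij_is_inj)
  have injV: "inj \<phi>V" and autV: "\<And>n a b. \<phi>V (pr n a b) = pr n (\<phi>V a) (\<phi>V b)"
    using assms(11) by (simp_all add: va_automorphism_def bij_is_inj)
  note J = assms(13) and JV = assms(14)
  have S: "clinear \<S>" using assms(15) by (simp add: is_S_op_def)
  note N = jordan_decompD(4)[OF J]
  note db = assms(16)
  have Y: "clinear Y" and YL: "\<And>a. Y a \<in> LFie" and Yvac: "Y vac = id_field"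
    and Yloc: "\<And>a b. \<exists>N. local_order N (Y a) (Y b)" and Ymon: "\<And>a. Y (\<phi>V a) = monodromy (Y a)"
    and Yprod: "\<And>n a b. field_prod n (Y a) (Y b) = Y (pr n a b)"
    using assms(19) by (auto simp: twisted_module_def local_collection_def)
  have \<iota>: "clinear \<iota>" and pr0: "\<And>a b. pr 0 (\<iota> a) (\<iota> b) = \<iota> (br a b)"
    and pr1: "\<And>a b. pr 1 (\<iota> a) (\<iota> b) = (\<kappa> * B a b) *\<^sub>C vac"
    and pr2: "\<And>a b m. m \<ge> 2 \<Longrightarrow> pr m (\<iota> a) (\<iota> b) = 0"
    unfolding assms(8) using clinear_affine_embed[OF U br B] affine_product_0[OF U br B]
      affine_product_1[OF U br B] affine_product_ge_2[OF U br B] by auto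
  have pr: "cbilinear (pr (-1))" using U by (simp add: universal_affine_va_def vertex_algebra_def)

  have \<iota>\<phi>: "\<phi>V (\<iota> a) = \<iota> (\<phi> a)" for a using assms(12) by blast
  have \<iota>N: "\<N>V (\<iota> a) = \<iota> (\<N> a)" for a by (rule jordan_linear_nilpotent[OF J JV \<iota> \<iota>\<phi> inj])
  have skew: "B (\<N> x) y + B x (\<N> y) = 0" for x y
    by (rule jordan_bilinear_nilpotent[OF J J jordan_decomp_id_complex inj inj B, symmetric])
      (use assms(10) in simp)
  have derivY: "of_nat (Suc k) *\<^sub>C Y a w \<gamma> (Suc k) = - Y (\<N>V a) w \<gamma> k" for a w \<gamma> k
    by (rule twisted_zeta_derivative[OF Y LFie_finite[OF YL] Ymon JV injV])
  have X: "X a w \<gamma> k = (if k = 0 then Y a w \<gamma> 0 else 0)" for a w \<gamma> k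
    unfolding assms(20) by (rule X_field_eq) (rule derivY)
  have SN: "\<S> (\<N> a) = \<N> (\<S> a)" for a by (rule is_S_op_commute[OF J inj assms(15)])

  let ?T = "\<lambda>a. \<S> a + \<N> a"
  define y where "y a = Y (\<iota> a)" for a
  have y: "clinear y"
    by (simp add: clinear_iff y_def clinear_add[OF Y] clinear_add[OF \<iota>] clinear_scale[OF Y] clinear_scale[OF \<iota>])
  \<comment> \<open>The expansion stops at \<open>j = 2\<close>, because of the products of elements of \<open>\<gg>\<close>.\<close>
  have expansion: "normal_ordered (y a) (y b) w \<gamma> k = Y (pr (-1) (\<iota> a) (\<iota> b)) w \<gamma> k
      + Y (\<iota> (br (?T a) b)) w (\<gamma> + 1) k + (\<kappa> / 2 * B (?T (?T a) - ?T a) b) *\<^sub>C id_field w (\<gamma> + 2) k"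
    for a b w \<gamma> k
  proof -
    \<comment> \<open>The bound \<open>M \<ge> 2\<close> makes all three terms occur in the sum.\<close>
    obtain M where M: "M \<ge> 2" "\<And>a. local_order M (y a) (y b)"
      using local_order_common[OF fd y, of "y b" 2] LFie_clinear[OF YL] Yloc unfolding y_def by blast
    let ?ff = "falling_factorial_op ?T"
    let ?t = "\<lambda>j. (1 / fact j) *\<^sub>C Y (pr (int j - 1) (\<iota> (?ff j a)) (\<iota> b)) w (\<gamma> + of_nat j) k"
    have eig: "\<exists>\<alpha>. - 1 < Re \<alpha> \<and> Re \<alpha> \<le> 0 \<and> \<S> a = \<alpha> *\<^sub>C a \<and> (\<forall>v \<gamma> k. y a v \<gamma> k \<noteq> 0 \<longrightarrow> \<gamma> + \<alpha> \<in> \<int>)"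
      if a: "a \<in> {a. \<exists>\<tau>. \<sigma> a = \<tau> *\<^sub>C a}" for a
    proof (cases "a = 0")
      case True
      then show ?thesis by (intro exI[of _ 0]) (simp add: clinear_zero[OF S] clinear_zero[OF y])
    next
      case False
      obtain \<tau> where \<tau>: "\<sigma> a = \<tau> *\<^sub>C a" using a by blast
      obtain \<alpha> where \<alpha>: "- 1 < Re \<alpha>" "Re \<alpha> \<le> 0" "\<tau> = exp (- 2 * of_real pi * \<i> * \<alpha>)"
        using nonzero_eq_exp_strip jordan_eigenvector_nonzero[OF J inj \<tau> False] by blast
      have "\<S> a = \<alpha> *\<^sub>C a" using assms(15) \<tau> \<alpha> unfolding is_S_op_def by blast
      moreover have "\<gamma> + \<alpha> \<in> \<int>" if "y a v \<gamma> k \<noteq> 0" for v \<gamma> k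
      proof (rule exp_eq_exp_imp_Ints)
        have "\<sigma>V (\<iota> a) = \<tau> *\<^sub>C \<iota> a" by (rule jordan_linear_semisimple_eigenvector[OF J JV \<iota> \<iota>\<phi> \<tau>])
        from twisted_exponents[OF Y LFie_finite[OF YL] Ymon JV this] that
        show "exp (2 * of_real pi * \<i> * \<gamma>) = exp (- 2 * of_real pi * \<i> * \<alpha>)" unfolding y_def \<alpha>(3) by blast
      qed
      ultimately show ?thesis using \<alpha>(1,2) by blast
    qed
    have "normal_ordered (y a) (y b) w \<gamma> k =
      (\<Sum>j\<le>M. (1 / fact j) *\<^sub>C field_prod (int j - 1) (y (?ff j a)) (y b) w (\<gamma> + of_nat j) k)"
    proof (rule normal_ordered_expansion[OF y _ _ M(2) S N SN])
      show "cvec.span {a. \<exists>\<tau>. \<sigma> a = \<tau> *\<^sub>C a} = UNIV"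
        using jordan_decompD(1)[OF J] by (simp add: semisimple_op_def)
      show "of_nat (Suc k) *\<^sub>C y a v \<gamma> (Suc k) = - y (\<N> a) v \<gamma> k" for a v \<gamma> k
        unfolding y_def derivY \<iota>N ..
    qed (use YL eig in \<open>auto simp: y_def\<close>)
    also have "\<dots> = (\<Sum>j\<le>M. ?t j)" by (simp only: y_def Yprod)
    also have "\<dots> = (\<Sum>j\<in>{0, 1, 2}. ?t j)"
    proof (rule sum.mono_neutral_right)
      show "\<forall>j\<in>{..M} - {0, 1, 2}. ?t j = 0"
      proof
        fix j assume "j \<in> {..M} - {0, 1, 2}"
        then have "int j - 1 \<ge> 2" by auto
        then show "?t j = 0" by (simp add: pr2 clinear_zero[OF Y])
      qed
    qed (use M(1) in auto)
    also have "\<dots> = ?t 0 + (?t 1 + ?t 2)" by simp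
    also have "?t 0 = Y (pr (-1) (\<iota> a) (\<iota> b)) w \<gamma> k" by (simp add: scaleC_one)
    also have "?t 1 = Y (\<iota> (br (?T a) b)) w (\<gamma> + 1) k" by (simp add: pr0 scaleC_one)
    also have "?t 2 = (\<kappa> / 2 * B (?T (?T a) - ?T a) b) *\<^sub>C id_field w (\<gamma> + 2) k"
      by (simp add: pr1 numeral_2_eq_2 scaleC_one clinear_scale[OF Y] Yvac scaleC_fun_def scaleC_scaleC)
    finally show ?thesis by (simp only: add.assoc)
  qed

  define \<omega>' where "\<omega>' = (\<Sum>i\<in>?I. pr (-1) (\<iota> (v_up i)) (\<iota> (v_low i)))"
  have "\<kappa> + h \<noteq> 0" using assms(6) by (simp add: eq_neg_iff_add_eq_0)
  then have "2 * (\<kappa> + h) * (1 / (2 * (\<kappa> + h))) = 1" by (simp del: distrib_left_numeral)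
  then have lhs: "(2 * (\<kappa> + h)) *\<^sub>C Y \<omega> = Y \<omega>'"
    by (simp only: assms(17) \<omega>'_def[symmetric] clinear_scale[OF Y] scaleC_scaleC scaleC_one)
  have N\<omega>: "\<N>V \<omega>' = 0"
  proof -
    have "cbilinear (\<lambda>a b. pr (-1) (\<iota> a) (\<iota> b))"
      by (simp add: cbilinear_def clinear_iff clinear_add[OF \<iota>] clinear_scale[OF \<iota>] clinear_add[OF cbilinear_left[OF pr]]
          clinear_scale[OF cbilinear_left[OF pr]] clinear_add[OF cbilinear_right[OF pr]] clinear_scale[OF cbilinear_right[OF pr]])
    from dual_bases_skew_invariant[OF B sym db this skew]
    show ?thesis
      by (simp add: \<omega>'_def clinear_sum[OF jordan_decompD(4)[OF JV]] \<iota>N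
          jordan_bilinear_nilpotent[OF JV JV JV injV injV pr autV])
  qed
  have trace: "(\<Sum>i\<in>?I. B (?T (?T (v_up i)) - ?T (v_up i)) (v_low i)) = 2 * op_trace (op_choose_2 \<S>)"
  proof -
    \<comment> \<open>\<open>T(T - 1) = \<S>(\<S> - 1) + \<N> R\<close>, where \<open>\<N> R\<close> is nilpotent because \<open>R\<close> commutes with \<open>\<N>\<close>.\<close>
    define R where "R a = 2 *\<^sub>C \<S> a + \<N> a - a" for a
    have lR: "clinear R"
      by (simp add: R_def clinear_iff clinear_add[OF S] clinear_scale[OF S] clinear_add[OF N] clinear_scale[OF N]
          scaleC_add_right cvec.scale_right_diff_distrib scaleC_scaleC mult.commute)
    have RN: "R (\<N> a) = \<N> (R a)" for a
      by (simp add: R_def clinear_add[OF N] clinear_diff[OF N] clinear_scale[OF N] SN)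
    have RNn: "R ((\<N> ^^ n) a) = (\<N> ^^ n) (R a)" for n a by (induction n) (simp_all add: RN)
    have "locally_nilpotent (\<lambda>a. \<N> (R a))"
      unfolding locally_nilpotent_def
    proof (intro conjI allI)
      show "clinear (\<lambda>a. \<N> (R a))"
        using lR N by (simp only: clinear_iff) simp
      fix x
      obtain n where n: "(\<N> ^^ n) x = 0" using jordan_decompD(3)[OF J] by (auto simp: locally_nilpotent_def)
      have "((\<lambda>a. \<N> (R a)) ^^ m) x = (R ^^ m) ((\<N> ^^ m) x)" for m
      proof (induction m)
        case (Suc m)
        have "\<N> ((R ^^ k) z) = (R ^^ k) (\<N> z)" for k z by (induction k) (simp_all add: RN[symmetric])
        then have "\<N> (R ((R ^^ m) ((\<N> ^^ m) x))) = R ((R ^^ m) (\<N> ((\<N> ^^ m) x)))" by (simp only: RN[symmetric])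
        then show ?case by (simp only: funpow.simps comp_apply Suc)
      qed simp
      then show "\<exists>n. ((\<lambda>a. \<N> (R a)) ^^ n) x = 0"
        using n clinear_zero[OF clinear_funpow[OF lR]] by metis
    qed
    from dual_bases_trace_nilpotent[OF fd B db this]
    have nil: "(\<Sum>i\<in>?I. B (v_low i) (\<N> (R (v_up i)))) = 0" .
    have lC: "clinear (op_choose_2 \<S>)"
      by (simp add: clinear_iff op_choose_2_def clinear_add[OF S] clinear_diff[OF S] clinear_scale[OF S]
          scaleC_add_right cvec.scale_right_diff_distrib scaleC_scaleC mult.commute)
    have eq: "?T (?T a) - ?T a = 2 *\<^sub>C op_choose_2 \<S> a + \<N> (R a)" for a
    proof -
      have two: "2 *\<^sub>C x = x + x" for x :: 'g
        using scaleC_add_left[of 1 1 x] by (simp add: scaleC_one)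
      show ?thesis
        by (simp add: R_def op_choose_2_def scaleC_scaleC scaleC_one clinear_add[OF S] clinear_diff[OF S] clinear_add[OF N]
            clinear_diff[OF N] SN two)
    qed
    note Br = cbilinear_right[OF B]
    have "(\<Sum>i\<in>?I. B (?T (?T (v_up i)) - ?T (v_up i)) (v_low i)) =
        (\<Sum>i\<in>?I. 2 * B (v_low i) (op_choose_2 \<S> (v_up i)) + B (v_low i) (\<N> (R (v_up i))))"
      by (simp only: eq sym[of _ "v_low _"] clinear_add[OF Br] clinear_scale[OF Br] scaleC_complex_def)
    also have "\<dots> = 2 * op_trace (op_choose_2 \<S>)"
      by (simp only: sum.distrib nil sum_distrib_left[symmetric] op_trace_eq[OF fd B db lC] add_0_right)
    finally show ?thesis .
  qed

  have Xno: "normal_ordered (X (\<iota> a)) (X (\<iota> b)) w \<gamma> k = (if k = 0 then normal_ordered (y a) (y b) w \<gamma> 0 else 0)" for a b w \<gamma> k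
    unfolding y_def by (rule normal_ordered_zeta_free[OF LFie_clinear[OF YL] LFie_clinear[OF YL] X X])
  have \<iota>\<omega>: "Y (\<iota> \<omega>bar) = (\<Sum>i\<in>?I. Y (\<iota> (br (?T (v_up i)) (v_low i))))"
    by (simp only: assms(18) clinear_sum[OF \<iota>] clinear_sum[OF Y])
  show ?thesis
    unfolding lhs
  proof (intro ext)
    fix w \<gamma> k
    let ?rhs = "(\<Sum>i\<in>?I. normal_ordered (X (\<iota> (v_up i))) (X (\<iota> (v_low i))) w \<gamma> k)
        - X (\<iota> \<omega>bar) w (\<gamma> + 1) k - (\<kappa> * op_trace (op_choose_2 \<S>)) *\<^sub>C id_field w (\<gamma> + 2) k"
    have "Y \<omega>' w \<gamma> k = ?rhs"
    proof (cases k)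
      case (Suc k')
      have "of_nat (Suc k') *\<^sub>C Y \<omega>' w \<gamma> (Suc k') = 0"
        unfolding derivY N\<omega> by (simp add: clinear_zero[OF Y])
      then have "Y \<omega>' w \<gamma> k = 0" unfolding Suc by (simp del: of_nat_Suc)
      then show ?thesis by (simp add: Suc Xno X id_field_def)
    next
      case 0
      have "(\<Sum>i\<in>?I. normal_ordered (X (\<iota> (v_up i))) (X (\<iota> (v_low i))) w \<gamma> 0) =
          (\<Sum>i\<in>?I. Y (pr (-1) (\<iota> (v_up i)) (\<iota> (v_low i))) w \<gamma> 0) + (\<Sum>i\<in>?I. Y (\<iota> (br (?T (v_up i)) (v_low i))) w (\<gamma> + 1) 0)
          + (\<kappa> / 2 * (\<Sum>i\<in>?I. B (?T (?T (v_up i)) - ?T (v_up i)) (v_low i))) *\<^sub>C id_field w (\<gamma> + 2) 0"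
        by (simp only: Xno simp_thms if_True expansion sum.distrib cvec.scale_sum_left[symmetric] sum_distrib_left[symmetric])
      also have "(\<Sum>i\<in>?I. Y (pr (-1) (\<iota> (v_up i)) (\<iota> (v_low i))) w \<gamma> 0) = Y \<omega>' w \<gamma> 0"
        by (simp only: \<omega>'_def clinear_sum[OF Y] sum_apply)
      also have "(\<Sum>i\<in>?I. Y (\<iota> (br (?T (v_up i)) (v_low i))) w (\<gamma> + 1) 0) = X (\<iota> \<omega>bar) w (\<gamma> + 1) 0"
        by (simp only: X simp_thms if_True \<iota>\<omega> sum_apply)
      finally show ?thesis unfolding trace 0 by simp
    qed
    then show "Y \<omega>' w \<gamma> k = ((\<Sum>i\<in>?I. normal_ordered (X (\<iota> (v_up i))) (X (\<iota> (v_low i))))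
        - z_times (-1) (X (\<iota> \<omega>bar)) - z_times (-2) ((\<kappa> * op_trace (op_choose_2 \<S>)) *\<^sub>C id_field)) w \<gamma> k"
      by (simp only: fun_diff_def sum_apply z_times_def scaleC_fun_def diff_minus_eq_add)
  qed
qed

end
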